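(* Let $\Omega$ be a bounded smooth pseudoconvex domain in $\mathbb{C}^n$ such that the Bergman kernel $K_\Omega$ is of sharp $\mathcal B$-type. Assume further that there are universal constants $\lambda>0$ and $C>0$ such that for any $z\in\Omega$ near the boundary $b\Omega$, after mapping by the biholomorphism $\Phi_z$ from the definition of sharp $\mathcal B$-type, the $\mathcal B$-system associated to $z':=\Phi_z(z)$ has the property: $P_\lambda(z')\subset\Omega':=\Phi_z(\Omega)$ and $K_{\Omega'}(w',w')\le C\,K_{\Omega'}(z',z')$ for all $w'\in P_\lambda(z')$. Let $\alpha\ge0$ and let $T_{K_\Omega^{-\alpha}}$ be the Bergman-Toeplitz operator with symbol $\psi(z)=K_\Omega(z,z)^{-\alpha}$. If $T_{K_\Omega^{-\alpha}}:L^p(\Omega)\to L^q(\Omega)$ continuously with $1<p\le q<\infty$, then $\alpha\ge\frac1p-\frac1q$.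
   Context: For a bounded domain $D\subset\mathbb{C}^n$: $bD$ is its boundary, $K_D(z,w)$ its Bergman kernel, $r_D$ its negative distance function ($|r_D(z)|$ is the distance from $z$ to $bD$), and $\mathbb B(z,c)$ is the Euclidean ball. For $\psi\in L^\infty(\Omega)$ the Bergman-Toeplitz operator with symbol $\psi$ is $T_\psi f(z)=\int_\Omega K_\Omega(z,w)\psi(w)f(w)\,dw$ ($dw$ Lebesgue measure). In the definitions below, $C,\tilde C$ denote universal positive constants, depending only on $\Omega$. $\mathcal B$-system. Let $\Omega'$ be a bounded domain in $\mathbb{C}^n$ and $z'\in\overline{\Omega'}$ near $b\Omega'$. A family $\{b_j(z',\cdot)\}_{j=1}^n$ is a $\mathcal B$-system at $z'$ if there exist a neighbourhood $U$ of $z'$ and an integer $m\ge2$ such that for all $w'\in U$ $$b_1(z',w')=\frac1{\delta(z',w')},\qquad b_j(z',w')=\sum_{k=2}^m\left(\frac{A_{jk}(z')}{\delta(z',w')}\right)^{1/k}\ (j=2,\dots,n),$$ where $A_{jk}:U\to[0,\infty)$ are bounded functions and $\delta(z',w')$ is the pseudo-distance $$\delta(z',w')=|r_{\Omega'}(z')|+|r_{\Omega'}(w')|+|z_1'-w_1'|+\sum_{l=2}^n\sum_{s=2}^m A_{ls}(z')|z_l'-w_l'|^s,$$ under a proper system of coordinates (as in McNeal and Stein's 1994 work on convex domains of finite type). The $\mathcal B$-polydisc with centre $z'$ is $P_\lambda(z')=\{w'\in\mathbb{C}^n: |w_j'-z_j'|\,b_j(z',z')\le\lambda \text{ for all } j=1,\dots,n\}$.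 Local type. With $\{b_j(z',\cdot)\}$ a $\mathcal B$-system at $z'$, $K_{\Omega'}$ is of $\mathcal B$-type at $z'$ if there exists a constant $c>0$ such that $|K_{\Omega'}(z',w')|\le C\prod_{j=1}^n b_j(z',w')^2$ for all $w'\in\Omega'\cap\mathbb B(z',c)$. It is of sharp $\mathcal B$-type at $z'$ if it is of $\mathcal B$-type and $\tilde C\prod_{j=1}^n b_j(z',z')^2\le K_{\Omega'}(z',z')\le C\prod_{j=1}^n b_j(z',z')^2$. Global type. $K_\Omega$ is of sharp $\mathcal B$-type if (i) $K_\Omega\in C(\overline\Omega\times\overline\Omega\setminus\Delta_b)$, where $\Delta_b=\{(z,z):z\in b\Omega\}$; and (ii) for all $z\in\overline\Omega$ near $b\Omega$ there exists a biholomorphism $\Phi_z$ whose holomorphic Jacobian is uniformly nonsingular so that the Bergman kernel $K_{\Omega'}$ of $\Omega':=\Phi_z(\Omega)$ is of sharp $\mathcal B$-type at $z':=\Phi_z(z)$. *)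

theory Defs
  imports "HOL-Analysis.Analysis"
begin

definition holomorphic_fun_on :: "(complex ^ 'n \<Rightarrow> complex) \<Rightarrow> (complex ^ 'n) set \<Rightarrow> bool" where
  "holomorphic_fun_on f S \<longleftrightarrow>
     (\<forall>z\<in>S. \<exists>D. (f has_derivative D) (at z) \<and> (\<forall>c v. D (c *s v) = c * D v))"

definition holomorphic_map_on ::
  "(complex ^ 'n \<Rightarrow> complex ^ 'm) \<Rightarrow> (complex ^ 'n) set \<Rightarrow> bool" where
  "holomorphic_map_on F S \<longleftrightarrow> (\<forall>i. holomorphic_fun_on (\<lambda>z. F z $ i) S)"

definition biholomorphic_on ::
  "(complex ^ 'n \<Rightarrow> complex ^ 'n) \<Rightarrow> (complex ^ 'n) set \<Rightarrow> bool" where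
  "biholomorphic_on F S \<longleftrightarrow>
     holomorphic_map_on F S \<and> inj_on F S \<and> open (F ` S) \<and>
     holomorphic_map_on (inv_into S F) (F ` S)"

text \<open>Determinant of the complex Jacobian matrix \<open>\<partial>F\<^sub>i/\<partial>z\<^sub>j\<close>, for holomorphic \<open>F\<close>.\<close>

definition holo_jacobian :: "(complex ^ 'n \<Rightarrow> complex ^ 'n) \<Rightarrow> complex ^ 'n \<Rightarrow> complex" where
  "holo_jacobian F z = det (matrix (frechet_derivative F (at z)) :: complex ^ 'n ^ 'n)"

definition bounded_domain :: "'a::real_normed_vector set \<Rightarrow> bool" where
  "bounded_domain D \<longleftrightarrow> open D \<and> connected D \<and> D \<noteq> {} \<and> bounded D"

text \<open>\<open>C\<^sup>k\<close> regularity on an open set, by recursion over directional derivatives along the basis.\<close>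

primrec Ck_on :: "nat \<Rightarrow> ('a::euclidean_space \<Rightarrow> real) \<Rightarrow> 'a set \<Rightarrow> bool" where
  "Ck_on 0 f S \<longleftrightarrow> continuous_on S f"
| "Ck_on (Suc k) f S \<longleftrightarrow>
     (\<forall>x\<in>S. f differentiable (at x)) \<and>
     (\<forall>v\<in>Basis. Ck_on k (\<lambda>x. frechet_derivative f (at x) v) S)"

definition smooth_on :: "('a::euclidean_space \<Rightarrow> real) \<Rightarrow> 'a set \<Rightarrow> bool" where
  "smooth_on f S \<longleftrightarrow> (\<forall>k. Ck_on k f S)"

definition smooth_defining_function ::
  "('a::euclidean_space \<Rightarrow> real) \<Rightarrow> 'a set \<Rightarrow> 'a set \<Rightarrow> bool" where
  "smooth_defining_function \<rho> U D \<longleftrightarrow>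
     open U \<and> frontier D \<subseteq> U \<and> smooth_on \<rho> U \<and>
     D \<inter> U = {z\<in>U. \<rho> z < 0} \<and> frontier D = {z\<in>U. \<rho> z = 0} \<and>
     (\<forall>z\<in>frontier D. frechet_derivative \<rho> (at z) \<noteq> (\<lambda>v. 0))"

definition wirt_dz :: "'n \<Rightarrow> (complex ^ 'n \<Rightarrow> complex) \<Rightarrow> complex ^ 'n \<Rightarrow> complex" where
  "wirt_dz j f z =
     (frechet_derivative f (at z) (axis j 1) - \<i> * frechet_derivative f (at z) (axis j \<i>)) / 2"

definition wirt_dzbar :: "'n \<Rightarrow> (complex ^ 'n \<Rightarrow> complex) \<Rightarrow> complex ^ 'n \<Rightarrow> complex" where
  "wirt_dzbar j f z =
     (frechet_derivative f (at z) (axis j 1) + \<i> * frechet_derivative f (at z) (axis j \<i>)) / 2"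

text \<open>For real-valued \<open>C\<^sup>2\<close> functions the Hermitian sum below is real, so \<open>Re\<close> loses nothing.\<close>

definition levi_form :: "(complex ^ 'n \<Rightarrow> real) \<Rightarrow> complex ^ 'n \<Rightarrow> complex ^ 'n \<Rightarrow> real" where
  "levi_form \<rho> z \<xi> =
     Re (\<Sum>j\<in>UNIV. \<Sum>k\<in>UNIV.
           wirt_dz j (wirt_dzbar k (\<lambda>w. of_real (\<rho> w))) z * \<xi> $ j * cnj (\<xi> $ k))"

definition complex_tangent :: "(complex ^ 'n \<Rightarrow> real) \<Rightarrow> complex ^ 'n \<Rightarrow> (complex ^ 'n) set" where
  "complex_tangent \<rho> z = {\<xi>. (\<Sum>j\<in>UNIV. wirt_dz j (\<lambda>w. of_real (\<rho> w)) z * \<xi> $ j) = 0}"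

definition smooth_pseudoconvex :: "(complex ^ 'n) set \<Rightarrow> bool" where
  "smooth_pseudoconvex D \<longleftrightarrow>
     (\<exists>\<rho> U. smooth_defining_function \<rho> U D \<and>
        (\<forall>z\<in>frontier D. \<forall>\<xi>\<in>complex_tangent \<rho> z. levi_form \<rho> z \<xi> \<ge> 0))"

definition bergman_space :: "(complex ^ 'n) set \<Rightarrow> (complex ^ 'n \<Rightarrow> complex) set" where
  "bergman_space D =
     {f. holomorphic_fun_on f D \<and> integrable (lebesgue_on D) (\<lambda>w. (cmod (f w))\<^sup>2)}"

text \<open>The reproducing kernel of the Bergman space; the normalisation off \<open>D \<times> D\<close> only serves to
  make the description unique as a total function.\<close>

definition bergman_kernel :: "(complex ^ 'n) set \<Rightarrow> complex ^ 'n \<Rightarrow> complex ^ 'n \<Rightarrow> complex" where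
  "bergman_kernel D = (THE K.
     (\<forall>z\<in>D. (\<lambda>w. cnj (K z w)) \<in> bergman_space D \<and>
        (\<forall>f\<in>bergman_space D. f z = (\<integral>w. K z w * f w \<partial>lebesgue_on D))) \<and>
     (\<forall>z w. z \<notin> D \<or> w \<notin> D \<longrightarrow> K z w = 0))"

text \<open>\<open>K\<^sub>D(z,z)\<close> as a real number; it is real and nonnegative.\<close>

definition bergman_diag :: "(complex ^ 'n) set \<Rightarrow> complex ^ 'n \<Rightarrow> real" where
  "bergman_diag D z = Re (bergman_kernel D z z)"

text \<open>\<open>L\<close> is the value at \<open>(z,w)\<close>, in the closure of \<open>D \<times> D\<close>, of the continuous extension of the
  kernel. On \<open>D \<times> D\<close> this is the kernel itself, which is continuous there.\<close>

definition bergman_kernel_value ::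
  "(complex ^ 'n) set \<Rightarrow> complex ^ 'n \<Rightarrow> complex ^ 'n \<Rightarrow> complex \<Rightarrow> bool" where
  "bergman_kernel_value D z w L \<longleftrightarrow>
     (if z \<in> D \<and> w \<in> D then L = bergman_kernel D z w
      else ((\<lambda>(x, y). bergman_kernel D x y) \<longlongrightarrow> L) (at (z, w) within D \<times> D))"

definition neg_dist :: "(complex ^ 'n) set \<Rightarrow> complex ^ 'n \<Rightarrow> real" where
  "neg_dist D z = - infdist z (frontier D)"

text \<open>Coordinates are indexed by a finite type; \<open>o1\<close> is the index playing the role of the
  first coordinate, so that \<open>- {o1}\<close> corresponds to \<open>2, \<dots>, n\<close>.\<close>

definition pseudo_dist ::
  "'n \<Rightarrow> nat \<Rightarrow> ('n \<Rightarrow> nat \<Rightarrow> complex ^ 'n \<Rightarrow> real) \<Rightarrow> (complex ^ 'n) set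
     \<Rightarrow> complex ^ 'n \<Rightarrow> complex ^ 'n \<Rightarrow> real" where
  "pseudo_dist o1 m A D z w =
     \<bar>neg_dist D z\<bar> + \<bar>neg_dist D w\<bar> + cmod (z $ o1 - w $ o1)
     + (\<Sum>l\<in>- {o1}. \<Sum>s=2..m. A l s z * cmod (z $ l - w $ l) ^ s)"

text \<open>The family \<open>b\<close> stands for \<open>b\<^sub>j(z,\<cdot>)\<close> with \<open>z\<close> fixed.\<close>

definition B_system ::
  "'n \<Rightarrow> (complex ^ 'n) set \<Rightarrow> complex ^ 'n \<Rightarrow> ('n \<Rightarrow> complex ^ 'n \<Rightarrow> real) \<Rightarrow> bool" where
  "B_system o1 D z b \<longleftrightarrow>
     bounded_domain D \<and> z \<in> closure D \<and>
     (\<exists>U m A. open U \<and> z \<in> U \<and> m \<ge> 2 \<and>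
        (\<forall>j\<in>- {o1}. \<forall>k\<in>{2..m}. (\<forall>x\<in>U. A j k x \<ge> 0) \<and> bounded (A j k ` U)) \<and>
        (\<forall>w\<in>U. b o1 w = 1 / pseudo_dist o1 m A D z w \<and>
           (\<forall>j\<in>- {o1}. b j w =
              (\<Sum>k=2..m. (A j k z / pseudo_dist o1 m A D z w) powr (1 / real k)))))"

definition B_polydisc ::
  "real \<Rightarrow> complex ^ 'n \<Rightarrow> ('n \<Rightarrow> complex ^ 'n \<Rightarrow> real) \<Rightarrow> (complex ^ 'n) set" where
  "B_polydisc r z b = {w. \<forall>j. cmod (w $ j - z $ j) * b j z \<le> r}"

definition B_type_at ::
  "real \<Rightarrow> (complex ^ 'n) set \<Rightarrow> complex ^ 'n \<Rightarrow> ('n \<Rightarrow> complex ^ 'n \<Rightarrow> real) \<Rightarrow> bool" where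
  "B_type_at C D z b \<longleftrightarrow>
     (\<exists>c>0. \<forall>w\<in>D \<inter> ball z c.
        \<exists>L. bergman_kernel_value D z w L \<and> cmod L \<le> C * (\<Prod>j\<in>UNIV. (b j w)\<^sup>2))"

text \<open>If \<open>z\<close> is a boundary point then the pseudo-distance of \<open>z\<close> to itself is \<open>0\<close> and the two-sided
  diagonal estimate has infinite entries; it is an estimate between numbers only for \<open>z \<in> D\<close>.\<close>

definition sharp_B_type_at ::
  "real \<Rightarrow> real \<Rightarrow> (complex ^ 'n) set \<Rightarrow> complex ^ 'n \<Rightarrow> ('n \<Rightarrow> complex ^ 'n \<Rightarrow> real) \<Rightarrow> bool" where
  "sharp_B_type_at C C' D z b \<longleftrightarrow>
     B_type_at C D z b \<and>
     (z \<in> D \<longrightarrow> C' * (\<Prod>j\<in>UNIV. (b j z)\<^sup>2) \<le> bergman_diag D z \<and>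
                bergman_diag D z \<le> C * (\<Prod>j\<in>UNIV. (b j z)\<^sup>2))"

definition bergman_kernel_cont_ext :: "(complex ^ 'n) set \<Rightarrow> bool" where
  "bergman_kernel_cont_ext D \<longleftrightarrow>
     (\<exists>K. continuous_on (closure D \<times> closure D - {(z, z) |z. z \<in> frontier D}) K \<and>
        (\<forall>z\<in>D. \<forall>w\<in>D. K (z, w) = bergman_kernel D z w))"

text \<open>\<open>\<Phi> z\<close> and \<open>b z\<close> are the biholomorphism and the \<open>\<B>\<close>-system at \<open>\<Phi> z z\<close> belonging to \<open>z\<close>.
  For a boundary point \<open>z\<close>, the value \<open>\<Phi> z z\<close> is the boundary value of \<open>\<Phi> z\<close> at \<open>z\<close>.
  The constants bounding the Jacobians and the kernels do not depend on \<open>z\<close>.\<close>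

definition sharp_B_type_via ::
  "'n \<Rightarrow> (complex ^ 'n) set \<Rightarrow> (complex ^ 'n \<Rightarrow> complex ^ 'n \<Rightarrow> complex ^ 'n)
     \<Rightarrow> (complex ^ 'n \<Rightarrow> 'n \<Rightarrow> complex ^ 'n \<Rightarrow> real) \<Rightarrow> bool" where
  "sharp_B_type_via o1 \<Omega> \<Phi> b \<longleftrightarrow>
     bergman_kernel_cont_ext \<Omega> \<and>
     (\<exists>\<epsilon>>0. \<exists>C>0. \<exists>C'>0. \<exists>M>0. \<exists>M'>0.
        \<forall>z\<in>closure \<Omega>. infdist z (frontier \<Omega>) < \<epsilon> \<longrightarrow>
          biholomorphic_on (\<Phi> z) \<Omega> \<and> (\<Phi> z \<longlongrightarrow> \<Phi> z z) (at z within \<Omega>) \<and>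
          (\<forall>w\<in>\<Omega>. M' \<le> cmod (holo_jacobian (\<Phi> z) w) \<and> cmod (holo_jacobian (\<Phi> z) w) \<le> M) \<and>
          B_system o1 (\<Phi> z ` \<Omega>) (\<Phi> z z) (b z) \<and>
          sharp_B_type_at C C' (\<Phi> z ` \<Omega>) (\<Phi> z z) (b z))"

definition B_polydisc_property ::
  "(complex ^ 'n) set \<Rightarrow> (complex ^ 'n \<Rightarrow> complex ^ 'n \<Rightarrow> complex ^ 'n)
     \<Rightarrow> (complex ^ 'n \<Rightarrow> 'n \<Rightarrow> complex ^ 'n \<Rightarrow> real) \<Rightarrow> bool" where
  "B_polydisc_property \<Omega> \<Phi> b \<longleftrightarrow>
     (\<exists>r>0. \<exists>C>0. \<exists>\<epsilon>>0. \<forall>z\<in>\<Omega>. infdist z (frontier \<Omega>) < \<epsilon> \<longrightarrow>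
        B_polydisc r (\<Phi> z z) (b z) \<subseteq> \<Phi> z ` \<Omega> \<and>
        (\<forall>w\<in>B_polydisc r (\<Phi> z z) (b z).
           bergman_diag (\<Phi> z ` \<Omega>) w \<le> C * bergman_diag (\<Phi> z ` \<Omega>) (\<Phi> z z)))"

definition toeplitz_op ::
  "(complex ^ 'n) set \<Rightarrow> (complex ^ 'n \<Rightarrow> complex) \<Rightarrow> (complex ^ 'n \<Rightarrow> complex)
     \<Rightarrow> complex ^ 'n \<Rightarrow> complex" where
  "toeplitz_op \<Omega> \<psi> f z = (\<integral>w. bergman_kernel \<Omega> z w * \<psi> w * f w \<partial>lebesgue_on \<Omega>)"

definition Lp_fun :: "real \<Rightarrow> 'a::euclidean_space set \<Rightarrow> ('a \<Rightarrow> complex) set" where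
  "Lp_fun p S = {f. f \<in> borel_measurable (lebesgue_on S) \<and>
                    integrable (lebesgue_on S) (\<lambda>x. cmod (f x) powr p)}"

definition Lp_norm :: "real \<Rightarrow> 'a::euclidean_space set \<Rightarrow> ('a \<Rightarrow> complex) \<Rightarrow> real" where
  "Lp_norm p S f = (\<integral>x. cmod (f x) powr p \<partial>lebesgue_on S) powr (1 / p)"

text \<open>Continuity of a linear operator from \<open>L\<^sup>p(S)\<close> to \<open>L\<^sup>q(S)\<close>, as boundedness. Functions are not
  identified almost everywhere; the norm bound makes the operator respect that identification.\<close>

definition Lp_Lq_bounded ::
  "real \<Rightarrow> real \<Rightarrow> 'a::euclidean_space set \<Rightarrow> (('a \<Rightarrow> complex) \<Rightarrow> ('a \<Rightarrow> complex)) \<Rightarrow> bool" where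
  "Lp_Lq_bounded p q S T \<longleftrightarrow>
     (\<exists>M. \<forall>f\<in>Lp_fun p S. T f \<in> Lp_fun q S \<and> Lp_norm q S (T f) \<le> M * Lp_norm p S f)"

end

theory Submission
  imports Defs "HOL-Complex_Analysis.Complex_Analysis"
begin

text \<open>
  Write \<open>k z = K(z,z)\<close> and let \<open>Q\<close> be the preimage of the polydisc \<open>P\<close> under the biholomorphism belonging
  to \<open>z\<close>. Testing the operator \<open>T\<close> on the restriction \<open>f\<close> of \<open>K(_,z)\<close> to \<open>Q\<close> gives, by the mean value
  property over \<open>P\<close>, the lower bound \<open>c (k z)^(2-\<alpha>) |Q|\<close> for \<open>T f z\<close>. Since \<open>T f\<close> is a Bergman projection, hence
  holomorphic, the same property and Hoelder's inequality bound \<open>T f z\<close> from above by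
  \<open>C |Q|^(-1/q) \<parallel>f\<parallel>_p \<le> C' k z |Q|^(1/p-1/q)\<close>, where \<open>|K(w,z)|\<^sup>2 \<le> k w k z\<close> bounds \<open>f\<close>. Sharpness
  means \<open>|Q| \<ge> c / k z\<close>, so \<open>(k z)^(1/p-1/q-\<alpha>)\<close> stays bounded as \<open>z\<close> approaches the boundary, whereas \<open>k\<close>
  is unbounded near a boundary point that is extremal for a coordinate.

  The biholomorphisms enter only through the bounds on their Jacobians: by its extremal property, \<open>k\<close>
  changes under them at most by constant factors.
\<close>

no_notation fps_nth (infixl "$" 75)

section \<open>Complex space as a real space\<close>

text \<open>Truncating the test function to \<open>Q\<close> keeps the argument on the diagonal: on
  \<open>Q\<close> the polydisc hypothesis bounds it by a constant times \<open>k z\<close>, so its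
  \<open>p\<close>-norm needs no integral of the kernel far from \<open>z\<close>. At the same time
  \<open>T f z\<close> becomes an integral of a nonnegative function, so nothing can cancel. Mean
  values appear as inequalities for moduli, averaged over a set that is invariant under complex
  rotations about its centre. Balls and polydiscs are both of this kind: on balls the inequality
  yields the Bergman kernel, which is given by a definite description and has to be constructed, on
  polydiscs the two bounds for \<open>T f z\<close>. The change of variables rests on the fact that
  a complex linear map with determinant d scales volume by |d|^2. Complex space is identified with
  real coordinates by an isometry, and the identity is proved by elimination. Volumes are removed at
  the end: that of \<open>Q\<close> by an upper bound, with exponent \<open>1 + 1/p - 1/q\<close>,
  that of \<open>P\<close> by a lower bound, with exponent \<open>1 - (1/p - 1/q)\<close>. Both
  exponents are nonnegative, so the bounds point in the right direction.\<close>

lemma basis_isometry_exists: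
  assumes "DIM('a::euclidean_space) = DIM('b::euclidean_space)"
  shows "\<exists>f::'a \<Rightarrow> 'b. linear f \<and> f ` Basis = Basis \<and> bij f \<and> (\<forall>x y. f x \<bullet> f y = x \<bullet> y)"
proof -
  obtain g where g: "bij_betw g (Basis::'a set) (Basis::'b set)"
    using finite_same_card_bij[OF finite_Basis finite_Basis assms] by blast
  define f where "f x = (\<Sum>b\<in>Basis. (x \<bullet> b) *\<^sub>R g b)" for x :: 'a
  have gB: "g b \<in> Basis" if "b \<in> Basis" for b using g that by (auto simp: bij_betw_def)
  have gi: "g b \<bullet> g c = (if b = c then 1 else 0)" if "b \<in> Basis" "c \<in> Basis" for b c
    using g that by (auto simp: inner_Basis gB bij_betw_def inj_on_def)
  have lin: "linear f"
    by (rule linearI) (auto simp: f_def inner_add_left scaleR_add_left sum.distrib scaleR_sum_right)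
  have fb: "f b = g b" if "b \<in> Basis" for b
  proof -
    have "f b = (\<Sum>c\<in>Basis. if b = c then g c else 0)"
      unfolding f_def by (rule sum.cong) (auto simp: inner_Basis that)
    then show ?thesis using that by (simp add: sum.delta)
  qed
  have ip: "f x \<bullet> f y = x \<bullet> y" for x y
  proof -
    have "f x \<bullet> f y = (\<Sum>b\<in>Basis. \<Sum>c\<in>Basis. (x \<bullet> b) * (y \<bullet> c) * (g b \<bullet> g c))"
      by (simp add: f_def inner_sum_left inner_sum_right sum_distrib_left mult_ac)
        (subst sum.swap, simp add: mult_ac)
    also have "\<dots> = (\<Sum>b\<in>Basis. \<Sum>c\<in>Basis. if b = c then (x \<bullet> b) * (y \<bullet> c) else 0)"
      by (intro sum.cong refl) (auto simp: gi)
    also have "\<dots> = (\<Sum>b\<in>Basis. (x \<bullet> b) * (y \<bullet> b))"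
      by (intro sum.cong refl) (simp add: sum.delta)
    also have "\<dots> = x \<bullet> y" by (simp add: euclidean_inner[of x y])
    finally show ?thesis .
  qed
  have inj: "inj f"
    unfolding linear_injective_0[OF lin] by (metis inner_eq_zero_iff ip)
  have "f ` Basis = Basis" using g by (auto simp: fb bij_betw_def image_def)
  moreover have "surj f"
  proof -
    have "(Basis::'b set) \<subseteq> range f" using \<open>f ` Basis = Basis\<close> by auto
    moreover have "subspace (range f)" by (simp add: lin linear_subspace_image)
    ultimately have "span (Basis::'b set) \<subseteq> range f" by (rule span_minimal)
    then show ?thesis by auto
  qed
  ultimately show ?thesis using lin inj ip by (auto simp: bij_def)
qed

text \<open>\<open>'n bit0\<close> has twice as many elements as \<open>'n\<close>, so both spaces
  have real dimension 2n. The choice among the possible matchings of the bases is immaterial: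
  everything about \<open>realify\<close> is derived from the properties selected here.\<close>

definition realify :: "complex ^ 'n \<Rightarrow> real ^ ('n bit0)" where
  "realify = (SOME f. linear f \<and> f ` Basis = Basis \<and> bij f \<and> (\<forall>x y. f x \<bullet> f y = x \<bullet> y))"

lemma
  shows linear_realify: "linear realify"
    and realify_Basis: "realify ` Basis = Basis"
    and bij_realify: "bij realify"
    and inner_realify: "realify x \<bullet> realify y = x \<bullet> y"
proof -
  have "DIM(complex ^ 'n) = DIM(real ^ ('n bit0))"
    by (simp add: mult.commute)
  then have "linear (realify :: complex ^ 'n \<Rightarrow> _) \<and> realify ` (Basis :: (complex ^ 'n) set) = Basis
      \<and> bij (realify :: complex ^ 'n \<Rightarrow> _) \<and>
      (\<forall>x y :: complex ^ 'n. realify x \<bullet> realify y = x \<bullet> y)"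
    unfolding realify_def by (rule someI_ex[OF basis_isometry_exists])
  then show "linear (realify :: complex ^ 'n \<Rightarrow> _)" "realify ` (Basis :: (complex ^ 'n) set) = Basis"
    "bij (realify :: complex ^ 'n \<Rightarrow> _)" "realify x \<bullet> realify y = x \<bullet> y" for x y :: "complex ^ 'n"
    by blast+
qed

lemma norm_realify: "norm (realify x) = norm x"
  by (simp add: norm_eq_sqrt_inner inner_realify)

lemma inv_realify [simp]: "inv realify (realify x) = x" "realify (inv realify y) = y"
  using bij_realify by (metis bij_def inv_f_f, metis bij_def surj_f_inv_f)

lemma linear_inv_realify: "linear (inv (realify :: complex ^ 'n \<Rightarrow> _))"
proof (rule linearI)
  fix x y :: "real ^ ('n bit0)" and c :: real
  have "realify (inv realify x + inv realify y :: complex ^ 'n) = x + y"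
    by (simp add: linear_add[OF linear_realify])
  then show "inv realify (x + y) = inv realify x + (inv realify y :: complex ^ 'n)"
    by (metis inv_realify(1))
  have "realify (c *\<^sub>R inv realify x :: complex ^ 'n) = c *\<^sub>R x"
    by (simp add: linear_cmul[OF linear_realify])
  then show "inv realify (c *\<^sub>R x) = c *\<^sub>R (inv realify x :: complex ^ 'n)"
    by (metis inv_realify(1))
qed

lemma norm_inv_realify: "norm (inv realify y) = norm y"
  by (metis inv_realify(2) norm_realify)

lemma continuous_on_realify: "continuous_on S realify"
  by (simp add: linear_realify linear_continuous_on linear_linear)

lemma continuous_on_inv_realify: "continuous_on S (inv realify)"
  by (simp add: linear_inv_realify linear_continuous_on linear_linear)

text \<open>Basis vectors go to basis vectors, so boxes pull back to boxes with the same side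
  lengths, and boxes determine \<open>lborel\<close>.\<close>

lemma distr_realify: "distr lborel borel (realify :: complex ^ 'n \<Rightarrow> _) = lborel"
proof (rule lborel_eqI[symmetric])
  fix l u :: "real ^ ('n bit0)"
  assume lu: "\<And>b. b \<in> Basis \<Longrightarrow> l \<bullet> b \<le> u \<bullet> b"
  have m: "(realify :: complex ^ 'n \<Rightarrow> _) \<in> borel_measurable borel"
    by (intro borel_measurable_continuous_onI continuous_on_realify)
  have ib: "l \<bullet> realify b = inv realify l \<bullet> b" for l and b :: "complex ^ 'n"
    by (metis inner_realify inv_realify(2))
  have v: "realify -` box l u \<inter> space lborel = box (inv realify l) (inv realify u :: complex ^ 'n)"
    by (auto simp: box_def ib inner_realify simp flip: realify_Basis)
  have "emeasure (distr lborel borel (realify :: complex ^ 'n \<Rightarrow> _)) (box l u)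
      = emeasure lborel (box (inv realify l) (inv realify u :: complex ^ 'n))"
    using m v by (subst emeasure_distr) auto
  also have "\<dots> = (\<Prod>b\<in>(Basis :: (complex ^ 'n) set). (inv realify u - inv realify l) \<bullet> b)"
    using lu by (subst emeasure_lborel_box) (auto simp flip: ib simp: realify_Basis[symmetric])
  also have "(\<Prod>b\<in>(Basis :: (complex ^ 'n) set). (inv realify u - inv realify l) \<bullet> b)
      = (\<Prod>b\<in>(realify ` (Basis :: (complex ^ 'n) set)). (u - l) \<bullet> b)"
    using bij_realify
    by (subst prod.reindex) (auto simp: bij_def inj_on_def inner_diff_left ib linear_diff[OF linear_inv_realify] intro!: prod.cong)
  also have "\<dots> = (\<Prod>b\<in>Basis. (u - l) \<bullet> b)" by (simp add: realify_Basis)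
  finally show "emeasure (distr lborel borel (realify :: complex ^ 'n \<Rightarrow> _)) (box l u)
     = ennreal (\<Prod>b\<in>Basis. (u - l) \<bullet> b)" .
qed simp

lemma distr_inv_realify: "distr lborel borel (inv (realify :: complex ^ 'n \<Rightarrow> _)) = lborel"
proof -
  have m: "(realify :: complex ^ 'n \<Rightarrow> _) \<in> borel_measurable borel"
    "inv (realify :: complex ^ 'n \<Rightarrow> _) \<in> borel_measurable borel"
    by (intro borel_measurable_continuous_onI continuous_on_realify continuous_on_inv_realify)+
  have "distr lborel borel (inv (realify :: complex ^ 'n \<Rightarrow> _))
      = distr (distr lborel borel realify) borel (inv realify)"
    by (simp add: distr_realify)
  also have "\<dots> = distr lborel borel (inv realify \<circ> (realify :: complex ^ 'n \<Rightarrow> _))"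
    using m by (intro distr_distr) auto
  also have "inv realify \<circ> (realify :: complex ^ 'n \<Rightarrow> _) = (\<lambda>x. x)" by auto
  also have "distr lborel borel (\<lambda>x :: complex ^ 'n. x) = lborel"
    by (rule distr_id2) simp
  finally show ?thesis .
qed

text \<open>Equality of distributions speaks of Borel sets. A Lebesgue set is a Borel set up to a
  subset of a Borel null set, and taking preimages respects this decomposition.\<close>

lemma
  fixes f :: "'a::euclidean_space \<Rightarrow> 'b::euclidean_space"
  assumes f: "f \<in> borel_measurable borel" and d: "distr lborel borel f = lborel"
    and S: "S \<in> lmeasurable"
  shows lmeasurable_vimage_preserving: "f -` S \<in> lmeasurable"
    and measure_vimage_preserving: "measure lebesgue (f -` S) = measure lebesgue S"
proof -
  have bor: "f -` T \<in> sets borel" if "T \<in> sets borel" for T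
    using measurable_sets[OF f that] by simp
  have eq: "emeasure lborel (f -` T) = emeasure lborel T" if "T \<in> sets borel" for T
  proof -
    have "emeasure lborel T = emeasure (distr lborel borel f) T" by (simp add: d)
    also have "\<dots> = emeasure lborel (f -` T \<inter> space lborel)"
      using f that by (intro emeasure_distr) auto
    finally show ?thesis by simp
  qed
  from S have "S \<in> sets lebesgue" by auto
  then obtain T N N' where TN: "S = T \<union> N" "N \<subseteq> N'" "N' \<in> null_sets lborel" "T \<in> sets lborel"
    by (auto elim: sets_completionE)
  have N': "f -` N' \<in> null_sets lborel"
    using TN(3) eq[of N'] bor[of N'] by (auto simp: null_sets_def)
  have Nn: "N \<in> null_sets lebesgue"
    using TN(2,3) by (meson null_sets_completionI null_sets_completion_subset)
  have Nn': "f -` N \<in> null_sets lebesgue"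
    using TN(2) N' by (meson null_sets_completionI null_sets_completion_subset vimage_mono)
  have T: "T \<in> sets lebesgue" "f -` T \<in> sets lebesgue"
    using TN(4) bor[of T] by auto
  have "emeasure lebesgue (f -` S) = emeasure lebesgue (f -` T)"
    unfolding TN(1) vimage_Un using Nn' T(2) by (simp add: emeasure_Un_null_set)
  also have "\<dots> = emeasure lebesgue T"
    using eq[of T] bor[of T] TN(4) by simp
  also have "\<dots> = emeasure lebesgue S"
    unfolding TN(1) using Nn T(1) by (simp add: emeasure_Un_null_set)
  finally have *: "emeasure lebesgue (f -` S) = emeasure lebesgue S" .
  have "f -` S \<in> sets lebesgue"
    unfolding TN(1) vimage_Un using T(2) Nn' by auto
  with * S show "f -` S \<in> lmeasurable" unfolding fmeasurable_def by (simp del: emeasure_completion)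
  from * show "measure lebesgue (f -` S) = measure lebesgue S" by (simp add: measure_def)
qed

lemma
  shows lmeasurable_realify: "S \<in> lmeasurable \<Longrightarrow> realify ` S \<in> lmeasurable"
    and lmeasurable_inv_realify: "T \<in> lmeasurable \<Longrightarrow> realify -` T \<in> lmeasurable"
    and measure_realify: "S \<in> lmeasurable \<Longrightarrow> measure lebesgue (realify ` S) = measure lebesgue S"
proof -
  have im: "realify ` S = inv realify -` S"
    by (metis bij_imp_bij_inv bij_realify bij_vimage_eq_inv_image inv_inv_eq)
  note * = borel_measurable_continuous_onI[OF continuous_on_inv_realify] distr_inv_realify
  show "S \<in> lmeasurable \<Longrightarrow> realify ` S \<in> lmeasurable"
    unfolding im by (rule lmeasurable_vimage_preserving[OF *])
  show "S \<in> lmeasurable \<Longrightarrow> measure lebesgue (realify ` S) = measure lebesgue S"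
    unfolding im by (rule measure_vimage_preserving[OF *])
  show "T \<in> lmeasurable \<Longrightarrow> realify -` T \<in> lmeasurable"
    by (rule lmeasurable_vimage_preserving[OF borel_measurable_continuous_onI[OF continuous_on_realify] distr_realify])
qed

section \<open>The real determinant of a complex matrix\<close>

definition real_det :: "complex ^ 'n ^ 'n \<Rightarrow> real" where
  "real_det A = det (matrix (\<lambda>x. realify (A *v inv realify x)))"

lemma linear_realify_conj: "linear (\<lambda>x. realify ((A :: complex ^ 'n ^ 'n) *v inv realify x))"
  using linear_compose[OF linear_compose[OF linear_inv_realify matrix_vector_mul_linear[of A]]
      linear_realify]
  by (simp add: o_def)

lemma real_det_mult: "real_det (A ** B) = real_det A * real_det B"
proof -
  have "(\<lambda>x. realify ((A ** B) *v inv realify x))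
      = (\<lambda>x. realify (A *v inv realify x)) \<circ> (\<lambda>x. realify (B *v inv realify x))"
    by (simp add: o_def matrix_vector_mul_assoc)
  then show ?thesis
    unfolding real_det_def
    by (simp add: matrix_compose[OF linear_realify_conj linear_realify_conj] det_mul)
qed

lemma real_det_1 [simp]: "real_det (mat 1 :: complex ^ 'n ^ 'n) = 1"
proof -
  have "(\<lambda>x. realify ((mat 1 :: complex ^ 'n ^ 'n) *v inv realify x)) = id"
    by auto
  then show ?thesis unfolding real_det_def by (simp only: matrix_id_mat_1 det_I)
qed

lemma real_det_diagonal:
  fixes A :: "complex ^ 'n ^ 'n"
  assumes "\<And>b. b \<in> Basis \<Longrightarrow> A *v b = c b *\<^sub>R b"
  shows "real_det A = (\<Prod>b\<in>Basis. c b)"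
proof -
  let ?M = "matrix (\<lambda>x. realify (A *v inv realify x)) :: real ^ ('n bit0) ^ ('n bit0)"
  have ax: "inv realify (axis j (1::real)) \<in> (Basis :: (complex ^ 'n) set)" for j :: "'n bit0"
  proof -
    have "axis j (1::real) \<in> realify ` (Basis :: (complex ^ 'n) set)"
      unfolding realify_Basis by simp
    then show ?thesis by auto
  qed
  have M: "?M $ i $ j = c (inv realify (axis j 1)) * axis j 1 $ i" for i j
    by (simp add: matrix_def assms[OF ax] linear_cmul[OF linear_realify])
  have "real_det A = (\<Prod>i\<in>UNIV. c (inv realify (axis i 1)))"
    unfolding real_det_def by (subst det_diagonal) (auto simp: M axis_def)
  also have "\<dots> = (\<Prod>b\<in>(\<lambda>i::'n bit0. inv realify (axis i (1::real))) ` UNIV. c b)"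
    by (subst prod.reindex) (auto intro!: injI dest!: arg_cong[where f=realify] simp: axis_eq_axis)
  also have "(\<lambda>i::'n bit0. inv realify (axis i (1::real))) ` UNIV = Basis"
  proof -
    have "(\<lambda>i::'n bit0. inv realify (axis i (1::real))) ` UNIV = inv realify ` Basis"
      by (auto simp: Basis_vec_def)
    also have "\<dots> = inv realify ` (realify ` (Basis :: (complex ^ 'n) set))"
      by (simp add: realify_Basis)
    finally show ?thesis by (simp add: image_image)
  qed
  finally show ?thesis .
qed

section \<open>Elementary matrices and the relation between real and complex determinants\<close>

definition replace_col :: "'n \<Rightarrow> complex ^ 'n \<Rightarrow> complex ^ 'n ^ 'n" where
  "replace_col k v = (\<chi> i j. if j = k then v $ i else if i = j then 1 else 0)"

lemma replace_col_vec: "replace_col k v *v x = (\<chi> i. (if i = k then 0 else x $ i) + v $ i * x $ k)"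
proof -
  have "(\<Sum>j\<in>UNIV. replace_col k v $ i $ j * x $ j) = (if i = k then 0 else x $ i) + v $ i * x $ k" for i
  proof -
    have "(\<Sum>j\<in>UNIV. replace_col k v $ i $ j * x $ j)
        = (\<Sum>j\<in>UNIV. (if j = k then v $ i * x $ j else 0) + (if j = i then (if i = k then 0 else x $ i) else 0))"
      by (rule sum.cong) (auto simp: replace_col_def)
    then show ?thesis by (simp add: sum.distrib)
  qed
  then show ?thesis by (simp add: matrix_vector_mult_def)
qed

lemma matrix_mult_axis_nth: "((A :: complex ^ 'n ^ 'm) *v axis j 1) $ i = A $ i $ j"
  by (simp add: matrix_vector_mult_def axis_def if_distrib cong: if_cong)

lemma matrix_eq_cols:
  fixes A B :: "complex ^ 'n ^ 'm"
  assumes "\<And>j. A *v axis j 1 = B *v axis j 1"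
  shows "A = B"
  using assms by (metis matrix_mult_axis_nth vec_eq_iff)

lemma replace_col_axis: "replace_col k v *v axis j 1 = (if j = k then v else axis j 1)"
  by (auto simp: replace_col_vec vec_eq_iff axis_def)

text \<open>For fixed \<open>k\<close> these matrices are closed under multiplication, and the
  product is again described by one column. Factorisations and inverses thus become identities
  between vectors, checked entry by entry.\<close>

lemma replace_col_mult: "replace_col k v ** replace_col k w = replace_col k (replace_col k v *v w)"
  by (rule matrix_eq_cols) (simp add: replace_col_axis flip: matrix_vector_mul_assoc)

lemma replace_col_id: "replace_col k (axis k 1) = mat 1"
  by (rule matrix_eq_cols) (simp add: replace_col_axis)

lemma det_replace_col:
  fixes v :: "complex ^ 'n"
  shows "det (replace_col k v) = v $ k"
proof -
  have "(\<chi> i j. if j = k then ((mat 1 :: complex ^ 'n ^ 'n) *v v) $ i else (mat 1 :: complex ^ 'n ^ 'n) $ i $ j)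
      = replace_col k v"
    unfolding matrix_vector_mul_lid by (auto simp: replace_col_def mat_def vec_eq_iff)
  then show ?thesis using cramer_lemma[of k "mat 1 :: complex ^ 'n ^ 'n" v] by simp
qed

text \<open>A transvection \<open>U\<close> satisfies \<open>S U\<^sup>2 = U S\<close> for \<open>S\<close> doubling the \<open>k\<close>-th coordinate.\<close>

lemma real_det_transvection:
  assumes "u $ k = 1"
  shows "real_det (replace_col k u) = 1"
proof -
  let ?S = "replace_col k (axis k 2)" and ?U = "replace_col k u"
  have "?S ** (?U ** ?U) = ?U ** ?S"
    by (simp add: replace_col_mult) (rule arg_cong[where f = "replace_col k"],
        auto simp: replace_col_vec vec_eq_iff axis_def assms)
  from arg_cong[OF this, of real_det]
  have 1: "real_det ?S * (real_det ?U * real_det ?U) = real_det ?U * real_det ?S"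
    by (simp add: real_det_mult)
  \<comment> \<open>Explicit inverses show that both determinants are nonzero, so cancelling in the
    identity above leaves the value 1. For \<open>?U\<close> the inverse has column
    \<open>axis k 2 - u\<close>, which keeps the entry 1 at \<open>k\<close> and negates the
    others.\<close>
  have "?S ** replace_col k (axis k (1/2)) = mat 1"
    by (simp add: replace_col_mult flip: replace_col_id[of k]) (rule arg_cong[where f = "replace_col k"],
        auto simp: replace_col_vec vec_eq_iff axis_def)
  from arg_cong[OF this, of real_det] have S: "real_det ?S \<noteq> 0" by (auto simp: real_det_mult)
  have "?U ** replace_col k (axis k 2 - u) = mat 1"
    by (simp add: replace_col_mult flip: replace_col_id[of k]) (rule arg_cong[where f = "replace_col k"],
        auto simp: replace_col_vec vec_eq_iff axis_def assms)
  from arg_cong[OF this, of real_det] have U: "real_det ?U \<noteq> 0" by (auto simp: real_det_mult)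
  from 1 S U show ?thesis by simp
qed

text \<open>Scaling one complex coordinate by a real factor stretches the two real directions
  \<open>axis k 1\<close> and \<open>axis k \<i>\<close>, hence the square.\<close>

lemma real_det_scale_real:
  "real_det (replace_col (k::'n::finite) (axis k (of_real r))) = r\<^sup>2"
proof -
  let ?K = "{axis k 1, axis k \<i>} :: (complex ^ 'n) set"
  have "real_det (replace_col k (axis k (of_real r))) = (\<Prod>b\<in>Basis. if b \<in> ?K then r else 1)"
  proof (rule real_det_diagonal)
    fix b :: "complex ^ 'n" assume "b \<in> Basis"
    then obtain i u where b: "b = axis i u" "u = 1 \<or> u = \<i>"
      by (auto simp: Basis_vec_def Basis_complex_def)
    then have "b \<in> ?K \<longleftrightarrow> i = k" by (auto simp: axis_eq_axis)
    then show "replace_col k (axis k (of_real r)) *v b = (if b \<in> ?K then r else 1) *\<^sub>R b"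
      unfolding b(1) by (auto simp: replace_col_vec vec_eq_iff axis_def scaleR_complex.code complex_eq_iff)
  qed
  also have "\<dots> = (\<Prod>b\<in>Basis \<inter> ?K. r)"
    by (subst prod.inter_restrict) auto
  also have "Basis \<inter> ?K = ?K"
    by (auto simp: Basis_vec_def Basis_complex_def)
  also have "(\<Prod>b\<in>?K. r) = r\<^sup>2"
    by (simp add: axis_eq_axis power2_eq_square)
  finally show ?thesis .
qed

lemma abs_real_det_unimodular:
  assumes "cmod c = 1"
  shows "\<bar>real_det (replace_col (k::'n::finite) (axis k c))\<bar> = 1"
proof -
  let ?A = "replace_col k (axis k c)"
  have "norm (?A *v x) = norm x" for x
    unfolding norm_vec_def using assms
    by (intro L2_set_cong refl) (auto simp: replace_col_vec axis_def norm_mult)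
  then have "orthogonal_transformation (\<lambda>x. realify (?A *v inv realify x))"
    unfolding orthogonal_transformation
    using linear_realify_conj by (auto simp: norm_realify norm_inv_realify)
  then show ?thesis
    unfolding real_det_def by (rule orthogonal_transformation_det)
qed

text \<open>The column is split into the modulus of its pivot entry, the phase of that entry and a
  transvection. Only the modulus contributes to the absolute value of the determinant.\<close>

lemma abs_real_det_replace_col:
  assumes "v $ k \<noteq> 0"
  shows "\<bar>real_det (replace_col k v)\<bar> = (cmod (v $ k))\<^sup>2"
proof -
  let ?c = "v $ k" and ?w = "\<chi> i. if i = k then 1 else v $ i"
  have 1: "replace_col k v = replace_col k (axis k ?c) ** replace_col k ?w"
    unfolding replace_col_mult
    by (rule arg_cong[where f = "replace_col k"]) (auto simp: replace_col_vec vec_eq_iff axis_def)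
  have 2: "replace_col k (axis k ?c) = replace_col k (axis k (of_real (cmod ?c))) ** replace_col k (axis k (sgn ?c))"
    unfolding replace_col_mult
    by (rule arg_cong[where f = "replace_col k"])
      (auto simp: replace_col_vec vec_eq_iff axis_def sgn_div_norm scaleR_conv_of_real assms)
  have "\<bar>real_det (replace_col k (axis k (sgn ?c)))\<bar> = 1"
    using assms by (intro abs_real_det_unimodular) (simp add: norm_sgn)
  moreover have "real_det (replace_col k ?w) = 1" by (rule real_det_transvection) simp
  ultimately show ?thesis
    by (simp only: 1 2 real_det_mult abs_mult real_det_scale_real) simp
qed

text \<open>Gaussian elimination, as an induction over the set \<open>T\<close> of columns that may
  still differ from those of the identity. Both sides are multiplicative, and the elementary factors
  are covered by the preceding lemmas.\<close>

lemma abs_real_det: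
  fixes A :: "complex ^ 'n ^ 'n"
  assumes "det A \<noteq> 0"
  shows "\<bar>real_det A\<bar> = (cmod (det A))\<^sup>2"
proof -
  have "\<forall>A :: complex ^ 'n ^ 'n. det A \<noteq> 0 \<longrightarrow> (\<forall>j. j \<notin> T \<longrightarrow> A *v axis j 1 = axis j 1) \<longrightarrow>
      \<bar>real_det A\<bar> = (cmod (det A))\<^sup>2" if "finite T" for T
    using that
  proof (induction T)
    case empty
    show ?case
    proof (intro allI impI)
      fix A :: "complex ^ 'n ^ 'n"
      assume "\<forall>j. j \<notin> {} \<longrightarrow> A *v axis j 1 = axis j 1"
      then have "A = mat 1" by (intro matrix_eq_cols) simp
      then show "\<bar>real_det A\<bar> = (cmod (det A))\<^sup>2" by simp
    qed
  next
    case (insert k T)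
    have reduced: "\<bar>real_det A\<bar> = (cmod (det A))\<^sup>2"
      if A: "det A \<noteq> 0" "\<And>j. j \<notin> insert k T \<Longrightarrow> A *v axis j 1 = axis j 1"
        and nz: "(A *v axis k 1) $ k \<noteq> 0" for A :: "complex ^ 'n ^ 'n"
    proof -
      let ?v = "A *v axis k 1"
      \<comment> \<open>Multiplication by \<open>replace_col k ?w\<close> carries the pivot column
        to \<open>axis k 1\<close>. It is inverse to \<open>replace_col k ?v\<close>, so
        \<open>A\<close> is recovered from \<open>?B\<close>, to which the induction hypothesis
        applies.\<close>
      let ?w = "\<chi> i. if i = k then 1 / ?v $ k else - ?v $ i / ?v $ k"
      let ?B = "replace_col k ?w ** A"
      have wv: "replace_col k ?w *v ?v = axis k 1"
        using nz by (auto simp: replace_col_vec vec_eq_iff axis_def)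
      have vw: "replace_col k ?v *v ?w = axis k 1"
        using nz by (auto simp: replace_col_vec vec_eq_iff axis_def)
      have eq: "A = replace_col k ?v ** ?B"
        by (simp only: matrix_mul_assoc replace_col_mult vw replace_col_id matrix_mul_lid)
      have "?B *v axis j 1 = axis j 1" if "j \<notin> T" for j
        using that A(2)[of j] wv
        by (cases "j = k") (auto simp: replace_col_axis simp flip: matrix_vector_mul_assoc)
      moreover have "det ?B \<noteq> 0"
        using A(1) nz by (simp add: det_mul det_replace_col)
      ultimately have "\<bar>real_det ?B\<bar> = (cmod (det ?B))\<^sup>2"
        using insert.IH by blast
      moreover have "\<bar>real_det (replace_col k ?v)\<bar> = (cmod (det (replace_col k ?v)))\<^sup>2"
        unfolding det_replace_col by (rule abs_real_det_replace_col[OF nz])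
      moreover have "\<bar>real_det (X ** Y)\<bar> = (cmod (det (X ** Y)))\<^sup>2"
        if "\<bar>real_det X\<bar> = (cmod (det X))\<^sup>2" "\<bar>real_det Y\<bar> = (cmod (det Y))\<^sup>2"
        for X Y :: "complex ^ 'n ^ 'n"
        by (simp add: real_det_mult det_mul abs_mult norm_mult power_mult_distrib that)
      ultimately have "\<bar>real_det (replace_col k ?v ** ?B)\<bar> = (cmod (det (replace_col k ?v ** ?B)))\<^sup>2"
        by blast
      then show ?thesis by (simp only: eq[symmetric])
    qed
    show ?case
    proof (intro allI impI)
      fix A :: "complex ^ 'n ^ 'n"
      assume A: "det A \<noteq> 0" "\<forall>j. j \<notin> insert k T \<longrightarrow> A *v axis j 1 = axis j 1"
      let ?v = "A *v axis k 1"
      show "\<bar>real_det A\<bar> = (cmod (det A))\<^sup>2"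
      proof (cases "?v $ k = 0")
        case False
        then show ?thesis using A by (intro reduced) auto
      next
        case True
        \<comment> \<open>Otherwise \<open>?v\<close> would be supported on indices whose columns
          are unit vectors, so \<open>A\<close> would fix \<open>?v\<close>. Then \<open>A\<close>
          maps both \<open>?v\<close> and \<open>axis k 1\<close> to \<open>?v\<close>, and
          invertibility forces \<open>?v = axis k 1\<close>, against the zero pivot.\<close>
        have "\<exists>i\<in>T. ?v $ i \<noteq> 0"
        proof (rule ccontr)
          assume "\<not> ?thesis"
          with True have v0: "?v $ i = 0" if "i \<in> insert k T" for i using that by auto
          have "(A *v ?v) $ i = ?v $ i" for i
          proof -
            have "(A *v ?v) $ i = (\<Sum>j\<in>UNIV. A $ i $ j * ?v $ j)"
              by (simp add: matrix_vector_mult_def)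
            also have "\<dots> = (\<Sum>j\<in>UNIV. if j = i then ?v $ j else 0)"
            proof (intro sum.cong refl)
              fix j show "A $ i $ j * ?v $ j = (if j = i then ?v $ j else 0)"
              proof (cases "j \<in> insert k T")
                case False
                then have "A $ i $ j = axis j 1 $ i" using A(2) by (metis matrix_mult_axis_nth)
                then show ?thesis by (simp add: axis_def)
              qed (use v0 in auto)
            qed
            finally show ?thesis by simp
          qed
          then have "A *v ?v = A *v axis k 1" by (simp add: vec_eq_iff)
          then have "?v = axis k 1"
            using A(1) by (metis invertible_det_nz invertible_def matrix_vector_mul_assoc matrix_vector_mul_lid)
          with True show False by (metis axis_nth zero_neq_one)
        qed
        then obtain i where i: "i \<in> T" "?v $ i \<noteq> 0" by blast
        have ik: "i \<noteq> k" using i insert.hyps by auto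
        \<comment> \<open>Adding row \<open>i\<close> to row \<open>k\<close> moves a nonzero entry
          into the pivot position. This transvection has determinant 1 in both senses, and since
          \<open>i\<close> lies in \<open>T\<close> the columns already cleared stay
          untouched.\<close>
        let ?E = "replace_col i (axis i 1 + axis k 1)"
        let ?B = "?E ** A"
        have E1: "(axis i 1 + axis k (1::complex)) $ i = 1" using ik by (simp add: axis_def)
        have d: "det ?B = det A" "real_det ?B = real_det A"
          by (simp_all add: det_mul det_replace_col real_det_mult real_det_transvection E1
              del: vector_add_component)
        have "\<bar>real_det ?B\<bar> = (cmod (det ?B))\<^sup>2"
        proof (rule reduced)
          show "det ?B \<noteq> 0" using A(1) d by simp
          show "?B *v axis j 1 = axis j 1" if "j \<notin> insert k T" for j
            using that A(2) i by (auto simp: replace_col_axis simp flip: matrix_vector_mul_assoc)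
          have "(?B *v axis k 1) $ k = ?v $ i"
            using ik True by (auto simp: replace_col_vec axis_def simp flip: matrix_vector_mul_assoc)
          then show "(?B *v axis k 1) $ k \<noteq> 0" using i by simp
        qed
        then show ?thesis using d by simp
      qed
    qed
  qed
  from this[of UNIV] assms show ?thesis by simp
qed

section \<open>Change of variables\<close>

lemma has_derivative_vec:
  fixes f :: "'a::real_normed_vector \<Rightarrow> complex ^ 'n"
  assumes "\<And>i. ((\<lambda>x. f x $ i) has_derivative (\<lambda>h. f' h $ i)) (at x within S)"
  shows "(f has_derivative f') (at x within S)"
proof (subst has_derivative_componentwise_within, intro ballI)
  fix b :: "complex ^ 'n" assume "b \<in> Basis"
  then obtain i u where b: "b = axis i u" by (auto simp: Basis_vec_def)
  have "((\<lambda>x. f x $ i \<bullet> u) has_derivative (\<lambda>h. f' h $ i \<bullet> u)) (at x within S)"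
    by (rule bounded_linear.has_derivative[OF bounded_linear_inner_left assms])
  then show "((\<lambda>x. f x \<bullet> b) has_derivative (\<lambda>h. f' h \<bullet> b)) (at x within S)"
    by (simp add: b inner_axis)
qed

text \<open>Conjugation by \<open>realify\<close> reduces this to real coordinates, where the
  Jacobian determinant has absolute value \<open>(cmod (det (J x)))\<^sup>2\<close> by
  \<open>abs_real_det\<close>; this is the origin of \<open>B\<^sup>2\<close>.\<close>

lemma
  fixes F :: "complex ^ 'n \<Rightarrow> complex ^ 'n"
  assumes E: "E \<in> lmeasurable"
    and der: "\<And>x. x \<in> E \<Longrightarrow> (F has_derivative (*v) (J x)) (at x within E)"
    and nz: "\<And>x. x \<in> E \<Longrightarrow> det (J x) \<noteq> 0"
    and bd: "\<And>x. x \<in> E \<Longrightarrow> cmod (det (J x)) \<le> B"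
  shows lmeasurable_complex_image: "F ` E \<in> lmeasurable"
    and measure_complex_image_le: "measure lebesgue (F ` E) \<le> B\<^sup>2 * measure lebesgue E"
proof -
  let ?G = "\<lambda>y. realify (F (inv realify y))"
  let ?E = "realify ` E"
  let ?D = "\<lambda>y h. realify (J (inv realify y) *v inv realify h)"
  have E': "?E \<in> lmeasurable" using E by (rule lmeasurable_realify)
  have iE: "inv realify ` ?E = E" by (simp add: image_image)
  have der': "(?G has_derivative ?D y) (at y within ?E)" if "y \<in> ?E" for y
  proof -
    have "(inv realify has_derivative inv realify) (at y within ?E)"
      by (intro linear_imp_has_derivative linear_inv_realify)
    moreover have "(F has_derivative (*v) (J (inv realify y))) (at (inv realify y) within (inv realify ` ?E))"
      unfolding iE using that by (intro der) auto
    ultimately have "((\<lambda>y. F (inv realify y)) has_derivative (\<lambda>h. J (inv realify y) *v inv realify h)) (at y within ?E)"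
      by (rule has_derivative_in_compose)
    then show ?thesis
      by (rule bounded_linear.has_derivative[OF linear_linear[THEN iffD2, OF linear_realify]])
  qed
  have dt: "\<bar>det (matrix (?D y))\<bar> = (cmod (det (J (inv realify y))))\<^sup>2" if "y \<in> ?E" for y
    using abs_real_det[of "J (inv realify y)"] nz that by (auto simp: real_det_def)
  have bd': "\<bar>det (matrix (?D y))\<bar> \<le> B\<^sup>2" if "y \<in> ?E" for y
    unfolding dt[OF that] using bd that by (intro power_mono) auto
  have "(\<lambda>y. det (matrix (?D y))) \<in> borel_measurable (lebesgue_on ?E)"
    using E' der' by (intro borel_measurable_det_Jacobian) auto
  then have "(\<lambda>y. \<bar>det (matrix (?D y))\<bar>) \<in> borel_measurable (lebesgue_on ?E)"
    by (rule borel_measurable_abs)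
  then have int: "(\<lambda>y. \<bar>det (matrix (?D y))\<bar>) integrable_on ?E"
    by (rule measurable_bounded_by_integrable_imp_integrable[where g="\<lambda>_. B\<^sup>2"])
      (use E' bd' in \<open>auto simp: integrable_on_const\<close>)
  have im: "realify ` (F ` E) = ?G ` ?E" by (simp add: image_image)
  have "?G ` ?E \<in> lmeasurable"
    by (rule measurable_bounded_differentiable_image[OF E' der' int bd'])
  then have "realify -` (?G ` ?E) \<in> lmeasurable" by (rule lmeasurable_inv_realify)
  moreover have "realify -` (?G ` ?E) = F ` E"
    unfolding im[symmetric] by (rule inj_vimage_image_eq[OF bij_is_inj[OF bij_realify]])
  ultimately show l: "F ` E \<in> lmeasurable" by simp
  have "measure lebesgue (?G ` ?E) \<le> B\<^sup>2 * measure lebesgue ?E"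
    by (rule measure_bounded_differentiable_image[OF E' der' int bd'])
  then show "measure lebesgue (F ` E) \<le> B\<^sup>2 * measure lebesgue E"
    unfolding im[symmetric] using l E by (simp add: measure_realify)
qed

text \<open>The inequality already holds between measures: the image of Lebesgue measure on
  \<open>S\<close> under \<open>F\<close> is at most \<open>B\<^sup>2\<close> times Lebesgue measure
  on \<open>T\<close>, because the preimage of a set under \<open>F\<close> is its image under
  \<open>G\<close>, whose volume the previous lemma bounds.\<close>

lemma nn_integral_substitution_le:
  fixes F G :: "complex ^ 'n \<Rightarrow> complex ^ 'n"
  assumes S: "S \<in> lmeasurable" and T: "T \<in> lmeasurable"
    and FS: "\<And>x. x \<in> S \<Longrightarrow> F x \<in> T" and GT: "\<And>y. y \<in> T \<Longrightarrow> G y \<in> S"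
    and GF: "\<And>x. x \<in> S \<Longrightarrow> G (F x) = x" and FG: "\<And>y. y \<in> T \<Longrightarrow> F (G y) = y"
    and der: "\<And>y. y \<in> T \<Longrightarrow> (G has_derivative (*v) (J y)) (at y within T)"
    and nz: "\<And>y. y \<in> T \<Longrightarrow> det (J y) \<noteq> 0"
    and bd: "\<And>y. y \<in> T \<Longrightarrow> cmod (det (J y)) \<le> B"
    and g: "g \<in> borel_measurable (lebesgue_on T)"
  shows "(\<integral>\<^sup>+x. g (F x) \<partial>lebesgue_on S) \<le> ennreal (B\<^sup>2) * (\<integral>\<^sup>+y. g y \<partial>lebesgue_on T)"
proof -
  have Sl: "S \<in> sets lebesgue" and Tl: "T \<in> sets lebesgue" using S T by auto
  have pre: "F -` E \<inter> S = G ` E" if "E \<subseteq> T" for E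
    using that by (auto simp: FG GT image_iff subset_iff) (metis FS GF)+
  have E: "E \<subseteq> T" "E \<in> lmeasurable" if "E \<in> sets (lebesgue_on T)" for E
  proof -
    from that Tl have "E \<in> sets lebesgue" "E \<subseteq> T"
      by (auto simp: sets_restrict_space_iff)
    then show "E \<subseteq> T" "E \<in> lmeasurable"
      using T by (auto intro: fmeasurableI2)
  qed
  have im: "G ` E \<in> lmeasurable" "measure lebesgue (G ` E) \<le> B\<^sup>2 * measure lebesgue E"
    if "E \<in> sets (lebesgue_on T)" for E
    using E[OF that] der nz bd
    by (auto intro!: lmeasurable_complex_image[where J=J and B=B] measure_complex_image_le[where J=J]
        intro: has_derivative_subset)
  have meas: "F \<in> lebesgue_on S \<rightarrow>\<^sub>M lebesgue_on T"
  proof (rule measurableI)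
    show "F x \<in> space (lebesgue_on T)" if "x \<in> space (lebesgue_on S)" for x
      using that FS by simp
    show "F -` E \<inter> space (lebesgue_on S) \<in> sets (lebesgue_on S)" if "E \<in> sets (lebesgue_on T)" for E
      using pre[OF E(1)[OF that]] im(1)[OF that] GT E(1)[OF that] Sl
      by (auto simp: sets_restrict_space_iff)
  qed
  let ?\<nu> = "distr (lebesgue_on S) (lebesgue_on T) F"
  have "?\<nu> \<le> scale_measure (ennreal (B\<^sup>2)) (lebesgue_on T)"
  proof (subst le_measure; (intro allI ballI)?)
    show "emeasure ?\<nu> E \<le> emeasure (scale_measure (ennreal (B\<^sup>2)) (lebesgue_on T)) E" for E
    proof (cases "E \<in> sets (lebesgue_on T)")
      case True
      have "emeasure ?\<nu> E = emeasure (lebesgue_on S) (G ` E)"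
        using True meas pre[OF E(1)[OF True]] by (simp add: emeasure_distr)
      also have "\<dots> = emeasure lebesgue (G ` E)"
        using Sl GT E(1)[OF True] by (intro emeasure_restrict_space) auto
      also have "\<dots> = ennreal (measure lebesgue (G ` E))"
        using im(1)[OF True] by (simp add: emeasure_eq_measure2)
      also have "\<dots> \<le> ennreal (B\<^sup>2 * measure lebesgue E)"
        using im(2)[OF True] by (rule ennreal_leI)
      also have "\<dots> = ennreal (B\<^sup>2) * emeasure lebesgue E"
        using E(2)[OF True] by (simp add: emeasure_eq_measure2 ennreal_mult)
      also have "emeasure lebesgue E = emeasure (lebesgue_on T) E"
        using Tl E(1)[OF True] by (intro emeasure_restrict_space[symmetric]) auto
      finally show ?thesis by simp
    qed (simp add: emeasure_notin_sets)
  qed simp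
  then have "nn_integral ?\<nu> g \<le> nn_integral (scale_measure (ennreal (B\<^sup>2)) (lebesgue_on T)) g"
    by (intro nn_integral_mono_measure) auto
  then show "(\<integral>\<^sup>+x. g (F x) \<partial>lebesgue_on S) \<le> ennreal (B\<^sup>2) * (\<integral>\<^sup>+y. g y \<partial>lebesgue_on T)"
    using g meas by (simp add: nn_integral_distr nn_integral_scale_measure)
qed

text \<open>Homogeneity over the complex numbers makes the real Frechet derivative complex linear,
  so the matrix of its values at the vectors \<open>axis j 1\<close>, on which
  \<open>holo_jacobian\<close> rests, recovers it completely.\<close>

lemma holomorphic_map_on_imp_matrix:
  assumes "holomorphic_map_on F S" "x \<in> S"
  shows "(F has_derivative (*v) (matrix (frechet_derivative F (at x)))) (at x)"
proof -
  have "\<forall>i. \<exists>D. ((\<lambda>z. F z $ i) has_derivative D) (at x) \<and> (\<forall>c v. D (c *s v) = c * D v)"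
    using assms by (auto simp: holomorphic_map_on_def holomorphic_fun_on_def)
  then obtain D where D: "\<And>i. ((\<lambda>z. F z $ i) has_derivative D i) (at x)"
      "\<And>i c v. D i (c *s v) = c * D i v" by metis
  let ?L = "\<lambda>h. \<chi> i. D i h"
  have L: "(F has_derivative ?L) (at x)"
    by (rule has_derivative_vec) (simp add: D)
  have "Vector_Spaces.linear (*s) (*s) ?L"
    by unfold_locales
      (auto simp: vec_eq_iff D(2) linear_add[OF has_derivative_linear[OF D(1)]] algebra_simps)
  then have "(*v) (matrix ?L) = ?L" by (auto simp: matrix_works)
  moreover have "frechet_derivative F (at x) = ?L"
    using L by (simp add: frechet_derivative_at[symmetric])
  ultimately show ?thesis using L by simp
qed

lemma biholomorphic_on_jacobian:
  assumes "biholomorphic_on F S" and S: "open S" and x: "x \<in> S"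
  defines "G \<equiv> inv_into S F"
  shows "(F has_derivative (*v) (matrix (frechet_derivative F (at x)))) (at x)"
    and "(G has_derivative (*v) (matrix (frechet_derivative G (at (F x))))) (at (F x))"
    and "det (matrix (frechet_derivative G (at (F x)))) * holo_jacobian F x = 1"
proof -
  have hF: "holomorphic_map_on F S" and inj: "inj_on F S"
    and hG: "holomorphic_map_on G (F ` S)"
    using assms(1) by (auto simp: biholomorphic_on_def G_def)
  let ?A = "matrix (frechet_derivative F (at x))" and ?B = "matrix (frechet_derivative G (at (F x)))"
  show 1: "(F has_derivative (*v) ?A) (at x)"
    by (rule holomorphic_map_on_imp_matrix[OF hF x])
  show 2: "(G has_derivative (*v) ?B) (at (F x))"
    using x by (intro holomorphic_map_on_imp_matrix[OF hG]) auto
  have "((\<lambda>y. G (F y)) has_derivative (\<lambda>h. ?B *v (?A *v h))) (at x)"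
    by (rule has_derivative_compose[OF 1 2])
  moreover have "((\<lambda>y. G (F y)) has_derivative (\<lambda>h. h)) (at x)"
    by (rule has_derivative_transform_within_open[OF has_derivative_ident S x])
      (simp add: G_def inj inv_into_f_f)
  ultimately have "(\<lambda>h. ?B *v (?A *v h)) = (\<lambda>h. h)"
    by (rule has_derivative_unique)
  then have "\<forall>h. (?B ** ?A) *v h = mat 1 *v h"
    by (simp add: matrix_vector_mul_assoc fun_eq_iff)
  then have "?B ** ?A = mat 1" by (simp add: matrix_eq)
  from arg_cong[OF this, of det]
  show "det ?B * holo_jacobian F x = 1"
    by (simp add: det_mul holo_jacobian_def)
qed

section \<open>Holomorphic functions of several variables\<close>

lemma continuous_on_vector_scalar_mult:
  fixes g :: "'a::topological_space \<Rightarrow> complex ^ 'n"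
  assumes "continuous_on S f" "continuous_on S g"
  shows "continuous_on S (\<lambda>x. f x *s g x)"
  unfolding vector_scalar_mult_def
  using assms by (intro continuous_on_vec_lambda continuous_intros continuous_on_component)

lemma linear_scalar_left: "linear (\<lambda>t. t *s (v :: complex ^ 'n))"
  by (rule linearI) (auto simp: vec_eq_iff algebra_simps)

lemma linear_scalar_right: "linear (\<lambda>v :: complex ^ 'n. c *s v)"
  by (rule linearI) (auto simp: vec_eq_iff algebra_simps)

lemma norm_vector_scalar_mult: "norm (c *s (v :: complex ^ 'n)) = cmod c * norm v"
proof -
  have "L2_set (\<lambda>i. cmod c * cmod (v $ i)) UNIV = cmod c * L2_set (\<lambda>i. cmod (v $ i)) UNIV"
    by (simp add: L2_set_right_distrib)
  then show ?thesis by (simp add: norm_vec_def norm_mult)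
qed

lemma holomorphic_fun_onD:
  assumes "holomorphic_fun_on f S" "x \<in> S"
  obtains D where "(f has_derivative D) (at x)" "\<And>c v. D (c *s v) = c * D v"
  using assms by (auto simp: holomorphic_fun_on_def)

lemma holomorphic_fun_on_imp_continuous_on:
  assumes "holomorphic_fun_on f S"
  shows "continuous_on S f"
  using assms unfolding holomorphic_fun_on_def continuous_on_eq_continuous_within
  by (meson continuous_at_imp_continuous_at_within has_derivative_continuous)

lemma holomorphic_fun_on_const: "holomorphic_fun_on (\<lambda>_. c) S"
  unfolding holomorphic_fun_on_def by (intro ballI exI[of _ "\<lambda>_. 0"]) auto

lemma holomorphic_fun_on_add:
  assumes "holomorphic_fun_on f S" "holomorphic_fun_on g S"
  shows "holomorphic_fun_on (\<lambda>x. f x + g x) S"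
  unfolding holomorphic_fun_on_def
proof
  fix x assume x: "x \<in> S"
  obtain D where D: "(f has_derivative D) (at x)" "\<And>c v. D (c *s v) = c * D v"
    by (rule holomorphic_fun_onD[OF assms(1) x]) blast
  obtain E where E: "(g has_derivative E) (at x)" "\<And>c v. E (c *s v) = c * E v"
    by (rule holomorphic_fun_onD[OF assms(2) x]) blast
  show "\<exists>D. ((\<lambda>x. f x + g x) has_derivative D) (at x) \<and> (\<forall>c v. D (c *s v) = c * D v)"
    using D E by (intro exI[of _ "\<lambda>h. D h + E h"]) (auto intro: has_derivative_add simp: algebra_simps)
qed

lemma holomorphic_fun_on_mult:
  assumes "holomorphic_fun_on f S" "holomorphic_fun_on g S"
  shows "holomorphic_fun_on (\<lambda>x. f x * g x) S"
  unfolding holomorphic_fun_on_def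
proof
  fix x assume x: "x \<in> S"
  obtain D where D: "(f has_derivative D) (at x)" "\<And>c v. D (c *s v) = c * D v"
    by (rule holomorphic_fun_onD[OF assms(1) x]) blast
  obtain E where E: "(g has_derivative E) (at x)" "\<And>c v. E (c *s v) = c * E v"
    by (rule holomorphic_fun_onD[OF assms(2) x]) blast
  show "\<exists>D. ((\<lambda>x. f x * g x) has_derivative D) (at x) \<and> (\<forall>c v. D (c *s v) = c * D v)"
    by (intro exI[of _ "\<lambda>h. f x * E h + D h * g x"] conjI has_derivative_mult D(1) E(1))
      (simp add: D(2) E(2) distrib_left mult_ac)
qed

lemma holomorphic_fun_on_cong:
  assumes "holomorphic_fun_on f S" "open S" "\<And>x. x \<in> S \<Longrightarrow> f x = g x"
  shows "holomorphic_fun_on g S"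
  unfolding holomorphic_fun_on_def
proof
  fix x assume x: "x \<in> S"
  obtain D where D: "(f has_derivative D) (at x)" "\<And>c v. D (c *s v) = c * D v"
    by (rule holomorphic_fun_onD[OF assms(1) x]) blast
  show "\<exists>D. (g has_derivative D) (at x) \<and> (\<forall>c v. D (c *s v) = c * D v)"
    using has_derivative_transform_within_open[OF D(1) assms(2) x assms(3)] D(2) by blast
qed

lemma holomorphic_fun_on_compose:
  assumes f: "holomorphic_fun_on f T" and F: "holomorphic_map_on F S" and FS: "F ` S \<subseteq> T"
  shows "holomorphic_fun_on (\<lambda>x. f (F x)) S"
  unfolding holomorphic_fun_on_def
proof
  fix x assume x: "x \<in> S"
  then have Fx: "F x \<in> T" using FS by auto
  obtain D where D: "(f has_derivative D) (at (F x))" "\<And>c v. D (c *s v) = c * D v"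
    by (rule holomorphic_fun_onD[OF f Fx]) blast
  let ?A = "matrix (frechet_derivative F (at x))"
  have "((\<lambda>x. f (F x)) has_derivative (\<lambda>h. D (?A *v h))) (at x)"
    by (rule has_derivative_compose[OF holomorphic_map_on_imp_matrix[OF F x] D(1)])
  then show "\<exists>D. ((\<lambda>x. f (F x)) has_derivative D) (at x) \<and> (\<forall>c v. D (c *s v) = c * D v)"
    by (intro exI[of _ "\<lambda>h. D (?A *v h)"]) (auto simp: D(2) vector_scalar_commute)
qed

section \<open>Restriction to complex lines and mean values\<close>

lemma holomorphic_fun_on_line:
  fixes f :: "complex ^ 'n \<Rightarrow> complex"
  assumes "(f has_derivative D) (at (z + t *s v))" "\<And>c v. D (c *s v) = c * D v"
  shows "((\<lambda>t. f (z + t *s v)) has_field_derivative D v) (at t)"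
proof -
  have "((\<lambda>t. z + t *s v) has_derivative (\<lambda>t. t *s v)) (at t)"
    by (rule has_derivative_eq_rhs, rule has_derivative_add, rule has_derivative_const,
        rule linear_imp_has_derivative, rule linear_scalar_left) simp
  then have "((\<lambda>t. f (z + t *s v)) has_derivative (\<lambda>h. D (h *s v))) (at t)"
    by (rule has_derivative_compose) (rule assms(1))
  then show ?thesis
    by (simp add: has_field_derivative_def assms(2) mult_commute_abs)
qed

lemma holomorphic_on_line:
  assumes f: "holomorphic_fun_on f S" and T: "\<And>t. t \<in> T \<Longrightarrow> z + t *s v \<in> S"
  shows "(\<lambda>t. f (z + t *s v)) holomorphic_on T"
  unfolding holomorphic_on_def
proof
  fix t assume "t \<in> T"
  from holomorphic_fun_onD[OF f T[OF this]] obtain D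
    where D: "(f has_derivative D) (at (z + t *s v))" "\<And>c v. D (c *s v) = c * D v" by metis
  show "(\<lambda>t. f (z + t *s v)) field_differentiable at t within T"
    using holomorphic_fun_on_line[OF D]
    by (meson field_differentiable_at_within field_differentiable_def)
qed

text \<open>Cauchy's formula on the unit circle, parametrised over \<open>{0..1}\<close> so that the
  mean has total weight 1. The nonnegative integral is the form in which Fubini's theorem is applied
  to it afterwards.\<close>

lemma norm_le_circle_mean:
  assumes hol: "g holomorphic_on cball 0 1"
  shows "ennreal (cmod (g 0))
    \<le> (\<integral>\<^sup>+\<theta>. indicator {0..1} \<theta> * ennreal (cmod (g (exp (2 * of_real pi * \<i> * of_real \<theta>)))) \<partial>lborel)"
proof -
  let ?e = "\<lambda>\<theta>::real. exp (2 * of_real pi * \<i> * of_real \<theta>)"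
  have "((\<lambda>u. g u / (u - 0)) has_contour_integral (2 * of_real pi * \<i> * g 0)) (circlepath 0 1)"
    by (rule Cauchy_integral_circlepath_simple[OF hol]) simp
  then have "((\<lambda>x. g (circlepath 0 1 x) / circlepath 0 1 x *
      vector_derivative (circlepath 0 1) (at x within {0..1})) has_integral 2 * of_real pi * \<i> * g 0) {0..1}"
    by (simp add: has_contour_integral_def)
  then have "((\<lambda>x. (2 * of_real pi * \<i>) * g (?e x)) has_integral (2 * of_real pi * \<i>) * g 0) {0..1}"
    by (rule has_integral_eq[rotated]) (simp add: vector_derivative_circlepath01, simp add: circlepath)
  then have "((\<lambda>x. (1 / (2 * of_real pi * \<i>)) * ((2 * of_real pi * \<i>) * g (?e x))) has_integral
      (1 / (2 * of_real pi * \<i>)) * ((2 * of_real pi * \<i>) * g 0)) {0..1}"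
    by (rule has_integral_mult_right)
  then have hi: "((\<lambda>x. g (?e x)) has_integral g 0) {0..1}" by simp
  have cont: "continuous_on {0..1} (\<lambda>x. g (?e x))"
    by (rule continuous_on_compose2[OF holomorphic_on_imp_continuous_on[OF hol]])
      (auto intro!: continuous_intros simp: norm_exp_eq_Re)
  then have "(\<lambda>x. cmod (g (?e x))) integrable_on {0..1}"
    by (intro integrable_continuous_real continuous_on_norm)
  then obtain I where I: "((\<lambda>x. cmod (g (?e x))) has_integral I) {0..1}" by blast
  have "cmod (g 0) \<le> I"
    using integral_norm_bound_integral[of "\<lambda>x. g (?e x)" "{0..1}" "\<lambda>x. cmod (g (?e x))"] hi I
    by (auto simp: has_integral_iff)
  then have "ennreal (cmod (g 0)) \<le> ennreal I" by (rule ennreal_leI)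
  also have "ennreal I = (\<integral>\<^sup>+x. ennreal (indicator {0..1} x * cmod (g (?e x))) \<partial>lborel)"
    by (rule nn_integral_has_integral_lebesgue[symmetric, OF _ I]) simp
  also have "\<dots> = (\<integral>\<^sup>+x. indicator {0..1} x * ennreal (cmod (g (?e x))) \<partial>lborel)"
    by (intro nn_integral_cong) (auto simp: indicator_def)
  finally show ?thesis .
qed

text \<open>Closed balls and polydiscs are both balanced about their centres, so a single sub-mean
  value property serves the construction of the kernel and the final estimate.\<close>

definition complex_balanced :: "complex ^ 'n \<Rightarrow> (complex ^ 'n) set \<Rightarrow> bool" where
  "complex_balanced z B \<longleftrightarrow> (\<forall>w\<in>B. \<forall>t. cmod t \<le> 1 \<longrightarrow> z + t *s (w - z) \<in> B)"

text \<open>Balancedness for \<open>c\<close> and for its inverse makes the rotation a bijection of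
  \<open>B\<close>, and its complex Jacobian is a power of a number of modulus 1.\<close>

lemma nn_integral_rotation_le:
  fixes B :: "(complex ^ 'n) set"
  assumes B: "B \<in> lmeasurable" and bal: "complex_balanced z B" and c: "cmod c = 1"
    and g: "g \<in> borel_measurable (lebesgue_on B)"
  shows "(\<integral>\<^sup>+w. g (z + c *s (w - z)) \<partial>lebesgue_on B) \<le> (\<integral>\<^sup>+w. g w \<partial>lebesgue_on B)"
proof -
  have "c \<noteq> 0" using c by auto
  then have inv: "inverse c * c = 1" "c * inverse c = 1" by auto
  have d: "det (mat a :: complex ^ 'n ^ 'n) = a ^ CARD('n)" for a
    by (subst det_diagonal) (auto simp: mat_def)
  have mv: "mat a *v x = a *s x" for a and x :: "complex ^ 'n"
  proof -
    have "(\<Sum>j\<in>UNIV. (if i = j then a else 0) * x $ j) = (\<Sum>j\<in>UNIV. if j = i then a * x $ j else 0)" for i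
      by (rule sum.cong) auto
    then show ?thesis by (simp add: vec_eq_iff matrix_vector_mult_def mat_def)
  qed
  have "(\<integral>\<^sup>+w. g (z + c *s (w - z)) \<partial>lebesgue_on B) \<le> ennreal (1\<^sup>2) * (\<integral>\<^sup>+w. g w \<partial>lebesgue_on B)"
  proof (rule nn_integral_substitution_le[where G="\<lambda>y. z + inverse c *s (y - z)"
        and J="\<lambda>_. mat (inverse c)", OF B B])
    show "((\<lambda>y. z + inverse c *s (y - z)) has_derivative (*v) (mat (inverse c))) (at y within B)" for y
    proof -
      have "((\<lambda>y. inverse c *s (y - z)) has_derivative (\<lambda>h. inverse c *s h)) (at y within B)"
        by (rule bounded_linear.has_derivative[OF linear_linear[THEN iffD2, OF linear_scalar_right]])
          (auto intro!: derivative_eq_intros)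
      then have "((\<lambda>y. z + inverse c *s (y - z)) has_derivative (\<lambda>h. 0 + inverse c *s h)) (at y within B)"
        by (rule has_derivative_add[OF has_derivative_const])
      moreover have "(*v) (mat (inverse c)) = (\<lambda>h :: complex ^ 'n. 0 + inverse c *s h)" by (auto simp: mv)
      ultimately show ?thesis by simp
    qed
  qed (use bal c g in \<open>auto simp: complex_balanced_def d norm_power norm_inverse
      vector_smult_assoc inv\<close>)
  then show ?thesis by simp
qed

lemma nn_integral_lebesgue_on:
  assumes "B \<in> sets lebesgue"
  shows "(\<integral>\<^sup>+w. g w \<partial>lebesgue_on B) = (\<integral>\<^sup>+w. g w * indicator B w \<partial>lborel)"
  using assms by (simp add: nn_integral_restrict_space nn_integral_completion)

text \<open>Average the circle means over \<open>B\<close> and use that rotations about \<open>z\<close> preserve \<open>B\<close> and its measure.\<close>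

lemma submean_value:
  fixes F :: "complex ^ 'n \<Rightarrow> complex"
  assumes B: "compact B" and bal: "complex_balanced z B" and hol: "holomorphic_fun_on F D" and BD: "B \<subseteq> D"
  shows "emeasure lebesgue B * ennreal (cmod (F z)) \<le> (\<integral>\<^sup>+w. ennreal (cmod (F w)) \<partial>lebesgue_on B)"
proof -
  let ?e = "\<lambda>\<theta>::real. exp (2 * of_real pi * \<i> * of_real \<theta>)"
  let ?r = "\<lambda>\<theta> w. z + ?e \<theta> *s (w - z)"
  let ?h = "\<lambda>\<theta> w. indicator ({0..1} \<times> B) (\<theta>, w) * ennreal (cmod (F (?r \<theta> w)))"
  have e1: "cmod (?e \<theta>) = 1" for \<theta> by (simp add: norm_exp_eq_Re)
  have Bm: "B \<in> lmeasurable" using B by (rule lmeasurable_compact)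
  have Bl: "B \<in> sets lebesgue" using Bm by auto
  have Bb: "B \<in> sets borel" using B by (simp add: borel_compact)
  have rB: "?r \<theta> w \<in> B" if "w \<in> B" for \<theta> w
    using bal that e1[of \<theta>] unfolding complex_balanced_def by (metis order_refl)
  have contF: "continuous_on B F"
    using holomorphic_fun_on_imp_continuous_on[OF hol] BD continuous_on_subset by blast
  have "continuous_on ({0..1} \<times> B) (\<lambda>x. ?r (fst x) (snd x))"
    by (intro continuous_intros continuous_on_vector_scalar_mult)
  then have "continuous_on ({0..1} \<times> B) (\<lambda>x. F (?r (fst x) (snd x)))"
    by (rule continuous_on_compose2[OF contF]) (use rB in \<open>auto simp del: vector_ssub_ldistrib\<close>)
  then have "continuous_on ({0..1} \<times> B) (\<lambda>x. cmod (F (?r (fst x) (snd x))))"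
    by (rule continuous_on_norm)
  then have "(\<lambda>x. indicator ({0..1} \<times> B) x *\<^sub>R cmod (F (?r (fst x) (snd x)))) \<in> borel_measurable borel"
    by (intro borel_measurable_continuous_on_indicator borel_Times Bb) auto
  then have "(\<lambda>x. ennreal (indicator ({0..1} \<times> B) x *\<^sub>R cmod (F (?r (fst x) (snd x))))) \<in> borel_measurable borel"
    by measurable
  also have "(\<lambda>x. ennreal (indicator ({0..1} \<times> B) x *\<^sub>R cmod (F (?r (fst x) (snd x))))) = (\<lambda>(\<theta>, w). ?h \<theta> w)"
    by (auto simp: fun_eq_iff indicator_def)
  finally have meas: "(\<lambda>(\<theta>, w). ?h \<theta> w) \<in> borel_measurable (lborel \<Otimes>\<^sub>M (lborel :: (complex ^ 'n) measure))"
    by (simp add: measurable_def lborel_prod)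
  have "emeasure lebesgue B * ennreal (cmod (F z)) = (\<integral>\<^sup>+w. ennreal (cmod (F z)) * indicator B w \<partial>lborel)"
    using Bb by (subst nn_integral_cmult_indicator) (auto simp: mult.commute)
  also have "\<dots> \<le> (\<integral>\<^sup>+w. (\<integral>\<^sup>+\<theta>. ?h \<theta> w \<partial>lborel) \<partial>lborel)"
  proof (rule nn_integral_mono)
    fix w
    show "ennreal (cmod (F z)) * indicator B w \<le> (\<integral>\<^sup>+\<theta>. ?h \<theta> w \<partial>lborel)"
    proof (cases "w \<in> B")
      case True
      \<comment> \<open>Whatever \<open>w\<close> is, the disc
        \<open>t \<mapsto> z + t *s (w - z)\<close> is centred at \<open>z\<close>, so every circle
        mean is compared with the same value \<open>F z\<close>.\<close>
      have "(\<lambda>t. F (z + t *s (w - z))) holomorphic_on cball 0 1"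
        using True bal BD by (intro holomorphic_on_line[OF hol]) (auto simp: complex_balanced_def)
      from norm_le_circle_mean[OF this] True show ?thesis by (simp add: indicator_def)
    qed simp
  qed
  also have "\<dots> = (\<integral>\<^sup>+\<theta>. (\<integral>\<^sup>+w. ?h \<theta> w \<partial>lborel) \<partial>lborel)"
    by (rule lborel_pair.Fubini'[OF meas])
  also have "\<dots> \<le> (\<integral>\<^sup>+\<theta>. (\<integral>\<^sup>+w. ennreal (cmod (F w)) \<partial>lebesgue_on B) * indicator {0..1} \<theta> \<partial>(lborel :: real measure))"
  proof (rule nn_integral_mono)
    fix \<theta> :: real
    have "(\<lambda>w. ennreal (cmod (F w))) \<in> borel_measurable (lebesgue_on B)"
      using continuous_imp_measurable_on_sets_lebesgue[OF continuous_on_norm[OF contF] Bl] by measurable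
    from nn_integral_rotation_le[OF Bm bal e1[of \<theta>] this]
    have "(\<integral>\<^sup>+w. ennreal (cmod (F (?r \<theta> w))) * indicator B w \<partial>lborel) \<le> (\<integral>\<^sup>+w. ennreal (cmod (F w)) \<partial>lebesgue_on B)"
      by (simp add: nn_integral_lebesgue_on[OF Bl, symmetric])
    moreover have "?h \<theta> w = (if \<theta> \<in> {0..1} then ennreal (cmod (F (?r \<theta> w))) * indicator B w else 0)" for w
      by (auto simp: indicator_def)
    ultimately show "(\<integral>\<^sup>+w. ?h \<theta> w \<partial>lborel) \<le> (\<integral>\<^sup>+w. ennreal (cmod (F w)) \<partial>lebesgue_on B) * indicator {0..1} \<theta>"
      by (cases "\<theta> \<in> {0..1}") (simp_all del: vector_ssub_ldistrib atLeastAtMost_iff)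
  qed
  also have "\<dots> = (\<integral>\<^sup>+w. ennreal (cmod (F w)) \<partial>lebesgue_on B)"
    by (subst nn_integral_cmult_indicator) auto
  finally show ?thesis .
qed

section \<open>Square-integrable functions\<close>

text \<open>Functions are not identified almost everywhere. Definiteness of the norm is recovered
  for holomorphic functions, in \<open>bergman_space_eq_0\<close>.\<close>

definition L2_on :: "'a measure \<Rightarrow> ('a \<Rightarrow> complex) set" where
  "L2_on M = {u. u \<in> borel_measurable M \<and> integrable M (\<lambda>w. (cmod (u w))\<^sup>2)}"

definition L2_inner :: "'a measure \<Rightarrow> ('a \<Rightarrow> complex) \<Rightarrow> ('a \<Rightarrow> complex) \<Rightarrow> complex" where
  "L2_inner M u v = (\<integral>w. u w * cnj (v w) \<partial>M)"

definition L2_sq :: "'a measure \<Rightarrow> ('a \<Rightarrow> complex) \<Rightarrow> real" where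
  "L2_sq M u = (\<integral>w. (cmod (u w))\<^sup>2 \<partial>M)"

lemma L2_sq_nonneg [simp]: "0 \<le> L2_sq M u"
  by (simp add: L2_sq_def)

lemma integrable_L2_mult:
  assumes "u \<in> L2_on M" "v \<in> L2_on M"
  shows "integrable M (\<lambda>w. u w * v w)"
proof (rule Bochner_Integration.integrable_bound)
  show "integrable M (\<lambda>w. (cmod (u w))\<^sup>2 + (cmod (v w))\<^sup>2)"
    using assms by (auto simp: L2_on_def)
  show "(\<lambda>w. u w * v w) \<in> borel_measurable M"
    using assms by (auto simp: L2_on_def)
  have "cmod a * cmod b \<le> (cmod a)\<^sup>2 + (cmod b)\<^sup>2" for a b :: complex
  proof -
    have "0 \<le> cmod a * cmod b" by simp
    then show ?thesis using sum_squares_bound[of "cmod a" "cmod b"] by linarith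
  qed
  then show "AE w in M. norm (u w * v w) \<le> norm ((cmod (u w))\<^sup>2 + (cmod (v w))\<^sup>2)"
    by (auto simp: norm_mult)
qed

lemma L2_on_cnj: "u \<in> L2_on M \<Longrightarrow> (\<lambda>w. cnj (u w)) \<in> L2_on M"
  using measurable_compose[OF _ borel_measurable_continuous_onI[OF continuous_on_cnj[OF continuous_on_id]]]
  by (auto simp: L2_on_def)

lemma L2_on_mult_left: "u \<in> L2_on M \<Longrightarrow> (\<lambda>w. c * u w) \<in> L2_on M"
  by (auto simp: L2_on_def norm_mult power_mult_distrib)

lemma L2_on_add:
  assumes "u \<in> L2_on M" "v \<in> L2_on M"
  shows "(\<lambda>w. u w + v w) \<in> L2_on M"
proof -
  have "integrable M (\<lambda>w. (cmod (u w + v w))\<^sup>2)"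
  proof (rule Bochner_Integration.integrable_bound)
    show "integrable M (\<lambda>w. 2 * (cmod (u w))\<^sup>2 + 2 * (cmod (v w))\<^sup>2)"
      using assms by (auto simp: L2_on_def)
    show "(\<lambda>w. (cmod (u w + v w))\<^sup>2) \<in> borel_measurable M"
      using assms by (auto simp: L2_on_def)
    have "(cmod (a + b))\<^sup>2 \<le> 2 * (cmod a)\<^sup>2 + 2 * (cmod b)\<^sup>2" for a b :: complex
    proof -
      have "(cmod (a + b))\<^sup>2 \<le> (cmod a + cmod b)\<^sup>2"
        by (intro power_mono norm_triangle_ineq) simp
      also have "\<dots> \<le> 2 * (cmod a)\<^sup>2 + 2 * (cmod b)\<^sup>2"
        using sum_squares_bound[of "cmod a" "cmod b"] by (simp add: power2_sum)
      finally show ?thesis .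
    qed
    then show "AE w in M. norm ((cmod (u w + v w))\<^sup>2) \<le> norm (2 * (cmod (u w))\<^sup>2 + 2 * (cmod (v w))\<^sup>2)"
      by auto
  qed
  with assms show ?thesis by (auto simp: L2_on_def)
qed

lemma L2_inner_self: "L2_inner M u u = of_real (L2_sq M u)"
  unfolding L2_inner_def L2_sq_def complex_norm_square[symmetric] integral_complex_of_real ..

lemma L2_inner_commute: "L2_inner M v u = cnj (L2_inner M u v)"
proof -
  have "cnj (L2_inner M u v) = (\<integral>w. cnj (u w * cnj (v w)) \<partial>M)"
    unfolding L2_inner_def by (rule Bochner_Integration.integral_cnj[symmetric])
  then show ?thesis by (simp add: L2_inner_def mult.commute)
qed

lemma L2_inner_add_left:
  assumes "u \<in> L2_on M" "v \<in> L2_on M" "w \<in> L2_on M"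
  shows "L2_inner M (\<lambda>x. u x + v x) w = L2_inner M u w + L2_inner M v w"
  unfolding L2_inner_def
  using integrable_L2_mult[OF assms(1) L2_on_cnj[OF assms(3)]]
    integrable_L2_mult[OF assms(2) L2_on_cnj[OF assms(3)]]
  by (simp add: distrib_right)

lemma L2_inner_mult_left: "L2_inner M (\<lambda>x. c * u x) w = c * L2_inner M u w"
  unfolding L2_inner_def by (simp add: mult.assoc)

lemma L2_sq_mult: "L2_sq M (\<lambda>x. c * u x) = (cmod c)\<^sup>2 * L2_sq M u"
  unfolding L2_sq_def by (simp add: norm_mult power_mult_distrib)

lemma L2_sq_add:
  assumes "u \<in> L2_on M" "v \<in> L2_on M"
  shows "L2_sq M (\<lambda>x. u x + v x) = L2_sq M u + L2_sq M v + 2 * Re (L2_inner M u v)"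
proof -
  have i: "integrable M (\<lambda>w. u w * cnj (v w))"
    by (rule integrable_L2_mult[OF assms(1) L2_on_cnj[OF assms(2)]])
  have "(cmod (a + b))\<^sup>2 = (cmod a)\<^sup>2 + (cmod b)\<^sup>2 + 2 * Re (a * cnj b)" for a b
    unfolding cmod_power2 by (simp add: power2_eq_square algebra_simps)
  then have "L2_sq M (\<lambda>x. u x + v x)
      = (\<integral>x. ((cmod (u x))\<^sup>2 + (cmod (v x))\<^sup>2) + 2 * Re (u x * cnj (v x)) \<partial>M)"
    unfolding L2_sq_def by simp
  also have "\<dots> = (\<integral>x. (cmod (u x))\<^sup>2 + (cmod (v x))\<^sup>2 \<partial>M) + (\<integral>x. 2 * Re (u x * cnj (v x)) \<partial>M)"
    using assms i by (intro Bochner_Integration.integral_add integrable_mult_right integrable_Re)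
      (auto simp: L2_on_def)
  also have "(\<integral>x. (cmod (u x))\<^sup>2 + (cmod (v x))\<^sup>2 \<partial>M) = L2_sq M u + L2_sq M v"
    unfolding L2_sq_def using assms by (intro Bochner_Integration.integral_add) (auto simp: L2_on_def)
  also have "(\<integral>x. 2 * Re (u x * cnj (v x)) \<partial>M) = 2 * Re (L2_inner M u v)"
    unfolding L2_inner_def using i by (simp add: integral_Re del: times_complex.sel)
  finally show ?thesis .
qed

lemma L2_sq_add_scaled:
  assumes "u \<in> L2_on M" "v \<in> L2_on M"
  shows "L2_sq M (\<lambda>x. u x + c * v x)
    = L2_sq M u + (cmod c)\<^sup>2 * L2_sq M v + 2 * Re (cnj c * L2_inner M u v)"
proof -
  have "L2_inner M u (\<lambda>x. c * v x) = cnj c * L2_inner M u v"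
    using L2_inner_commute[of M u "\<lambda>x. c * v x"] L2_inner_commute[of M u v]
    by (simp add: L2_inner_mult_left)
  then show ?thesis
    using L2_sq_add[OF assms(1) L2_on_mult_left[OF assms(2)], of c] by (simp add: L2_sq_mult)
qed

text \<open>The squared norm of \<open>u - t * c * v\<close> with \<open>c = L2_inner M u v\<close>
  is a nonnegative polynomial of degree at most two in the real variable \<open>t\<close>; it is
  evaluated at its minimum \<open>t = 1 / L2_sq M v\<close>, if there is one.\<close>

lemma L2_Cauchy_Schwarz:
  assumes u: "u \<in> L2_on M" and v: "v \<in> L2_on M"
  shows "(cmod (L2_inner M u v))\<^sup>2 \<le> L2_sq M u * L2_sq M v"
proof -
  let ?c = "L2_inner M u v"
  have *: "0 \<le> L2_sq M u + t\<^sup>2 * (cmod ?c)\<^sup>2 * L2_sq M v - 2 * t * (cmod ?c)\<^sup>2" for t :: real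
  proof -
    have "0 \<le> L2_sq M (\<lambda>x. u x + (- of_real t * ?c) * v x)" by simp
    also have "\<dots> = L2_sq M u + (cmod (- of_real t * ?c))\<^sup>2 * L2_sq M v
        + 2 * Re (cnj (- of_real t * ?c) * ?c)"
      by (rule L2_sq_add_scaled[OF u v])
    also have "cnj (- of_real t * ?c) * ?c = of_real (- t * (cmod ?c)\<^sup>2)"
      by (simp only: of_real_mult complex_norm_square) simp
    finally show ?thesis by (simp add: norm_mult power_mult_distrib)
  qed
  show ?thesis
  proof (cases "L2_sq M v = 0")
    case True
    have "(cmod ?c)\<^sup>2 = 0"
    proof (rule ccontr)
      assume "(cmod ?c)\<^sup>2 \<noteq> 0"
      then have p: "(cmod ?c)\<^sup>2 > 0" by simp
      \<comment> \<open>With \<open>L2_sq M v = 0\<close> the polynomial is affine in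
        \<open>t\<close>, and this argument would give it the value
        \<open>- L2_sq M u - 2\<close>.\<close>
      from *[of "(L2_sq M u + 1) / (cmod ?c)\<^sup>2"] True p
      have "2 * (L2_sq M u + 1) \<le> L2_sq M u" by simp
      then have "L2_sq M u \<le> -2" by (simp add: algebra_simps)
      then show False using L2_sq_nonneg[of M u] by (simp add: not_le)
    qed
    with True show ?thesis by simp
  next
    case False
    then have p: "L2_sq M v > 0" using L2_sq_nonneg[of M v] by linarith
    have "0 \<le> L2_sq M u + (1 / L2_sq M v)\<^sup>2 * (cmod ?c)\<^sup>2 * L2_sq M v - 2 * (1 / L2_sq M v) * (cmod ?c)\<^sup>2"
      by (rule *)
    also have "\<dots> = L2_sq M u - (cmod ?c)\<^sup>2 / L2_sq M v"
      using p by (simp add: field_simps power2_eq_square)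
    finally show ?thesis using p by (simp add: field_simps)
  qed
qed

lemma L2_parallelogram:
  assumes "u \<in> L2_on M" "v \<in> L2_on M"
  shows "L2_sq M (\<lambda>x. u x - v x) = 2 * L2_sq M u + 2 * L2_sq M v - 4 * L2_sq M (\<lambda>x. (1/2) * (u x + v x))"
  using L2_sq_add_scaled[OF assms, of 1] L2_sq_add_scaled[OF assms, of "-1"]
    L2_sq_mult[of M "1/2" "\<lambda>x. u x + v x"]
  by (simp add: power2_eq_square)

text \<open>Fatou's lemma yields membership of the limit and the bound at once. The bound is asked
  for from some index on, as it is available for tails of Cauchy sequences and for minimising
  sequences.\<close>

lemma L2_Fatou:
  assumes f: "\<And>n. f n \<in> L2_on M" and g: "g \<in> borel_measurable M"
    and lim: "\<And>x. x \<in> space M \<Longrightarrow> (\<lambda>n. f n x) \<longlonglongrightarrow> g x"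
    and bd: "\<And>n. n \<ge> N \<Longrightarrow> L2_sq M (f n) \<le> c"
  shows "g \<in> L2_on M" "L2_sq M g \<le> c"
proof -
  have c: "0 \<le> c" using bd[of N] L2_sq_nonneg[of M "f N"] by linarith
  have fi: "(\<integral>\<^sup>+x. ennreal ((cmod (f n x))\<^sup>2) \<partial>M) = ennreal (L2_sq M (f n))" for n
    using f[of n] by (simp add: L2_on_def L2_sq_def nn_integral_eq_integral)
  have "(\<integral>\<^sup>+x. ennreal ((cmod (g x))\<^sup>2) \<partial>M) = (\<integral>\<^sup>+x. liminf (\<lambda>n. ennreal ((cmod (f n x))\<^sup>2)) \<partial>M)"
  proof (rule nn_integral_cong)
    fix x assume "x \<in> space M"
    then have "(\<lambda>n. ennreal ((cmod (f n x))\<^sup>2)) \<longlonglongrightarrow> ennreal ((cmod (g x))\<^sup>2)"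
      using lim by (intro tendsto_ennrealI tendsto_power tendsto_norm)
    then show "ennreal ((cmod (g x))\<^sup>2) = liminf (\<lambda>n. ennreal ((cmod (f n x))\<^sup>2))"
      by (rule lim_imp_Liminf[OF sequentially_bot, symmetric])
  qed
  also have "\<dots> \<le> liminf (\<lambda>n. \<integral>\<^sup>+x. ennreal ((cmod (f n x))\<^sup>2) \<partial>M)"
    using f by (intro nn_integral_liminf) (auto simp: L2_on_def)
  also have "\<dots> = liminf (\<lambda>n. ennreal (L2_sq M (f n)))" by (simp add: fi)
  also have "\<dots> \<le> ennreal c"
  proof (rule Liminf_le)
    show "\<forall>\<^sub>F n in sequentially. ennreal (L2_sq M (f n)) \<le> ennreal c"
      using bd by (auto simp: eventually_sequentially intro!: exI[of _ N] ennreal_leI)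
  qed simp
  finally have le: "(\<integral>\<^sup>+x. ennreal ((cmod (g x))\<^sup>2) \<partial>M) \<le> ennreal c" .
  have "(\<integral>\<^sup>+x. ennreal ((cmod (g x))\<^sup>2) \<partial>M) < \<infinity>"
    using le_less_trans[OF le ennreal_less_top] by (simp only: infinity_ennreal_def)
  then have int: "integrable M (\<lambda>x. (cmod (g x))\<^sup>2)"
    using g by (intro integrableI_nonneg) auto
  then show "g \<in> L2_on M" using g by (simp add: L2_on_def)
  from le int have "ennreal (L2_sq M g) \<le> ennreal c"
    by (simp add: L2_sq_def nn_integral_eq_integral)
  then show "L2_sq M g \<le> c" using c by (simp add: ennreal_le_iff)
qed

section \<open>The Bergman space\<close>

lemma bergman_space_L2:
  assumes "open D" "f \<in> bergman_space D"
  shows "f \<in> L2_on (lebesgue_on D)"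
proof -
  have "continuous_on D f"
    using assms(2) by (auto simp: bergman_space_def intro: holomorphic_fun_on_imp_continuous_on)
  then have "f \<in> borel_measurable (lebesgue_on D)"
    using assms(1) by (intro continuous_imp_measurable_on_sets_lebesgue) auto
  with assms(2) show ?thesis by (simp add: L2_on_def bergman_space_def)
qed

lemma bergman_space_iff:
  "open D \<Longrightarrow> f \<in> bergman_space D \<longleftrightarrow> holomorphic_fun_on f D \<and> f \<in> L2_on (lebesgue_on D)"
  using bergman_space_L2 by (auto simp: bergman_space_def L2_on_def)

lemma bergman_space_holomorphic: "f \<in> bergman_space D \<Longrightarrow> holomorphic_fun_on f D"
  by (simp add: bergman_space_def)

lemma bergman_space_add:
  "open D \<Longrightarrow> f \<in> bergman_space D \<Longrightarrow> g \<in> bergman_space D \<Longrightarrow> (\<lambda>x. f x + g x) \<in> bergman_space D"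
  by (simp add: bergman_space_iff holomorphic_fun_on_add L2_on_add)

lemma bergman_space_mult:
  "open D \<Longrightarrow> f \<in> bergman_space D \<Longrightarrow> (\<lambda>x. c * f x) \<in> bergman_space D"
  by (simp add: bergman_space_iff holomorphic_fun_on_mult[OF holomorphic_fun_on_const] L2_on_mult_left)

lemma bergman_space_diff:
  assumes "open D" "f \<in> bergman_space D" "g \<in> bergman_space D"
  shows "(\<lambda>x. f x - g x) \<in> bergman_space D"
  using bergman_space_add[OF assms(1,2) bergman_space_mult[OF assms(1,3), of "-1"]] by simp

section \<open>Point evaluations, Cauchy estimates and completeness\<close>

lemma complex_balanced_cball: "complex_balanced z (cball z \<rho>)"
  unfolding complex_balanced_def
proof (intro ballI allI impI)
  fix w t assume w: "w \<in> cball z \<rho>" and t: "cmod t \<le> 1"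
  have "norm (t *s (w - z)) = cmod t * norm (w - z)" by (rule norm_vector_scalar_mult)
  also have "\<dots> \<le> 1 * norm (w - z)" using t by (intro mult_right_mono) auto
  also have "\<dots> \<le> \<rho>" using w by (simp add: dist_norm norm_minus_commute)
  finally show "z + t *s (w - z) \<in> cball z \<rho>"
    by (simp add: dist_norm del: vector_ssub_ldistrib)
qed

text \<open>The sub-mean value property for the holomorphic square \<open>f * f\<close>. Measuring
  the ball about 0 instead of \<open>z\<close> shows that the constant depends on the radius alone,
  which makes the bound locally uniform in \<open>z\<close>.\<close>

lemma bergman_space_point_bound:
  fixes f :: "complex ^ 'n \<Rightarrow> complex"
  assumes D: "open D" and f: "f \<in> bergman_space D" and \<rho>: "\<rho> > 0" "cball z \<rho> \<subseteq> D"
  shows "measure lebesgue (cball (0 :: complex ^ 'n) \<rho>) * (cmod (f z))\<^sup>2 \<le> L2_sq (lebesgue_on D) f"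
proof -
  have hol: "holomorphic_fun_on (\<lambda>w. f w * f w) D"
    using f by (intro holomorphic_fun_on_mult bergman_space_holomorphic)
  have eq: "measure lebesgue (cball z \<rho>) = measure lebesgue (cball (0 :: complex ^ 'n) \<rho>)"
    using \<rho>(1) by (simp add: content_cball)
  have "ennreal (measure lebesgue (cball (0 :: complex ^ 'n) \<rho>) * (cmod (f z))\<^sup>2)
      = emeasure lebesgue (cball z \<rho>) * ennreal (cmod (f z * f z))"
    unfolding eq[symmetric] using lmeasurable_cball[of z \<rho>]
    by (simp add: emeasure_eq_measure2 ennreal_mult norm_mult power2_eq_square)
  also have "\<dots> \<le> (\<integral>\<^sup>+w. ennreal (cmod (f w * f w)) \<partial>lebesgue_on (cball z \<rho>))"
    by (rule submean_value[OF compact_cball complex_balanced_cball hol \<rho>(2)])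
  also have "\<dots> = (\<integral>\<^sup>+w. ennreal (cmod (f w * f w)) * indicator (cball z \<rho>) w \<partial>lborel)"
    by (rule nn_integral_lebesgue_on) auto
  also have "\<dots> \<le> (\<integral>\<^sup>+w. ennreal (cmod (f w * f w)) * indicator D w \<partial>lborel)"
    using \<rho>(2) by (intro nn_integral_mono mult_left_mono) (auto simp: indicator_def)
  also have "\<dots> = (\<integral>\<^sup>+w. ennreal (cmod (f w * f w)) \<partial>lebesgue_on D)"
    using D by (intro nn_integral_lebesgue_on[symmetric]) auto
  also have "\<dots> = ennreal (L2_sq (lebesgue_on D) f)"
    using bergman_space_L2[OF D f]
    by (simp add: L2_sq_def L2_on_def norm_mult nn_integral_eq_integral power2_eq_square)
  finally show ?thesis by (simp add: ennreal_le_iff)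
qed

text \<open>On the line through \<open>x\<close> in direction \<open>v\<close> the ball contains the
  disc of radius \<open>r / norm v\<close>, to which the one-variable Cauchy inequality
  applies.\<close>

lemma derivative_Cauchy_bound:
  assumes hol: "holomorphic_fun_on h D" and r: "r > 0" "cball x r \<subseteq> D"
    and bd: "\<And>y. y \<in> cball x r \<Longrightarrow> cmod (h y) \<le> M"
    and der: "(h has_derivative L) (at x)" "\<And>c v. L (c *s v) = c * L v"
  shows "cmod (L v) \<le> M / r * norm v"
proof (cases "v = 0")
  case True
  then show ?thesis using linear_0[OF has_derivative_linear[OF der(1)]] by simp
next
  case False
  let ?R = "r / norm v"
  have R: "?R > 0" using r False by simp
  let ?p = "\<lambda>t. h (x + t *s v)"
  have in_ball: "x + t *s v \<in> cball x r" if "t \<in> cball 0 ?R" for t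
    using that False by (simp add: dist_norm norm_vector_scalar_mult field_simps)
  have "?p holomorphic_on cball 0 ?R"
    using in_ball r(2) by (intro holomorphic_on_line[OF hol]) auto
  then have "norm ((deriv ^^ 1) ?p 0) \<le> fact 1 * M / ?R ^ 1"
  proof (intro Cauchy_inequality)
    show "norm (?p t) \<le> M" if "norm (0 - t) = ?R" for t
      using that by (intro bd in_ball) simp
  qed (use R in \<open>auto intro: holomorphic_on_subset holomorphic_on_imp_continuous_on\<close>)
  moreover have "deriv ?p 0 = L v"
    using holomorphic_fun_on_line[of h L x 0 v] der by (intro DERIV_imp_deriv) simp
  ultimately show ?thesis using R r by (simp add: field_simps)
qed

text \<open>By Cauchy estimates on balls of half the radius the derivatives are uniformly Cauchy, so
  the limit may be differentiated term by term; complex homogeneity passes to the limit.\<close>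

lemma holomorphic_uniform_limit:
  fixes f :: "nat \<Rightarrow> complex ^ 'n \<Rightarrow> complex"
  assumes hol: "\<And>n. holomorphic_fun_on (f n) D"
    and loc: "\<And>z. z \<in> D \<Longrightarrow> \<exists>\<rho>>0. cball z \<rho> \<subseteq> D \<and> uniform_limit (cball z \<rho>) f g sequentially"
  shows "holomorphic_fun_on g D"
  unfolding holomorphic_fun_on_def
proof
  fix z assume "z \<in> D"
  then obtain \<rho> where \<rho>: "\<rho> > 0" "cball z \<rho> \<subseteq> D" and ul: "uniform_limit (cball z \<rho>) f g sequentially"
    using loc by blast
  let ?S = "ball z (\<rho>/2)"
  have S: "cball x (\<rho>/2) \<subseteq> cball z \<rho>" if "x \<in> ?S" for x
  proof
    fix y assume "y \<in> cball x (\<rho>/2)"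
    then show "y \<in> cball z \<rho>" using that dist_triangle[of z y x] by simp
  qed
  have SD: "x \<in> D" if "x \<in> ?S" for x using that \<rho> by auto
  have "\<forall>n. \<forall>x. \<exists>L. x \<in> ?S \<longrightarrow> (f n has_derivative L) (at x) \<and> (\<forall>c v. L (c *s v) = c * L v)"
    using hol SD by (auto simp: holomorphic_fun_on_def)
  then obtain L where L: "\<And>n x. x \<in> ?S \<Longrightarrow> (f n has_derivative L n x) (at x)"
      "\<And>n x c v. x \<in> ?S \<Longrightarrow> L n x (c *s v) = c * L n x v"
    by metis
  have uc: "\<exists>N. \<forall>m\<ge>N. \<forall>n\<ge>N. \<forall>x\<in>?S. \<forall>v. cmod (L m x v - L n x v) \<le> e * norm v" if "e > 0" for e
  proof -
    \<comment> \<open>Two errors below \<open>e * \<rho> / 4\<close> add up to at most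
      \<open>e * \<rho> / 2\<close>, and the Cauchy estimate on a ball of radius
      \<open>\<rho> / 2\<close> turns this into \<open>e\<close>.\<close>
    have "e * \<rho> / 4 > 0" using that \<rho> by simp
    from uniform_limitD[OF ul this] obtain N where
      N: "\<And>n y. n \<ge> N \<Longrightarrow> y \<in> cball z \<rho> \<Longrightarrow> dist (f n y) (g y) < e * \<rho> / 4"
      unfolding eventually_sequentially by metis
    have "cmod (L m x v - L n x v) \<le> e * norm v" if mn: "m \<ge> N" "n \<ge> N" and x: "x \<in> ?S" for m n x v
    proof -
      let ?h = "\<lambda>y. f m y + (-1) * f n y"
      have "cmod (L m x v + (-1) * L n x v) \<le> (e * \<rho> / 2) / (\<rho> / 2) * norm v"
      proof (rule derivative_Cauchy_bound[where h = ?h and x = x and D = D])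
        show "holomorphic_fun_on ?h D"
          by (intro holomorphic_fun_on_add holomorphic_fun_on_mult holomorphic_fun_on_const hol)
        show "cball x (\<rho> / 2) \<subseteq> D" using S[OF x] \<rho> by blast
        show "cmod (?h y) \<le> e * \<rho> / 2" if "y \<in> cball x (\<rho> / 2)" for y
        proof -
          have y: "y \<in> cball z \<rho>" using that S[OF x] by blast
          have "cmod (f m y - f n y) \<le> dist (f m y) (g y) + dist (f n y) (g y)"
            by (metis dist_norm dist_triangle2)
          then show ?thesis using N[OF mn(1) y] N[OF mn(2) y] by simp
        qed
        show "(?h has_derivative (\<lambda>v. L m x v + (-1) * L n x v)) (at x)"
          by (intro has_derivative_add has_derivative_mult_right L(1)[OF x])
      qed (use \<rho> in \<open>auto simp: L(2)[OF x] algebra_simps\<close>)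
      then show ?thesis using \<rho> by simp
    qed
    then show ?thesis by blast
  qed
  have "\<exists>l. (\<lambda>n. L n x v) \<longlonglongrightarrow> l" if x: "x \<in> ?S" for x v
  proof -
    have "Cauchy (\<lambda>n. L n x v)"
    proof (rule metric_CauchyI)
      fix e :: real assume e: "e > 0"
      then have "e / (norm v + 1) > 0" by (simp add: add_nonneg_pos)
      from uc[OF this] obtain N where
        N: "\<And>m n. m \<ge> N \<Longrightarrow> n \<ge> N \<Longrightarrow> cmod (L m x v - L n x v) \<le> e / (norm v + 1) * norm v"
        using x by meson
      have "e / (norm v + 1) * norm v < e"
      proof -
        have "norm v + 1 > 0" by (simp add: add_nonneg_pos)
        then show ?thesis using e by (simp add: pos_divide_less_eq algebra_simps)
      qed
      with N show "\<exists>N. \<forall>m\<ge>N. \<forall>n\<ge>N. dist (L m x v) (L n x v) < e"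
        unfolding dist_norm by (meson le_less_trans)
    qed
    then show ?thesis by (simp add: Cauchy_convergent_iff convergent_def)
  qed
  then obtain L' where L': "\<And>x v. x \<in> ?S \<Longrightarrow> (\<lambda>n. L n x v) \<longlonglongrightarrow> L' x v" by metis
  have "\<exists>g'. \<forall>x\<in>?S. (\<lambda>n. f n x) \<longlonglongrightarrow> g' x \<and> (g' has_derivative L' x) (at x within ?S)"
  proof (rule has_derivative_sequence)
    show "z \<in> ?S" using \<rho> by simp
    show "(\<lambda>n. f n z) \<longlonglongrightarrow> g z"
      using ul by (rule tendsto_uniform_limitI) (use \<rho> in auto)
    show "\<forall>\<^sub>F n in sequentially. \<forall>x\<in>?S. \<forall>h. norm (L n x h - L' x h) \<le> e * norm h" if "e > 0" for e
    proof -
      from uc[OF that] obtain N where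
        N: "\<And>m n x v. m \<ge> N \<Longrightarrow> n \<ge> N \<Longrightarrow> x \<in> ?S \<Longrightarrow> cmod (L m x v - L n x v) \<le> e * norm v"
        by meson
      have "norm (L n x h - L' x h) \<le> e * norm h" if "n \<ge> N" "x \<in> ?S" for n x h
      proof (rule LIMSEQ_le_const2)
        show "(\<lambda>m. norm (L n x h - L m x h)) \<longlonglongrightarrow> norm (L n x h - L' x h)"
          by (intro tendsto_intros L' that)
        show "\<exists>N. \<forall>m\<ge>N. norm (L n x h - L m x h) \<le> e * norm h"
          using N that by blast
      qed
      then show ?thesis unfolding eventually_sequentially by blast
    qed
  qed (use L(1) in \<open>auto intro: has_derivative_at_withinI\<close>)
  then obtain g' where g': "\<And>x. x \<in> ?S \<Longrightarrow> (\<lambda>n. f n x) \<longlonglongrightarrow> g' x"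
      "\<And>x. x \<in> ?S \<Longrightarrow> (g' has_derivative L' x) (at x within ?S)" by blast
  have zS: "z \<in> ?S" using \<rho> by simp
  have "g' x = g x" if "x \<in> ?S" for x
  proof (rule LIMSEQ_unique[OF g'(1)[OF that]])
    show "(\<lambda>n. f n x) \<longlonglongrightarrow> g x"
      using ul by (rule tendsto_uniform_limitI) (use that \<rho> in auto)
  qed
  moreover have "(g' has_derivative L' z) (at z)"
    using g'(2)[OF zS] zS at_within_open[OF zS open_ball] by simp
  ultimately have "(g has_derivative L' z) (at z)"
    using has_derivative_transform_within_open[OF _ open_ball zS] by blast
  moreover have "L' z (c *s v) = c * L' z v" for c v
    using tendsto_mult_left[OF L'[OF zS, of v], of c] L'[OF zS, of "c *s v"]
    by (simp add: L(2)[OF zS] LIMSEQ_unique)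
  ultimately show "\<exists>D. (g has_derivative D) (at z) \<and> (\<forall>c v. D (c *s v) = c * D v)" by blast
qed

text \<open>The point bound turns a Cauchy sequence in norm into a locally uniformly Cauchy one, so
  the limit exists pointwise and is holomorphic; Fatou's lemma then returns from pointwise to norm
  convergence.\<close>

lemma bergman_space_complete:
  fixes f :: "nat \<Rightarrow> complex ^ 'n \<Rightarrow> complex"
  assumes D: "open D" and f: "\<And>n. f n \<in> bergman_space D"
    and cau: "\<And>e. e > 0 \<Longrightarrow> \<exists>N. \<forall>m\<ge>N. \<forall>n\<ge>N. L2_sq (lebesgue_on D) (\<lambda>x. f m x - f n x) \<le> e"
  obtains g where "g \<in> bergman_space D" "\<And>x. x \<in> D \<Longrightarrow> (\<lambda>n. f n x) \<longlonglongrightarrow> g x"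
    "(\<lambda>n. L2_sq (lebesgue_on D) (\<lambda>x. f n x - g x)) \<longlonglongrightarrow> 0"
proof -
  let ?M = "lebesgue_on D"
  \<comment> \<open>The doubled radius leaves room for a ball of radius \<open>\<rho>\<close> about
    every point of \<open>cball z \<rho>\<close>.\<close>
  have uc: "\<exists>N. \<forall>m\<ge>N. \<forall>n\<ge>N. \<forall>x\<in>cball z \<rho>. dist (f m x) (f n x) < e"
    if \<rho>: "\<rho> > 0" "cball z (2 * \<rho>) \<subseteq> D" and e: "e > 0" for z \<rho> e
  proof -
    let ?V = "measure lebesgue (cball (0 :: complex ^ 'n) \<rho>)"
    have V: "?V > 0" using \<rho> by (simp add: content_cball_pos)
    have "?V * (e/2)\<^sup>2 > 0" using V e by simp
    from cau[OF this] obtain N where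
      N: "\<And>m n. m \<ge> N \<Longrightarrow> n \<ge> N \<Longrightarrow> L2_sq ?M (\<lambda>x. f m x - f n x) \<le> ?V * (e/2)\<^sup>2" by blast
    have "dist (f m x) (f n x) < e" if "m \<ge> N" "n \<ge> N" and x: "x \<in> cball z \<rho>" for m n x
    proof -
      have "cball x \<rho> \<subseteq> cball z (2 * \<rho>)"
      proof
        fix y assume "y \<in> cball x \<rho>"
        then show "y \<in> cball z (2 * \<rho>)" using x dist_triangle[of z y x] by simp
      qed
      then have "?V * (cmod (f m x - f n x))\<^sup>2 \<le> L2_sq ?M (\<lambda>x. f m x - f n x)"
        using \<rho> by (intro bergman_space_point_bound bergman_space_diff D f) auto
      also have "\<dots> \<le> ?V * (e/2)\<^sup>2" by (rule N[OF that(1,2)])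
      finally have "(cmod (f m x - f n x))\<^sup>2 \<le> (e/2)\<^sup>2" using V by simp
      then have "cmod (f m x - f n x) \<le> e/2" by (rule power2_le_imp_le) (use e in simp)
      then show ?thesis using e by (simp add: dist_norm)
    qed
    then show ?thesis by blast
  qed
  have ex\<rho>: "\<exists>\<rho>>0. cball z (2 * \<rho>) \<subseteq> D" if z: "z \<in> D" for z
  proof -
    obtain r where "r > 0" "cball z r \<subseteq> D" using D z by (meson open_contains_cball)
    then show ?thesis by (intro exI[of _ "r/2"]) auto
  qed
  have "\<exists>l. (\<lambda>n. f n z) \<longlonglongrightarrow> l" if z: "z \<in> D" for z
  proof -
    obtain \<rho> where \<rho>: "\<rho> > 0" "cball z (2 * \<rho>) \<subseteq> D" using ex\<rho>[OF z] by blast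
    have "z \<in> cball z \<rho>" using \<rho> by simp
    then have "Cauchy (\<lambda>n. f n z)" unfolding Cauchy_def using uc[OF \<rho>] by meson
    then show ?thesis by (simp add: Cauchy_convergent_iff convergent_def)
  qed
  then obtain g where g: "\<And>z. z \<in> D \<Longrightarrow> (\<lambda>n. f n z) \<longlonglongrightarrow> g z" by metis
  have holg: "holomorphic_fun_on g D"
  proof (rule holomorphic_uniform_limit)
    show "holomorphic_fun_on (f n) D" for n using f by (rule bergman_space_holomorphic)
    fix z assume "z \<in> D"
    then obtain \<rho> where \<rho>: "\<rho> > 0" "cball z (2 * \<rho>) \<subseteq> D" using ex\<rho> by blast
    have sub: "cball z \<rho> \<subseteq> D" using \<rho> by auto
    have "uniformly_Cauchy_on (cball z \<rho>) f"
      using uc[OF \<rho>] unfolding uniformly_Cauchy_on_def by meson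
    then have "uniformly_convergent_on (cball z \<rho>) f"
      by (rule Cauchy_uniformly_convergent)
    then obtain l where l: "uniform_limit (cball z \<rho>) f l sequentially"
      by (auto simp: uniformly_convergent_on_def)
    have "l x = g x" if "x \<in> cball z \<rho>" for x
      using tendsto_uniform_limitI[OF l that] g that sub LIMSEQ_unique by blast
    then have "uniform_limit (cball z \<rho>) f g sequentially"
      using l uniform_limit_cong'[of "cball z \<rho>" f f l g] by blast
    then show "\<exists>\<rho>>0. cball z \<rho> \<subseteq> D \<and> uniform_limit (cball z \<rho>) f g sequentially"
      using \<rho> sub by blast
  qed
  have mg: "g \<in> borel_measurable ?M"
    using D holomorphic_fun_on_imp_continuous_on[OF holg]
    by (intro continuous_imp_measurable_on_sets_lebesgue) auto
  have fL: "f n \<in> L2_on ?M" for n by (rule bergman_space_L2[OF D f])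
  have dL: "(\<lambda>x. f n x - f m x) \<in> L2_on ?M" for m n
    by (intro bergman_space_L2[OF D] bergman_space_diff D f)
  \<comment> \<open>Fatou's lemma is applied to the differences with \<open>n\<close> fixed and the
    other index tending to infinity.\<close>
  have tail: "(\<lambda>x. f n x - g x) \<in> L2_on ?M \<and> L2_sq ?M (\<lambda>x. f n x - g x) \<le> e"
    if N: "\<And>m n. m \<ge> N \<Longrightarrow> n \<ge> N \<Longrightarrow> L2_sq ?M (\<lambda>x. f m x - f n x) \<le> e" and n: "n \<ge> N" for N n e
  proof -
    have m: "(\<lambda>x. f n x - g x) \<in> borel_measurable ?M"
      using mg fL[of n] by (auto simp: L2_on_def)
    have l: "(\<lambda>m. f n x - f m x) \<longlonglongrightarrow> f n x - g x" if "x \<in> space ?M" for x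
      using that by (intro tendsto_intros g) simp
    show ?thesis
      using L2_Fatou[OF dL m l, where N=N and c=e] N n by blast
  qed
  obtain N1 where N1: "\<And>m n. m \<ge> N1 \<Longrightarrow> n \<ge> N1 \<Longrightarrow> L2_sq ?M (\<lambda>x. f m x - f n x) \<le> 1"
    using cau[of 1] by auto
  have "(\<lambda>x. f N1 x + (-1) * (f N1 x - g x)) \<in> L2_on ?M"
    using tail[OF N1 order_refl] by (intro L2_on_add L2_on_mult_left fL) auto
  then have "g \<in> L2_on ?M" by simp
  then have gA: "g \<in> bergman_space D" using holg D by (simp add: bergman_space_iff)
  have "(\<lambda>n. L2_sq ?M (\<lambda>x. f n x - g x)) \<longlonglongrightarrow> 0"
  proof (rule LIMSEQ_I)
    fix e :: real assume e: "e > 0"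
    then obtain N where N: "\<And>m n. m \<ge> N \<Longrightarrow> n \<ge> N \<Longrightarrow> L2_sq ?M (\<lambda>x. f m x - f n x) \<le> e / 2"
      using cau[of "e/2"] by auto
    have "norm (L2_sq ?M (\<lambda>x. f n x - g x) - 0) < e" if "n \<ge> N" for n
      using tail[OF N that] e by simp
    then show "\<exists>N. \<forall>n\<ge>N. norm (L2_sq ?M (\<lambda>x. f n x - g x) - 0) < e" by blast
  qed
  with gA g show ?thesis by (rule that)
qed

lemma quadratic_nonneg_imp_linear_zero:
  fixes a b :: real
  assumes "a \<ge> 0" and *: "\<And>t. t\<^sup>2 * a + 2 * t * b \<ge> 0"
  shows "b = 0"
proof (rule ccontr)
  assume b: "b \<noteq> 0"
  have a1: "a + 1 > 0" using assms(1) by simp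
  \<comment> \<open>The minimiser would be \<open>- b / a\<close>; enlarging the denominator by 1
    avoids division by zero and still gives a negative value.\<close>
  let ?t = "- b / (a + 1)"
  have "?t\<^sup>2 * a + 2 * ?t * b = - (b\<^sup>2 * (a + 2)) / (a + 1)\<^sup>2"
    using a1 by (simp add: divide_simps power2_eq_square) (simp add: algebra_simps)
  also have "\<dots> < 0" using b assms(1) a1 by (intro divide_neg_pos) (auto intro!: mult_pos_pos)
  finally show False using *[of ?t] by simp
qed

text \<open>Riesz representation: the minimiser of \<open>\<parallel>f\<parallel>\<^sup>2 - 2 Re (\<phi> f)\<close> represents \<open>\<phi>\<close>.\<close>

lemma bergman_space_Riesz:
  fixes D :: "(complex ^ 'n) set" and \<phi> :: "(complex ^ 'n \<Rightarrow> complex) \<Rightarrow> complex"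
  assumes D: "open D"
    and add: "\<And>f g. f \<in> bergman_space D \<Longrightarrow> g \<in> bergman_space D \<Longrightarrow> \<phi> (\<lambda>x. f x + g x) = \<phi> f + \<phi> g"
    and mult: "\<And>c f. f \<in> bergman_space D \<Longrightarrow> \<phi> (\<lambda>x. c * f x) = c * \<phi> f"
    and bd: "\<And>f. f \<in> bergman_space D \<Longrightarrow> (cmod (\<phi> f))\<^sup>2 \<le> C * L2_sq (lebesgue_on D) f"
  obtains g where "g \<in> bergman_space D" "\<And>f. f \<in> bergman_space D \<Longrightarrow> \<phi> f = L2_inner (lebesgue_on D) f g"
proof -
  let ?A = "bergman_space D" and ?M = "lebesgue_on D"
  define J where "J f = L2_sq ?M f - 2 * Re (\<phi> f)" for f
  note AL = bergman_space_L2[OF D]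
  have zero: "(\<lambda>_. 0) \<in> ?A"
    using D by (simp add: bergman_space_iff holomorphic_fun_on_const L2_on_def)
  \<comment> \<open>By the arithmetic-geometric mean inequality \<open>2 * cmod (\<phi> f)\<close>
    is at most \<open>\<bar>C\<bar> + L2_sq ?M f\<close>. The absolute value appears because
    \<open>C\<close> has no prescribed sign.\<close>
  have lower: "- \<bar>C\<bar> \<le> J f" if f: "f \<in> ?A" for f
  proof -
    have "(cmod (\<phi> f))\<^sup>2 \<le> \<bar>C\<bar> * L2_sq ?M f"
      using bd[OF f] by (rule order_trans) (simp add: mult_right_mono)
    then have "cmod (\<phi> f) \<le> sqrt (\<bar>C\<bar> * L2_sq ?M f)" by (simp add: real_le_rsqrt)
    also have "\<dots> \<le> (\<bar>C\<bar> + L2_sq ?M f) / 2" by (intro arith_geo_mean_sqrt) auto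
    finally show ?thesis using complex_Re_le_cmod[of "\<phi> f"] by (simp add: J_def)
  qed
  define d where "d = Inf (J ` ?A)"
  have bb: "bdd_below (J ` ?A)" using lower by (auto intro!: bdd_belowI)
  have dle: "d \<le> J f" if "f \<in> ?A" for f
    unfolding d_def using that bb by (intro cInf_lower) auto
  have "\<exists>f\<in>?A. J f < d + 1 / real (Suc n)" for n
  proof -
    have "Inf (J ` ?A) < d + 1 / real (Suc n)" unfolding d_def by simp
    then show ?thesis using zero by (subst (asm) cInf_less_iff) (use bb in auto)
  qed
  then obtain F where F: "\<And>n. F n \<in> ?A" "\<And>n. J (F n) < d + 1 / real (Suc n)" by metis
  \<comment> \<open>In the parallelogram law with midpoint \<open>?h\<close> the linear terms of
    \<open>J\<close> cancel, so the squared distance of two near-minimisers is bounded by how far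
    \<open>J\<close> exceeds its infimum at each of them.\<close>
  have dist: "L2_sq ?M (\<lambda>x. F m x - F n x) \<le> 2 / real (Suc m) + 2 / real (Suc n)" for m n
  proof -
    let ?h = "\<lambda>x. (1/2) * (F m x + F n x)"
    have h: "?h \<in> ?A" by (intro bergman_space_mult bergman_space_add D F)
    have "\<phi> ?h = (1/2) * (\<phi> (F m) + \<phi> (F n))"
      using mult[OF bergman_space_add[OF D F(1) F(1)], of "1/2" m n] add[OF F(1) F(1), of m n] by simp
    then have "2 * Re (\<phi> ?h) = 2 * Re ((1/2) * (\<phi> (F m) + \<phi> (F n)))" by (simp only:)
    then have "2 * Re (\<phi> ?h) = Re (\<phi> (F m)) + Re (\<phi> (F n))"
      by (simp only: Re_divide_numeral mult_1 times_divide_eq_left plus_complex.sel) simp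
    then have "L2_sq ?M (\<lambda>x. F m x - F n x) = 2 * J (F m) + 2 * J (F n) - 4 * J ?h"
      using L2_parallelogram[OF AL[OF F(1)] AL[OF F(1)], of m n] unfolding J_def right_diff_distrib by linarith
    also have "\<dots> \<le> 2 / real (Suc m) + 2 / real (Suc n)"
      using dle[OF h] F(2)[of m] F(2)[of n] by simp
    finally show ?thesis .
  qed
  have cau: "\<exists>N. \<forall>m\<ge>N. \<forall>n\<ge>N. L2_sq ?M (\<lambda>x. F m x - F n x) \<le> e" if e: "e > 0" for e
  proof -
    obtain N where N: "1 / real (Suc N) < e / 4"
      using reals_Archimedean[of "e/4"] e by (auto simp: inverse_eq_divide)
    have "L2_sq ?M (\<lambda>x. F m x - F n x) \<le> e" if "m \<ge> N" "n \<ge> N" for m n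
    proof -
      have "1 / real (Suc m) \<le> 1 / real (Suc N)" "1 / real (Suc n) \<le> 1 / real (Suc N)"
        using that by (auto simp: frac_le)
      then show ?thesis using dist[of m n] N by simp
    qed
    then show ?thesis by blast
  qed
  obtain g where g: "g \<in> ?A" "\<And>x. x \<in> D \<Longrightarrow> (\<lambda>n. F n x) \<longlonglongrightarrow> g x"
      "(\<lambda>n. L2_sq ?M (\<lambda>x. F n x - g x)) \<longlonglongrightarrow> 0"
    using bergman_space_complete[OF D F(1) cau] by blast
  have diff: "\<phi> (\<lambda>x. f x - h x) = \<phi> f - \<phi> h" if "f \<in> ?A" "h \<in> ?A" for f h
    using add[OF that(1) bergman_space_mult[OF D that(2), of "-1"]] mult[OF that(2), of "-1"] by simp
  have "(\<lambda>n. (cmod (\<phi> (F n) - \<phi> g))\<^sup>2) \<longlonglongrightarrow> 0"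
  proof (rule tendsto_sandwich[of "\<lambda>_. 0" _ _ "\<lambda>n. C * L2_sq ?M (\<lambda>x. F n x - g x)"])
    show "\<forall>\<^sub>F n in sequentially. (cmod (\<phi> (F n) - \<phi> g))\<^sup>2 \<le> C * L2_sq ?M (\<lambda>x. F n x - g x)"
      using bd[OF bergman_space_diff[OF D F(1) g(1)]] diff[OF F(1) g(1)] by simp
    show "(\<lambda>n. C * L2_sq ?M (\<lambda>x. F n x - g x)) \<longlonglongrightarrow> 0"
      using tendsto_mult_left[OF g(3), of C] by simp
  qed auto
  then have "(\<lambda>n. sqrt ((cmod (\<phi> (F n) - \<phi> g))\<^sup>2)) \<longlonglongrightarrow> sqrt 0" by (rule tendsto_real_sqrt)
  then have "(\<lambda>n. \<phi> (F n) - \<phi> g) \<longlonglongrightarrow> 0" by (simp add: tendsto_norm_zero_iff)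
  then have "(\<lambda>n. \<phi> (F n)) \<longlonglongrightarrow> \<phi> g" by (rule LIM_zero_cancel)
  then have lim: "(\<lambda>n. Re (\<phi> (F n))) \<longlonglongrightarrow> Re (\<phi> g)" by (rule tendsto_Re)
  \<comment> \<open>Fatou's lemma, as lower semicontinuity of the norm, and continuity of
    \<open>\<phi>\<close> along the sequence show that the limit attains the infimum.\<close>
  have Jg: "J g \<le> d"
  proof (rule field_le_epsilon)
    fix e :: real assume e: "e > 0"
    have "(\<lambda>n. d + 1 / real (Suc n) + 2 * Re (\<phi> (F n))) \<longlonglongrightarrow> d + 0 + 2 * Re (\<phi> g)"
      by (intro tendsto_intros lim LIMSEQ_Suc[OF lim_1_over_n])
    then have "\<forall>\<^sub>F n in sequentially. d + 1 / real (Suc n) + 2 * Re (\<phi> (F n)) < d + 2 * Re (\<phi> g) + e"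
      using e by (intro order_tendstoD) auto
    then obtain N where N: "\<And>n. n \<ge> N \<Longrightarrow> d + 1 / real (Suc n) + 2 * Re (\<phi> (F n)) < d + 2 * Re (\<phi> g) + e"
      by (auto simp: eventually_sequentially)
    have "L2_sq ?M g \<le> d + 2 * Re (\<phi> g) + e"
    proof (rule L2_Fatou(2)[where f=F and N=N])
      show "L2_sq ?M (F n) \<le> d + 2 * Re (\<phi> g) + e" if "n \<ge> N" for n
        using N[OF that] F(2)[of n] by (simp add: J_def)
    qed (use AL[OF F(1)] AL[OF g(1)] g(2) in \<open>auto simp: L2_on_def\<close>)
    then show "J g \<le> d + e" by (simp add: J_def)
  qed
  have Re_eq: "Re (L2_inner ?M g h) = Re (\<phi> h)" if h: "h \<in> ?A" for h
  proof -
    have "t\<^sup>2 * L2_sq ?M h + 2 * t * (Re (L2_inner ?M g h) - Re (\<phi> h)) \<ge> 0" for t :: real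
    proof -
      have th: "(\<lambda>x. of_real t * h x) \<in> ?A" by (rule bergman_space_mult[OF D h])
      have "J g \<le> J (\<lambda>x. g x + of_real t * h x)"
        using Jg dle[OF bergman_space_add[OF D g(1) th]] by linarith
      moreover have "\<phi> (\<lambda>x. g x + of_real t * h x) = \<phi> g + of_real t * \<phi> h"
        using add[OF g(1) th] mult[OF h] by simp
      moreover have "L2_sq ?M (\<lambda>x. g x + of_real t * h x)
          = L2_sq ?M g + t\<^sup>2 * L2_sq ?M h + 2 * (t * Re (L2_inner ?M g h))"
        using L2_sq_add_scaled[OF AL[OF g(1)] AL[OF h], of "of_real t"] by simp
      ultimately show ?thesis by (simp add: J_def algebra_simps)
    qed
    then have "Re (L2_inner ?M g h) - Re (\<phi> h) = 0"
      by (rule quadratic_nonneg_imp_linear_zero[OF L2_sq_nonneg])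
    then show ?thesis by simp
  qed
  \<comment> \<open>Real variations match real parts only; replacing \<open>h\<close> by
    \<open>\<i> * h\<close> supplies the imaginary parts.\<close>
  have "\<phi> h = L2_inner ?M h g" if h: "h \<in> ?A" for h
  proof -
    have ih: "(\<lambda>x. \<i> * h x) \<in> ?A" by (rule bergman_space_mult[OF D h])
    have "L2_inner ?M g (\<lambda>x. \<i> * h x) = cnj (\<i> * L2_inner ?M h g)"
      by (subst L2_inner_commute) (simp add: L2_inner_mult_left)
    then have "Re (cnj (\<i> * L2_inner ?M h g)) = Re (\<i> * \<phi> h)"
      using Re_eq[OF ih] mult[OF h, of \<i>] by simp
    moreover have "Re (cnj (L2_inner ?M h g)) = Re (\<phi> h)"
      using Re_eq[OF h] L2_inner_commute[of ?M g h] by simp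
    ultimately show ?thesis by (simp add: complex_eq_iff)
  qed
  with g(1) show ?thesis by (rule that)
qed

section \<open>Existence and extremal property of the Bergman kernel\<close>

lemma bergman_space_cong:
  assumes "open D" "f \<in> bergman_space D" "\<And>x. x \<in> D \<Longrightarrow> f x = g x"
  shows "g \<in> bergman_space D"
proof -
  have "holomorphic_fun_on g D"
    using holomorphic_fun_on_cong[OF bergman_space_holomorphic[OF assms(2)] assms(1,3)] by simp
  moreover have "integrable (lebesgue_on D) (\<lambda>w. (cmod (f w))\<^sup>2) \<longleftrightarrow> integrable (lebesgue_on D) (\<lambda>w. (cmod (g w))\<^sup>2)"
    using assms(3) by (intro Bochner_Integration.integrable_cong) auto
  ultimately show ?thesis using assms(2) by (simp add: bergman_space_def)
qed

lemma bergman_space_eq_0: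
  fixes D :: "(complex ^ 'n) set"
  assumes D: "open D" and f: "f \<in> bergman_space D" "L2_sq (lebesgue_on D) f = 0" and z: "z \<in> D"
  shows "f z = 0"
proof -
  obtain r where r: "r > 0" "cball z r \<subseteq> D" using D z by (meson open_contains_cball)
  from bergman_space_point_bound[OF D f(1) r] f(2)
  have "measure lebesgue (cball (0 :: complex ^ 'n) r) * (cmod (f z))\<^sup>2 \<le> 0" by simp
  moreover have "measure lebesgue (cball (0 :: complex ^ 'n) r) > 0"
    using r by (simp add: content_cball_pos)
  ultimately have "(cmod (f z))\<^sup>2 \<le> 0" by (metis mult_le_cancel_left_pos mult_zero_right)
  then show ?thesis by simp
qed

text \<open>Existence is the Riesz representation of point evaluation, bounded by the mean value
  property. For uniqueness, the difference \<open>?h\<close> of two kernel functions at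
  \<open>z\<close> has squared norm \<open>?h z - ?h z\<close>, and the normalisation off
  \<open>D \<times> D\<close> determines the rest.\<close>

lemma bergman_kernel_exists_unique:
  fixes D :: "(complex ^ 'n) set"
  assumes D: "open D"
  shows "\<exists>!K. (\<forall>z\<in>D. (\<lambda>w. cnj (K z w)) \<in> bergman_space D \<and>
        (\<forall>f\<in>bergman_space D. f z = (\<integral>w. K z w * f w \<partial>lebesgue_on D))) \<and>
     (\<forall>z w. z \<notin> D \<or> w \<notin> D \<longrightarrow> K z w = 0)" (is "\<exists>!K. ?P K")
proof (rule ex_ex1I)
  have "\<exists>g. g \<in> bergman_space D \<and> (\<forall>f\<in>bergman_space D. f z = L2_inner (lebesgue_on D) f g)" if z: "z \<in> D" for z
  proof -
    obtain r where r: "r > 0" "cball z r \<subseteq> D" using D z by (meson open_contains_cball)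
    let ?V = "measure lebesgue (cball (0 :: complex ^ 'n) r)"
    have V: "?V > 0" using r by (simp add: content_cball_pos)
    have bd: "(cmod (f z))\<^sup>2 \<le> (1 / ?V) * L2_sq (lebesgue_on D) f" if "f \<in> bergman_space D" for f
      using bergman_space_point_bound[OF D that r] V by (simp add: field_simps)
    show ?thesis
      by (rule bergman_space_Riesz[of D "\<lambda>f. f z" "1 / ?V", OF D _ _ bd]) (simp, simp, assumption, blast)
  qed
  then obtain g where g: "\<And>z. z \<in> D \<Longrightarrow> g z \<in> bergman_space D"
      "\<And>z f. z \<in> D \<Longrightarrow> f \<in> bergman_space D \<Longrightarrow> f z = L2_inner (lebesgue_on D) f (g z)" by metis
  define K where "K z w = (if z \<in> D \<and> w \<in> D then cnj (g z w) else 0)" for z w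
  have "(\<lambda>w. cnj (K z w)) \<in> bergman_space D" if "z \<in> D" for z
    using that by (intro bergman_space_cong[OF D g(1)[OF that]]) (simp add: K_def)
  moreover have "f z = (\<integral>w. K z w * f w \<partial>lebesgue_on D)" if "z \<in> D" "f \<in> bergman_space D" for z f
    unfolding g(2)[OF that] L2_inner_def using that
    by (intro Bochner_Integration.integral_cong) (auto simp: K_def)
  ultimately show "\<exists>K. ?P K" by (intro exI[of _ K]) (auto simp: K_def)
next
  fix K K' assume K: "?P K" and K': "?P K'"
  have "K z w = K' z w" if z: "z \<in> D" and w: "w \<in> D" for z w
  proof -
    let ?h = "\<lambda>w. cnj (K z w) - cnj (K' z w)"
    have h: "?h \<in> bergman_space D"
      using K K' z by (intro bergman_space_diff D) auto
    have KL: "K z \<in> L2_on (lebesgue_on D)" "K' z \<in> L2_on (lebesgue_on D)"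
      using L2_on_cnj[OF bergman_space_L2[OF D, of "\<lambda>w. cnj (K z w)"]]
        L2_on_cnj[OF bergman_space_L2[OF D, of "\<lambda>w. cnj (K' z w)"]] K K' z by auto
    note i = integrable_L2_mult[OF KL(1) bergman_space_L2[OF D h]] integrable_L2_mult[OF KL(2) bergman_space_L2[OF D h]]
    have "of_real (L2_sq (lebesgue_on D) ?h) = (\<integral>w. ?h w * cnj (?h w) \<partial>lebesgue_on D)"
      by (simp add: L2_inner_self[symmetric] L2_inner_def)
    also have "\<dots> = (\<integral>w. K z w * ?h w - K' z w * ?h w \<partial>lebesgue_on D)"
      by (intro Bochner_Integration.integral_cong) (auto simp: algebra_simps)
    also have "\<dots> = ?h z - ?h z"
      using K K' z h i by (simp add: Bochner_Integration.integral_diff)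
    finally have "L2_sq (lebesgue_on D) ?h = 0" by simp
    from bergman_space_eq_0[OF D h this w] show ?thesis by simp
  qed
  then show "K = K'" using K K' by (intro ext) metis
qed

context
  fixes D :: "(complex ^ 'n) set"
  assumes D: "open D"
begin

lemma bergman_kernel_props:
  "z \<in> D \<Longrightarrow> (\<lambda>w. cnj (bergman_kernel D z w)) \<in> bergman_space D"
  "z \<in> D \<Longrightarrow> f \<in> bergman_space D \<Longrightarrow> f z = (\<integral>w. bergman_kernel D z w * f w \<partial>lebesgue_on D)"
  using theI'[OF bergman_kernel_exists_unique[OF D]] unfolding bergman_kernel_def[symmetric] by auto

lemma bergman_kernel_reproducing:
  assumes "z \<in> D" "f \<in> bergman_space D"
  shows "f z = L2_inner (lebesgue_on D) f (\<lambda>w. cnj (bergman_kernel D z w))"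
  using bergman_kernel_props(2)[OF assms] by (simp add: L2_inner_def mult.commute)

lemma bergman_kernel_diag:
  assumes "z \<in> D"
  shows "bergman_kernel D z z = of_real (bergman_diag D z)"
    and "bergman_diag D z = L2_sq (lebesgue_on D) (\<lambda>w. cnj (bergman_kernel D z w))"
proof -
  have "cnj (bergman_kernel D z z) = of_real (L2_sq (lebesgue_on D) (\<lambda>w. cnj (bergman_kernel D z w)))"
    using bergman_kernel_reproducing[OF assms bergman_kernel_props(1)[OF assms]] by (simp add: L2_inner_self)
  then have *: "bergman_kernel D z z = of_real (L2_sq (lebesgue_on D) (\<lambda>w. cnj (bergman_kernel D z w)))"
    by (metis complex_cnj_cnj complex_cnj_complex_of_real)
  then show "bergman_diag D z = L2_sq (lebesgue_on D) (\<lambda>w. cnj (bergman_kernel D z w))"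
    by (simp add: bergman_diag_def)
  with * show "bergman_kernel D z z = of_real (bergman_diag D z)" by simp
qed

lemma bergman_diag_nonneg: "z \<in> D \<Longrightarrow> 0 \<le> bergman_diag D z"
  by (simp add: bergman_kernel_diag(2))

text \<open>One half of the extremal description of the diagonal as the largest |f z|^2 over the
  unit ball of the Bergman space. Inserting a test function for \<open>f\<close> gives lower bounds
  for the diagonal.\<close>

lemma bergman_point_le:
  assumes "z \<in> D" "f \<in> bergman_space D"
  shows "(cmod (f z))\<^sup>2 \<le> L2_sq (lebesgue_on D) f * bergman_diag D z"
  unfolding bergman_kernel_diag(2)[OF assms(1)] bergman_kernel_reproducing[OF assms]
  by (intro L2_Cauchy_Schwarz bergman_space_L2[OF D] bergman_kernel_props assms)

lemma bergman_kernel_le: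
  assumes "z \<in> D" "w \<in> D"
  shows "(cmod (bergman_kernel D z w))\<^sup>2 \<le> bergman_diag D z * bergman_diag D w"
  using bergman_point_le[OF assms(2) bergman_kernel_props(1)[OF assms(1)]]
  by (simp add: bergman_kernel_diag(2)[OF assms(1)])

text \<open>\<open>G\<close> is the orthogonal projection of \<open>u\<close>, found as the
  representative of the functional that takes the inner product with \<open>u\<close>. Holomorphy of
  the integral thus comes without differentiating under the integral sign.\<close>

lemma bergman_projection:
  assumes u: "u \<in> L2_on (lebesgue_on D)"
  obtains G where "G \<in> bergman_space D"
    "\<And>y. y \<in> D \<Longrightarrow> (\<integral>w. bergman_kernel D y w * u w \<partial>lebesgue_on D) = G y"
proof -
  let ?M = "lebesgue_on D"
  obtain G where G: "G \<in> bergman_space D" "\<And>f. f \<in> bergman_space D \<Longrightarrow> L2_inner ?M f u = L2_inner ?M f G"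
  proof (rule bergman_space_Riesz[of D "\<lambda>f. L2_inner ?M f u" "L2_sq ?M u", OF D])
    show "(cmod (L2_inner ?M f u))\<^sup>2 \<le> L2_sq ?M u * L2_sq ?M f" if "f \<in> bergman_space D" for f
      using L2_Cauchy_Schwarz[OF bergman_space_L2[OF D that] u] by (simp add: mult.commute)
  qed (use u in \<open>auto intro: L2_inner_add_left bergman_space_L2[OF D] simp: L2_inner_mult_left\<close>)
  have "(\<integral>w. bergman_kernel D y w * u w \<partial>?M) = G y" if y: "y \<in> D" for y
  proof -
    let ?k = "\<lambda>w. cnj (bergman_kernel D y w)"
    have "(\<integral>w. bergman_kernel D y w * u w \<partial>?M) = L2_inner ?M u ?k"
      by (simp add: L2_inner_def mult.commute)
    also have "\<dots> = cnj (L2_inner ?M ?k u)" by (rule L2_inner_commute)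
    also have "L2_inner ?M ?k u = L2_inner ?M ?k G" by (rule G(2)[OF bergman_kernel_props(1)[OF y]])
    also have "cnj (L2_inner ?M ?k G) = L2_inner ?M G ?k" by (rule L2_inner_commute[symmetric])
    also have "\<dots> = G y" by (rule bergman_kernel_reproducing[OF y G(1), symmetric])
    finally show ?thesis .
  qed
  with G(1) show ?thesis by (rule that)
qed

lemma const_in_bergman_space:
  assumes "bounded D"
  shows "(\<lambda>_. c) \<in> bergman_space D"
proof -
  have "D \<in> lmeasurable" using D assms by (simp add: lmeasurable_open)
  then have "finite_measure (lebesgue_on D)"
    by (rule finite_measure_lebesgue_on)
  then have "integrable (lebesgue_on D) (\<lambda>_. (cmod c)\<^sup>2)"
    by (rule finite_measure.integrable_const)
  then show ?thesis by (simp add: bergman_space_def holomorphic_fun_on_const)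
qed

text \<open>The constant 1 is the test function. The diagonal is thereby kept away from zero, so
  that its powers with exponent \<open>- \<alpha>\<close> stay bounded.\<close>

lemma bergman_diag_lower:
  assumes "bounded D" "z \<in> D"
  shows "1 \<le> measure lebesgue D * bergman_diag D z"
proof -
  have "L2_sq (lebesgue_on D) (\<lambda>_. 1) = measure lebesgue D"
    using D by (simp add: L2_sq_def measure_restrict_space)
  then show ?thesis
    using bergman_point_le[OF assms(2) const_in_bergman_space[OF assms(1), of 1]] by simp
qed

lemma bergman_diag_pos:
  assumes "bounded D" "z \<in> D"
  shows "0 < bergman_diag D z"
proof -
  have "bergman_diag D z \<noteq> 0" using bergman_diag_lower[OF assms] by auto
  then show ?thesis using bergman_diag_nonneg[OF assms(2)] by simp
qed

end

section \<open>Growth of the kernel at the boundary\<close>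

lemma norm_axis: "norm (axis j c :: complex ^ 'n) = cmod c"
  by (simp add: norm_vec_def L2_set_def axis_def if_distrib[of norm] if_distrib[of "\<lambda>x. x\<^sup>2"] cong: if_cong)

lemma holomorphic_fun_on_coordinate:
  fixes g :: "complex \<Rightarrow> complex" and S :: "(complex ^ 'n) set"
  assumes "\<And>w. w \<in> S \<Longrightarrow> (g has_field_derivative g' w) (at (w $ i))"
  shows "holomorphic_fun_on (\<lambda>w. g (w $ i)) S"
  unfolding holomorphic_fun_on_def
proof
  fix w assume "w \<in> S"
  have "((\<lambda>w. w $ i) has_derivative (\<lambda>h. h $ i)) (at w)"
    by (rule bounded_linear.has_derivative[OF bounded_linear_vec_nth has_derivative_ident])
  moreover have "(g has_derivative (*) (g' w)) (at (w $ i))"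
    using assms[OF \<open>w \<in> S\<close>] by (simp add: has_field_derivative_def)
  ultimately have "((\<lambda>w. g (w $ i)) has_derivative (\<lambda>h. g' w * h $ i)) (at w)"
    by (rule has_derivative_compose)
  then show "\<exists>D. ((\<lambda>w. g (w $ i)) has_derivative D) (at w) \<and> (\<forall>c v. D (c *s v) = c * D v)"
    by (intro exI[of _ "\<lambda>h. g' w * h $ i"]) auto
qed

text \<open>At a boundary point \<open>p\<close> maximising \<open>Re (w $ i)\<close> the functions \<open>e / (p $ i + e - w $ i)\<close> are
  bounded by \<open>1\<close> and tend to \<open>0\<close> in the Bergman space as \<open>e \<rightarrow> 0\<close>, but take the value \<open>1\<close> at \<open>p\<close>.\<close>

lemma bergman_diag_unbounded:
  fixes \<Omega> :: "(complex ^ 'n) set"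
  assumes dom: "bounded_domain \<Omega>" and \<epsilon>: "\<epsilon> > 0"
  shows "\<exists>z\<in>\<Omega>. infdist z (frontier \<Omega>) < \<epsilon> \<and> N \<le> bergman_diag \<Omega> z"
proof -
  have op: "open \<Omega>" and ne: "\<Omega> \<noteq> {}" and bdd: "bounded \<Omega>"
    using dom by (auto simp: bounded_domain_def)
  define i :: 'n where "i = undefined"
  have "compact (closure \<Omega>)" using bdd by (simp add: compact_closure)
  moreover have "continuous_on (closure \<Omega>) (\<lambda>w. Re (w $ i))"
    by (intro continuous_intros continuous_on_component)
  ultimately obtain p where p: "p \<in> closure \<Omega>" "\<And>w. w \<in> closure \<Omega> \<Longrightarrow> Re (w $ i) \<le> Re (p $ i)"
    using continuous_attains_sup[of "closure \<Omega>" "\<lambda>w. Re (w $ i)"] ne by auto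
  \<comment> \<open>By openness a point of \<open>\<Omega>\<close> can be moved a little in the
    positive real direction of coordinate \<open>i\<close>, so it cannot be a maximiser.\<close>
  have strict: "Re (w $ i) < Re (p $ i)" if w: "w \<in> \<Omega>" for w
  proof -
    obtain d where d: "d > 0" "ball w d \<subseteq> \<Omega>" using op w by (meson open_contains_ball)
    have "w + axis i (of_real (d/2)) \<in> ball w d"
      using d by (simp add: dist_norm norm_axis)
    then have "w + axis i (of_real (d/2)) \<in> closure \<Omega>" using d closure_subset by blast
    from p(2)[OF this] d show ?thesis by (simp add: axis_def)
  qed
  have pf: "p \<in> frontier \<Omega>"
    using p strict[of p] op by (auto simp: frontier_def interior_open)
  define f where "f e w = of_real e / (p $ i + of_real e - w $ i)" for e :: real and w :: "complex ^ 'n"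
  have Re_pos: "Re (p $ i + of_real e - w $ i) > e" if "w \<in> \<Omega>" for e w
    using strict[OF that] by simp
  have nz: "p $ i + of_real e - w $ i \<noteq> 0" if "w \<in> \<Omega>" "e > 0" for e w
    using Re_pos[OF that(1), of e] that(2) by (metis less_asym zero_complex.sel(1))
  have lower: "e \<le> cmod (p $ i + of_real e - w $ i)" if "w \<in> \<Omega>" for e w
    using Re_pos[OF that, of e] complex_Re_le_cmod[of "p $ i + of_real e - w $ i"] by linarith
  have f1: "cmod (f e w) \<le> 1" if "w \<in> \<Omega>" "e > 0" for e w
    using lower[OF that(1), of e] nz[OF that] that(2) by (simp add: f_def norm_divide)
  have hol: "holomorphic_fun_on (f e) \<Omega>" if "e > 0" for e
    unfolding f_def
  proof (rule holomorphic_fun_on_coordinate)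
    fix w assume "w \<in> \<Omega>"
    from nz[OF this that]
    show "((\<lambda>t. of_real e / (p $ i + of_real e - t)) has_field_derivative
        of_real e / (p $ i + of_real e - w $ i)\<^sup>2) (at (w $ i))"
      by (auto intro!: derivative_eq_intros simp: power2_eq_square)
  qed
  have meas: "f e \<in> borel_measurable (lebesgue_on \<Omega>)" if "e > 0" for e
    using holomorphic_fun_on_imp_continuous_on[OF hol[OF that]] op
    by (intro continuous_imp_measurable_on_sets_lebesgue) auto
  have "\<Omega> \<in> lmeasurable" using op bdd by (simp add: lmeasurable_open)
  then interpret finite_measure "lebesgue_on \<Omega>" by (rule finite_measure_lebesgue_on)
  have A2: "f e \<in> bergman_space \<Omega>" if e: "e > 0" for e
  proof -
    have "integrable (lebesgue_on \<Omega>) (\<lambda>w. (cmod (f e w))\<^sup>2)"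
      using meas[OF e] f1[OF _ e] by (intro integrable_const_bound[where B=1]) (auto simp: power_le_one)
    then show ?thesis using hol[OF e] by (simp add: bergman_space_def)
  qed
  define e where "e n = 1 / real (Suc n)" for n
  have e: "e n > 0" for n by (simp add: e_def)
  have e0: "e \<longlonglongrightarrow> 0" unfolding e_def by (rule LIMSEQ_Suc[OF lim_1_over_n])
  have "(\<lambda>n. L2_sq (lebesgue_on \<Omega>) (f (e n))) \<longlonglongrightarrow> (\<integral>w. 0 \<partial>lebesgue_on \<Omega>)"
    unfolding L2_sq_def
  proof (rule integral_dominated_convergence[where w = "\<lambda>_. 1"])
    show "AE w in lebesgue_on \<Omega>. (\<lambda>n. (cmod (f (e n) w))\<^sup>2) \<longlonglongrightarrow> 0"
    proof (rule AE_I2)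
      fix w assume "w \<in> space (lebesgue_on \<Omega>)"
      then have w: "w \<in> \<Omega>" by simp
      have "p $ i - w $ i \<noteq> 0" using strict[OF w] by auto
      then have "(\<lambda>n. f (e n) w) \<longlonglongrightarrow> of_real 0 / (p $ i + of_real 0 - w $ i)"
        unfolding f_def by (intro tendsto_intros e0) auto
      then have "(\<lambda>n. (cmod (f (e n) w))\<^sup>2) \<longlonglongrightarrow> (cmod 0)\<^sup>2"
        by (intro tendsto_intros) auto
      then show "(\<lambda>n. (cmod (f (e n) w))\<^sup>2) \<longlonglongrightarrow> 0" by simp
    qed
    show "AE w in lebesgue_on \<Omega>. norm ((cmod (f (e n) w))\<^sup>2) \<le> 1" for n
      using f1[OF _ e] by (intro AE_I2) (simp add: power_le_one)
    show "(\<lambda>w. (cmod (f (e n) w))\<^sup>2) \<in> borel_measurable (lebesgue_on \<Omega>)" for n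
      using meas[OF e[of n]] by measurable
  qed auto
  then have "(\<lambda>n. L2_sq (lebesgue_on \<Omega>) (f (e n))) \<longlonglongrightarrow> 0" by simp
  \<comment> \<open>The 4 compensates the value of the test function: for \<open>z\<close> within
    \<open>e n\<close> of \<open>p\<close> the denominator has modulus at most
    \<open>2 * e n\<close>, so the quotient has modulus at least 1/2 and its square is at least
    1/4.\<close>
  moreover have N1: "1 / (4 * (\<bar>N\<bar> + 1)) > 0" by (simp add: add_nonneg_pos)
  ultimately have "\<forall>\<^sub>F n in sequentially. L2_sq (lebesgue_on \<Omega>) (f (e n)) < 1 / (4 * (\<bar>N\<bar> + 1))"
    by (rule order_tendstoD(2))
  then obtain n where n: "L2_sq (lebesgue_on \<Omega>) (f (e n)) < 1 / (4 * (\<bar>N\<bar> + 1))"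
    by (auto simp: eventually_sequentially)
  have "min \<epsilon> (e n) > 0" using \<epsilon> e by simp
  then obtain z where z: "z \<in> \<Omega>" "dist z p < min \<epsilon> (e n)"
    using p(1) by (meson closure_approachable)
  have "cmod (p $ i + of_real (e n) - z $ i) \<le> cmod (p $ i - z $ i) + cmod (of_real (e n))"
    by (metis add_diff_eq add.commute norm_triangle_ineq add_diff_cancel_left' diff_add_eq)
  also have "\<dots> \<le> 2 * e n"
  proof -
    have "cmod (z $ i - p $ i) \<le> norm (z - p)" using Finite_Cartesian_Product.norm_nth_le[of "z - p" i] by simp
    then show ?thesis using z(2) e[of n] by (simp add: dist_norm norm_minus_commute)
  qed
  finally have "cmod (p $ i + of_real (e n) - z $ i) \<le> 2 * e n" .
  moreover have "0 < cmod (p $ i + of_real (e n) - z $ i)"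
    using lower[OF z(1), of "e n"] e[of n] by linarith
  ultimately have "1 / 2 \<le> cmod (f (e n) z)"
    using e[of n] by (simp add: f_def norm_divide pos_le_divide_eq del: zero_less_norm_iff)
  then have "(1 / 2)\<^sup>2 \<le> (cmod (f (e n) z))\<^sup>2" by (intro power_mono) auto
  also have "\<dots> \<le> L2_sq (lebesgue_on \<Omega>) (f (e n)) * bergman_diag \<Omega> z"
    by (rule bergman_point_le[OF op z(1) A2[OF e]])
  also have "\<dots> \<le> 1 / (4 * (\<bar>N\<bar> + 1)) * bergman_diag \<Omega> z"
    using n bergman_diag_nonneg[OF op z(1)] by (intro mult_right_mono) auto
  finally have "\<bar>N\<bar> + 1 \<le> bergman_diag \<Omega> z"
    by (simp add: field_simps power2_eq_square add_nonneg_pos)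
  moreover have "infdist z (frontier \<Omega>) < \<epsilon>"
    using infdist_le[OF pf, of z] z(2) by simp
  ultimately show ?thesis using z(1) by (intro bexI[of _ z]) auto
qed

section \<open>Polydiscs\<close>

text \<open>With \<open>b j z \<le> 0\<close> the polydisc would contain a real line in direction
  \<open>j\<close>, which a bounded set cannot. Positivity turns the polydisc into a product of
  discs of finite radii \<open>r / b j z\<close>.\<close>

lemma B_polydisc_bounded_imp_pos:
  fixes z :: "complex ^ 'n"
  assumes "B_polydisc r z b \<subseteq> S" "bounded S" "r > 0"
  shows "b j z > 0"
proof (rule ccontr)
  assume nb: "\<not> b j z > 0"
  have "z + axis j (of_real t) \<in> B_polydisc r z b" for t :: real
    unfolding B_polydisc_def
  proof (clarify)
    fix k
    show "cmod ((z + axis j (of_real t)) $ k - z $ k) * b k z \<le> r"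
    proof (cases "k = j")
      case True
      have "\<bar>t\<bar> * b j z \<le> 0" using nb by (intro mult_nonneg_nonpos) auto
      then show ?thesis using True assms(3) by (simp add: axis_def)
    qed (use assms(3) in \<open>simp add: axis_def\<close>)
  qed
  then have in_S: "z + axis j (of_real t) \<in> S" for t :: real using assms(1) by blast
  obtain B where B: "\<And>x. x \<in> S \<Longrightarrow> norm x \<le> B" using assms(2) by (auto simp: bounded_iff)
  define X where "X = B + norm z + 1"
  have "\<bar>X\<bar> = norm (axis j (of_real X) :: complex ^ 'n)" by (simp add: norm_axis)
  also have "\<dots> \<le> norm (z + axis j (of_real X)) + norm z"
    by (metis add_diff_cancel_left' norm_triangle_ineq4)
  also have "\<dots> \<le> B + norm z" by (rule add_right_mono[OF B[OF in_S]])
  finally show False by (simp add: X_def)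
qed

lemma compact_B_polydisc:
  assumes pos: "\<And>j. b j z > 0"
  shows "compact (B_polydisc r z b)"
proof -
  have "bounded (B_polydisc r z b)"
    unfolding bounded_iff
  proof (intro exI ballI)
    fix w assume w: "w \<in> B_polydisc r z b"
    have "norm w \<le> (\<Sum>j\<in>UNIV. cmod (w $ j))"
      unfolding norm_vec_def by (rule L2_set_le_sum) simp
    also have "\<dots> \<le> (\<Sum>j\<in>UNIV. cmod (z $ j) + r / b j z)"
    proof (rule sum_mono)
      fix j
      have "cmod (w $ j - z $ j) \<le> r / b j z"
        using w pos[of j] by (simp add: B_polydisc_def pos_le_divide_eq)
      moreover have "cmod (w $ j) \<le> cmod (z $ j) + cmod (w $ j - z $ j)"
        by (metis add.commute diff_add_cancel norm_triangle_ineq)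
      ultimately show "cmod (w $ j) \<le> cmod (z $ j) + r / b j z" by simp
    qed
    finally show "norm w \<le> (\<Sum>j\<in>UNIV. cmod (z $ j) + r / b j z)" .
  qed
  moreover have "closed (B_polydisc r z b)"
    unfolding B_polydisc_def
    by (intro closed_Collect_all closed_Collect_le continuous_intros continuous_on_component)
  ultimately show ?thesis by (simp add: compact_eq_bounded_closed)
qed

lemma complex_balanced_B_polydisc:
  assumes pos: "\<And>j. b j z > 0"
  shows "complex_balanced z (B_polydisc r z b)"
  unfolding complex_balanced_def B_polydisc_def
proof (clarify)
  fix w t j
  assume w: "\<forall>j. cmod (w $ j - z $ j) * b j z \<le> r" and t: "cmod t \<le> 1"
  have "cmod ((z + t *s (w - z)) $ j - z $ j) * b j z = cmod t * (cmod (w $ j - z $ j) * b j z)"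
    by (simp add: norm_mult right_diff_distrib[symmetric])
  also have "\<dots> \<le> 1 * (cmod (w $ j - z $ j) * b j z)"
    using t pos[of j] by (intro mult_right_mono) (auto simp: less_imp_le)
  also have "\<dots> \<le> r" using w by simp
  finally show "cmod ((z + t *s (w - z)) $ j - z $ j) * b j z \<le> r" .
qed

text \<open>Rescaling coordinate \<open>j\<close> by \<open>b j z / r\<close> maps the polydisc to
  the unit polydisc, which contains the unit ball. The volume of that ball replaces the exact one,
  as only the order of magnitude matters.\<close>

lemma measure_B_polydisc_ge:
  fixes z :: "complex ^ 'n"
  assumes pos: "\<And>j. b j z > 0" and r: "r > 0"
  shows "measure lebesgue (cball (0 :: complex ^ 'n) 1) * r ^ (2 * CARD('n))
    \<le> measure lebesgue (B_polydisc r z b) * (\<Prod>j\<in>UNIV. (b j z)\<^sup>2)"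
proof -
  let ?P = "B_polydisc r z b"
  let ?s = "\<lambda>j. of_real (b j z / r) :: complex"
  let ?L = "\<lambda>w :: complex ^ 'n. \<chi> j. ?s j * (w $ j - z $ j)"
  let ?J = "(\<chi> i j. if i = j then ?s i else 0) :: complex ^ 'n ^ 'n"
  have d: "det ?J = (\<Prod>j\<in>UNIV. ?s j)" by (subst det_diagonal) auto
  have mv: "?J *v h = (\<chi> j. ?s j * h $ j)" for h
  proof -
    have "(\<Sum>j\<in>UNIV. (if i = j then ?s i else 0) * h $ j) = (\<Sum>j\<in>UNIV. if j = i then ?s i * h $ i else 0)" for i
      by (rule sum.cong) auto
    then show ?thesis by (simp add: vec_eq_iff matrix_vector_mult_def)
  qed
  have der: "(?L has_derivative (*v) ?J) (at x within ?P)" for x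
  proof (rule has_derivative_vec)
    fix i
    have "((\<lambda>w. w $ i) has_derivative (\<lambda>h. h $ i)) (at x within ?P)"
      by (rule bounded_linear.has_derivative[OF bounded_linear_vec_nth has_derivative_ident])
    then have "((\<lambda>w. ?s i * (w $ i - z $ i)) has_derivative (\<lambda>h. ?s i * (h $ i - 0))) (at x within ?P)"
      by (intro has_derivative_mult_right has_derivative_diff has_derivative_const)
    then show "((\<lambda>w. ?L w $ i) has_derivative (\<lambda>h. (?J *v h) $ i)) (at x within ?P)"
      by (simp add: mv)
  qed
  have P: "?P \<in> lmeasurable" by (intro lmeasurable_compact compact_B_polydisc pos)
  have nz: "det ?J \<noteq> 0" unfolding d using pos r by (auto simp: less_imp_neq[symmetric])
  have im: "?L ` ?P \<in> lmeasurable"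
    by (rule lmeasurable_complex_image[OF P der nz order_refl])
  have "cball 0 1 \<subseteq> ?L ` ?P"
  proof
    fix y :: "complex ^ 'n" assume y: "y \<in> cball 0 1"
    let ?w = "\<chi> j. z $ j + y $ j / ?s j"
    have sn: "?s j \<noteq> 0" for j using pos[of j] r by simp
    have "y = ?L ?w" using sn by (simp add: vec_eq_iff)
    moreover have "?w \<in> ?P"
      unfolding B_polydisc_def
    proof (clarify)
      fix j
      have "cmod (y $ j) \<le> 1" using y Finite_Cartesian_Product.norm_nth_le[of y j] by simp
      then show "cmod (?w $ j - z $ j) * b j z \<le> r"
        using pos[of j] r by (simp add: norm_divide norm_mult field_simps)
    qed
    ultimately show "y \<in> ?L ` ?P" by blast
  qed
  then have "measure lebesgue (cball (0 :: complex ^ 'n) 1) \<le> measure lebesgue (?L ` ?P)"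
    using im by (intro measure_mono_fmeasurable) auto
  also have "\<dots> \<le> (cmod (det ?J))\<^sup>2 * measure lebesgue ?P"
    by (rule measure_complex_image_le[OF P der nz order_refl])
  also have "cmod (det ?J) = (\<Prod>j\<in>UNIV. b j z / r)"
    unfolding d prod_norm[symmetric] using pos r by (intro prod.cong) (auto simp: norm_divide abs_of_pos)
  also have "(\<Prod>j\<in>UNIV. b j z / r) = (\<Prod>j\<in>UNIV. b j z) / r ^ CARD('n)"
    by (simp add: prod_dividef)
  finally have "measure lebesgue (cball (0 :: complex ^ 'n) 1)
      \<le> ((\<Prod>j\<in>UNIV. b j z) / r ^ CARD('n))\<^sup>2 * measure lebesgue ?P" .
  moreover have "((\<Prod>j\<in>UNIV. b j z) / r ^ CARD('n))\<^sup>2 = (\<Prod>j\<in>UNIV. (b j z)\<^sup>2) / r ^ (2 * CARD('n))"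
    by (simp add: power_divide prod_power_distrib power_mult[symmetric] mult.commute)
  ultimately have "measure lebesgue (cball (0 :: complex ^ 'n) 1)
      \<le> (measure lebesgue ?P * (\<Prod>j\<in>UNIV. (b j z)\<^sup>2)) / r ^ (2 * CARD('n))"
    by (simp add: mult.commute)
  moreover have "r ^ (2 * CARD('n)) > 0" using r by simp
  ultimately show ?thesis using pos_le_divide_eq by blast
qed

section \<open>The kernel under biholomorphic maps\<close>

text \<open>The kernel function of \<open>T\<close> at \<open>F x\<close> is pulled back along
  \<open>F\<close> and serves as test function on \<open>S\<close>. Without the Jacobian factor of
  the exact transformation law its squared norm grows by at most \<open>B\<^sup>2\<close>, which is
  enough for comparability.\<close>

lemma bergman_diag_pullback:
  fixes F G :: "complex ^ 'n \<Rightarrow> complex ^ 'n"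
  assumes S: "open S" "bounded S" and T: "open T" "bounded T"
    and hol: "holomorphic_map_on F S"
    and FS: "\<And>x. x \<in> S \<Longrightarrow> F x \<in> T" and GT: "\<And>y. y \<in> T \<Longrightarrow> G y \<in> S"
    and GF: "\<And>x. x \<in> S \<Longrightarrow> G (F x) = x" and FG: "\<And>y. y \<in> T \<Longrightarrow> F (G y) = y"
    and der: "\<And>y. y \<in> T \<Longrightarrow> (G has_derivative (*v) (J y)) (at y)"
    and nz: "\<And>y. y \<in> T \<Longrightarrow> det (J y) \<noteq> 0"
    and bd: "\<And>y. y \<in> T \<Longrightarrow> cmod (det (J y)) \<le> B"
    and x: "x \<in> S"
  shows "bergman_diag T (F x) \<le> B\<^sup>2 * bergman_diag S x"
proof -
  have Sm: "S \<in> lmeasurable" and Tm: "T \<in> lmeasurable" using S T by (auto simp: lmeasurable_open)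
  have both: "(\<lambda>x. h (F x)) \<in> bergman_space S \<and>
      L2_sq (lebesgue_on S) (\<lambda>x. h (F x)) \<le> B\<^sup>2 * L2_sq (lebesgue_on T) h" if h: "h \<in> bergman_space T" for h
  proof -
    have hF: "holomorphic_fun_on (\<lambda>x. h (F x)) S"
      using FS by (intro holomorphic_fun_on_compose[OF bergman_space_holomorphic[OF h] hol]) auto
    have m: "(\<lambda>x. h (F x)) \<in> borel_measurable (lebesgue_on S)"
      using holomorphic_fun_on_imp_continuous_on[OF hF] S
      by (intro continuous_imp_measurable_on_sets_lebesgue) auto
    have hL: "h \<in> L2_on (lebesgue_on T)" by (rule bergman_space_L2[OF T(1) h])
    have "(\<integral>\<^sup>+x. ennreal ((cmod (h (F x)))\<^sup>2) \<partial>lebesgue_on S)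
        \<le> ennreal (B\<^sup>2) * (\<integral>\<^sup>+y. ennreal ((cmod (h y))\<^sup>2) \<partial>lebesgue_on T)"
      using hL by (intro nn_integral_substitution_le[where G=G and J=J] Sm Tm FS GT GF FG nz bd
          has_derivative_at_withinI[OF der]) (auto simp: L2_on_def)
    also have "\<dots> = ennreal (B\<^sup>2 * L2_sq (lebesgue_on T) h)"
      using hL by (simp add: L2_on_def L2_sq_def nn_integral_eq_integral ennreal_mult)
    finally have le: "(\<integral>\<^sup>+x. ennreal ((cmod (h (F x)))\<^sup>2) \<partial>lebesgue_on S) \<le> ennreal (B\<^sup>2 * L2_sq (lebesgue_on T) h)" .
    have "(\<integral>\<^sup>+x. ennreal ((cmod (h (F x)))\<^sup>2) \<partial>lebesgue_on S) < \<infinity>"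
      using le_less_trans[OF le ennreal_less_top] by (simp only: infinity_ennreal_def)
    then have int: "integrable (lebesgue_on S) (\<lambda>x. (cmod (h (F x)))\<^sup>2)"
      using m by (intro integrableI_nonneg) auto
    then have "(\<lambda>x. h (F x)) \<in> bergman_space S" using hF by (simp add: bergman_space_def)
    moreover have "L2_sq (lebesgue_on S) (\<lambda>x. h (F x)) \<le> B\<^sup>2 * L2_sq (lebesgue_on T) h"
      using le int by (simp add: L2_sq_def nn_integral_eq_integral ennreal_le_iff)
    ultimately show ?thesis by blast
  qed
  let ?k = "\<lambda>w. cnj (bergman_kernel T (F x) w)"
  have k: "?k \<in> bergman_space T" by (rule bergman_kernel_props(1)[OF T(1) FS[OF x]])
  have pos: "bergman_diag T (F x) > 0" by (rule bergman_diag_pos[OF T FS[OF x]])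
  have "(bergman_diag T (F x))\<^sup>2 = (cmod (?k (F x)))\<^sup>2"
    by (simp add: bergman_kernel_diag(1)[OF T(1) FS[OF x]])
  also have "\<dots> \<le> L2_sq (lebesgue_on S) (\<lambda>x. ?k (F x)) * bergman_diag S x"
    using bergman_point_le[OF S(1) x] both[OF k] by blast
  also have "\<dots> \<le> (B\<^sup>2 * L2_sq (lebesgue_on T) ?k) * bergman_diag S x"
    using both[OF k] bergman_diag_nonneg[OF S(1) x] by (intro mult_right_mono) auto
  also have "L2_sq (lebesgue_on T) ?k = bergman_diag T (F x)"
    by (simp add: bergman_kernel_diag(2)[OF T(1) FS[OF x]])
  finally show "bergman_diag T (F x) \<le> B\<^sup>2 * bergman_diag S x"
    using pos by (simp add: power2_eq_square mult.assoc mult.left_commute)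
qed

section \<open>Lebesgue norms\<close>

text \<open>A weak form of Young's inequality: above the threshold \<open>s\<close> the factor
  \<open>a powr (1 - q)\<close> is at most \<open>s powr (1 - q)\<close>.\<close>

lemma le_add_powr:
  fixes a s q :: real
  assumes "a \<ge> 0" "s > 0" "q \<ge> 1"
  shows "a \<le> s + s powr (1 - q) * a powr q"
proof (cases "a \<le> s")
  case True
  then show ?thesis by (simp add: add_increasing2)
next
  case False
  then have a: "a > 0" "s \<le> a" using assms by auto
  have "a = a powr (1 - q) * a powr q" using a by (simp add: powr_add[symmetric])
  also have "\<dots> \<le> s powr (1 - q) * a powr q"
    using a assms by (intro mult_right_mono powr_mono2') auto
  finally show ?thesis using assms by simp
qed

text \<open>Hoelder's inequality with a factor \<open>2\<close>, from the pointwise bound above with the optimal \<open>s\<close>.\<close>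

lemma nn_integral_le_Lp_norm:
  assumes Q: "Q \<in> lmeasurable" "Q \<subseteq> S" "measure lebesgue Q > 0" and S: "S \<in> sets lebesgue"
    and g: "g \<in> Lp_fun q S" and N: "Lp_norm q S g \<le> N" "N > 0" and q: "q \<ge> 1"
  shows "(\<integral>\<^sup>+w. ennreal (cmod (g w)) \<partial>lebesgue_on Q) \<le> ennreal (2 * N * measure lebesgue Q powr (1 - 1/q))"
proof -
  let ?m = "measure lebesgue Q"
  let ?I = "\<integral>x. cmod (g x) powr q \<partial>lebesgue_on S"
  \<comment> \<open>This choice balances the two terms: \<open>s * ?m\<close> and
    \<open>s powr (1 - q) * N powr q\<close> both equal \<open>N * ?m powr (1 - 1/q)\<close>, which
    produces the factor 2.\<close>
  define s where "s = N * ?m powr (- (1/q))"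
  have s: "s > 0" using N Q by (simp add: s_def)
  have Ql: "Q \<in> sets lebesgue" using Q by auto
  have gm: "g \<in> borel_measurable (lebesgue_on S)" and gi: "integrable (lebesgue_on S) (\<lambda>x. cmod (g x) powr q)"
    using g by (auto simp: Lp_fun_def)
  have gmQ: "g \<in> borel_measurable (lebesgue_on Q)"
    using gm Q(2) by (rule measurable_restrict_mono)
  have I0: "?I \<ge> 0" by simp
  have "?I = (?I powr (1/q)) powr q" using I0 q by (simp add: powr_powr)
  also have "\<dots> \<le> N powr q" using N(1) q by (intro powr_mono2) (auto simp: Lp_norm_def)
  finally have IN: "?I \<le> N powr q" .
  have "(\<integral>\<^sup>+w. ennreal (cmod (g w)) \<partial>lebesgue_on Q)
      \<le> (\<integral>\<^sup>+w. ennreal s + ennreal (s powr (1 - q)) * ennreal (cmod (g w) powr q) \<partial>lebesgue_on Q)"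
  proof (rule nn_integral_mono)
    fix w
    have "ennreal (cmod (g w)) \<le> ennreal (s + s powr (1 - q) * cmod (g w) powr q)"
      by (rule ennreal_leI[OF le_add_powr[OF norm_ge_zero s q]])
    also have "\<dots> = ennreal s + ennreal (s powr (1 - q)) * ennreal (cmod (g w) powr q)"
      using s by (simp add: ennreal_mult')
    finally show "ennreal (cmod (g w)) \<le> ennreal s + ennreal (s powr (1 - q)) * ennreal (cmod (g w) powr q)" .
  qed
  also have "\<dots> = ennreal s * emeasure (lebesgue_on Q) Q
      + ennreal (s powr (1 - q)) * (\<integral>\<^sup>+w. ennreal (cmod (g w) powr q) \<partial>lebesgue_on Q)"
    using gmQ by (simp add: nn_integral_add nn_integral_cmult)
  also have "emeasure (lebesgue_on Q) Q = ennreal ?m"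
    using Q Ql by (simp add: emeasure_restrict_space emeasure_eq_measure2 del: emeasure_completion)
  also have "(\<integral>\<^sup>+w. ennreal (cmod (g w) powr q) \<partial>lebesgue_on Q) \<le> (\<integral>\<^sup>+w. ennreal (cmod (g w) powr q) \<partial>lebesgue_on S)"
    unfolding nn_integral_lebesgue_on[OF Ql] nn_integral_lebesgue_on[OF S]
    using Q(2) by (intro nn_integral_mono mult_left_mono) (auto simp: indicator_def)
  also have "\<dots> = ennreal ?I" using gi by (simp add: nn_integral_eq_integral)
  also have "\<dots> \<le> ennreal (N powr q)" by (rule ennreal_leI[OF IN])
  finally have "(\<integral>\<^sup>+w. ennreal (cmod (g w)) \<partial>lebesgue_on Q)
      \<le> ennreal s * ennreal ?m + ennreal (s powr (1 - q)) * ennreal (N powr q)"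
    by (simp add: add_left_mono mult_left_mono)
  also have "\<dots> = ennreal (s * ?m + s powr (1 - q) * N powr q)"
    using s by (simp flip: ennreal_plus ennreal_mult')
  also have "s * ?m = N * ?m powr (1 - 1/q)"
    using Q(3) by (simp add: s_def powr_diff powr_minus field_simps)
  also have "s powr (1 - q) * N powr q = N * ?m powr (1 - 1/q)"
  proof -
    have "s powr (1 - q) = N powr (1 - q) * ?m powr (- (1/q) * (1 - q))"
      unfolding s_def using N Q by (simp add: powr_mult powr_powr)
    moreover have "- (1/q) * (1 - q) = 1 - 1/q" using q by (simp add: field_simps)
    moreover have "N powr (1 - q) * N powr q = N" using N by (simp add: powr_add[symmetric])
    ultimately show ?thesis by (simp add: mult_ac)
  qed
  finally show ?thesis by (simp add: mult.assoc)
qed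

lemma
  assumes Q: "Q \<in> lmeasurable" "Q \<subseteq> S" and S: "S \<in> sets lebesgue"
    and k: "k \<in> borel_measurable (lebesgue_on S)" and H: "H \<ge> 0" "\<And>w. w \<in> Q \<Longrightarrow> cmod (k w) \<le> H" and p: "p \<ge> 1"
  shows Lp_fun_indicator: "(\<lambda>w. indicator Q w * k w) \<in> Lp_fun p S"
    and Lp_norm_indicator: "Lp_norm p S (\<lambda>w. indicator Q w * k w) \<le> H * measure lebesgue Q powr (1 / p)"
proof -
  let ?f = "\<lambda>w. indicator Q w * k w"
  have Qm: "Q \<in> sets (lebesgue_on S)" using Q S by (auto simp: sets_restrict_space_iff)
  then have fm: "?f \<in> borel_measurable (lebesgue_on S)" using k by measurable
  have emQ: "emeasure (lebesgue_on S) Q = ennreal (measure lebesgue Q)"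
    using Q S by (simp add: emeasure_restrict_space emeasure_eq_measure2 del: emeasure_completion)
  then have Qi: "integrable (lebesgue_on S) (\<lambda>w. H powr p * indicat_real Q w)"
    using Qm by (intro integrable_mult_right integrable_real_indicator) auto
  have le: "cmod (?f w) powr p \<le> H powr p * indicat_real Q w" for w
    using H p by (auto simp: indicator_def intro!: powr_mono2)
  have fi: "integrable (lebesgue_on S) (\<lambda>w. cmod (?f w) powr p)"
    using Qi by (rule Bochner_Integration.integrable_bound) (use fm le H in \<open>auto intro!: AE_I2\<close>)
  with fm show "?f \<in> Lp_fun p S" by (simp add: Lp_fun_def)
  have "(\<integral>w. cmod (?f w) powr p \<partial>lebesgue_on S) \<le> (\<integral>w. H powr p * indicat_real Q w \<partial>lebesgue_on S)"
    using fi Qi le by (intro integral_mono) auto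
  also have "\<dots> = H powr p * measure lebesgue Q"
    using emQ Q(2) by (simp add: Int_absorb2 measure_eq_emeasure_eq_ennreal)
  finally have "Lp_norm p S ?f \<le> (H powr p * measure lebesgue Q) powr (1 / p)"
    unfolding Lp_norm_def using p by (intro powr_mono2) auto
  also have "\<dots> = H * measure lebesgue Q powr (1 / p)"
    using H p by (simp add: powr_mult powr_powr)
  finally show "Lp_norm p S ?f \<le> H * measure lebesgue Q powr (1 / p)" .
qed

section \<open>The local estimate\<close>

text \<open>By the chain rule the Jacobians are reciprocal, so a lower bound for that of
  \<open>F\<close> is an upper bound for that of its inverse.\<close>

lemma biholomorphic_inverse_derivative:
  assumes F: "biholomorphic_on F S" and S: "open S" and M': "M' > 0"
    and jac: "\<And>w. w \<in> S \<Longrightarrow> M' \<le> cmod (holo_jacobian F w)" and y: "y \<in> F ` S"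
  defines "G \<equiv> inv_into S F"
  defines "J' \<equiv> matrix (frechet_derivative G (at y))"
  shows "(G has_derivative (*v) J') (at y)" "det J' \<noteq> 0" "cmod (det J') \<le> 1 / M'"
proof -
  have Gy: "G y \<in> S" "F (G y) = y" using y by (auto simp: G_def inv_into_into f_inv_into_f)
  note j = biholomorphic_on_jacobian(2,3)[OF F S Gy(1)]
  from j(1) show "(G has_derivative (*v) J') (at y)" by (simp add: G_def[symmetric] Gy(2) J'_def)
  from j(2) have 1: "det J' * holo_jacobian F (G y) = 1" by (simp add: G_def[symmetric] Gy(2) J'_def)
  then show "det J' \<noteq> 0" by auto
  have "cmod (det J') * cmod (holo_jacobian F (G y)) = 1" using 1 by (metis norm_mult norm_one)
  moreover have "cmod (det J') * M' \<le> cmod (det J') * cmod (holo_jacobian F (G y))"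
    using jac[OF Gy(1)] by (intro mult_left_mono) auto
  ultimately show "cmod (det J') \<le> 1 / M'" using M' by (simp add: field_simps)
qed

text \<open>The operator is tested on \<open>f = indicator Q * cnj (K z _)\<close>, where \<open>Q\<close> is the preimage of \<open>P\<close>; the
  sub-mean value property over \<open>P\<close> bounds \<open>T f z\<close> from below and, as \<open>T f\<close> is holomorphic, from above.\<close>

lemma toeplitz_local_estimate:
  fixes \<Omega> :: "(complex ^ 'n) set" and F :: "complex ^ 'n \<Rightarrow> complex ^ 'n"
  assumes op: "open \<Omega>" and bdd: "bounded \<Omega>" and cont: "continuous_on \<Omega> (bergman_diag \<Omega>)"
    and p: "1 < p" and q: "1 < q" and \<alpha>: "\<alpha> \<ge> 0"
  defines "T \<equiv> toeplitz_op \<Omega> (\<lambda>z. complex_of_real (bergman_diag \<Omega> z powr (- \<alpha>)))"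
    and "G \<equiv> inv_into \<Omega> F"
  assumes T: "\<And>f. f \<in> Lp_fun p \<Omega> \<Longrightarrow> T f \<in> Lp_fun q \<Omega>"
      "\<And>f. f \<in> Lp_fun p \<Omega> \<Longrightarrow> Lp_norm q \<Omega> (T f) \<le> A * Lp_norm p \<Omega> f"
    and A: "A > 0" and z: "z \<in> \<Omega>"
    and P: "compact P" "complex_balanced (F z) P" "P \<subseteq> F ` \<Omega>" "measure lebesgue P > 0"
    and F: "biholomorphic_on F \<Omega>" and M': "M' > 0"
    and jac: "\<And>w. w \<in> \<Omega> \<Longrightarrow> M' \<le> cmod (holo_jacobian F w)" "\<And>w. w \<in> \<Omega> \<Longrightarrow> cmod (holo_jacobian F w) \<le> M"
    and C: "C > 0" "\<And>w. w \<in> \<Omega> \<Longrightarrow> F w \<in> P \<Longrightarrow> bergman_diag \<Omega> w \<le> C * bergman_diag \<Omega> z"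
  shows "(measure lebesgue P)\<^sup>2 * (C * bergman_diag \<Omega> z) powr (- \<alpha>) * (bergman_diag \<Omega> z)\<^sup>2
    \<le> 2 * M ^ 4 * A * sqrt C * bergman_diag \<Omega> z * (measure lebesgue P / M'\<^sup>2) powr (1 + 1/p - 1/q)"
proof -
  let ?\<mu> = "measure lebesgue :: (complex ^ 'n) set \<Rightarrow> real"
  let ?L = "lebesgue_on \<Omega>"
  let ?K = "bergman_kernel \<Omega> z"
  define k where "k = (\<lambda>w. cnj (?K w))"
  define \<kappa> where "\<kappa> = bergman_diag \<Omega> z"
  define H where "H = sqrt C * \<kappa>"
  define Q where "Q = G ` P"
  have inj: "inj_on F \<Omega>" and hF: "holomorphic_map_on F \<Omega>" and hG: "holomorphic_map_on G (F ` \<Omega>)"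
    using F by (auto simp: biholomorphic_on_def G_def)
  have GF: "G (F w) = w" if "w \<in> \<Omega>" for w using inj that by (simp add: G_def)
  have FG: "F (G y) = y" if "y \<in> F ` \<Omega>" for y using that by (simp add: G_def f_inv_into_f)
  have G\<Omega>: "G y \<in> \<Omega>" if "y \<in> F ` \<Omega>" for y using that by (simp add: G_def inv_into_into)
  have Q\<Omega>: "Q \<subseteq> \<Omega>" using P(3) G\<Omega> by (auto simp: Q_def)
  have FQ: "F w \<in> P" if "w \<in> Q" for w using that P(3) FG by (auto simp: Q_def)
  define J where "J w = matrix (frechet_derivative F (at w))" for w
  define J' where "J' y = matrix (frechet_derivative G (at y))" for y
  have dF: "(F has_derivative (*v) (J w)) (at w)" if "w \<in> \<Omega>" for w
    using biholomorphic_on_jacobian(1)[OF F op that] by (simp add: J_def)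
  have detJ: "det (J w) = holo_jacobian F w" for w by (simp add: J_def holo_jacobian_def)
  have jnz: "holo_jacobian F w \<noteq> 0" if "w \<in> \<Omega>" for w using jac(1)[OF that] M' by auto
  note inverse_facts = biholomorphic_inverse_derivative[OF F op M' jac(1), folded G_def, folded J'_def]
  have Pm: "P \<in> lmeasurable" using P(1) by (rule lmeasurable_compact)
  have Qm: "Q \<in> lmeasurable" and Qle: "?\<mu> Q \<le> (1 / M')\<^sup>2 * ?\<mu> P"
    unfolding Q_def using P(3) inverse_facts(2,3)
    by (auto intro!: lmeasurable_complex_image[OF Pm, where J=J' and B="1/M'"]
        measure_complex_image_le[OF Pm, where J=J'] has_derivative_at_withinI[OF inverse_facts(1)])
  have \<Omega>l: "\<Omega> \<in> sets lebesgue" using op by auto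
  have \<Omega>m: "\<Omega> \<in> lmeasurable" using op bdd by (simp add: lmeasurable_open)
  have Qon: "Q \<in> sets ?L" using Qm Q\<Omega> \<Omega>l by (auto simp: sets_restrict_space_iff)
  \<comment> \<open>\<open>Q\<close> itself may fail to be balanced about \<open>z\<close>. The
    inequality is applied on \<open>P\<close> to \<open>h\<close> composed with \<open>G\<close> and
    carried back to \<open>Q\<close>, at the cost of \<open>M\<^sup>2\<close>.\<close>
  have submean: "ennreal (?\<mu> P * cmod (h z)) \<le> ennreal (M\<^sup>2) * (\<integral>\<^sup>+w. ennreal (cmod (h w)) \<partial>lebesgue_on Q)"
    if h: "holomorphic_fun_on h \<Omega>" for h
  proof -
    have hGh: "holomorphic_fun_on (\<lambda>y. h (G y)) (F ` \<Omega>)"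
      using G\<Omega> by (intro holomorphic_fun_on_compose[OF h hG]) auto
    have "ennreal (?\<mu> P * cmod (h z)) = emeasure lebesgue P * ennreal (cmod (h (G (F z))))"
      using Pm z by (simp add: GF emeasure_eq_measure2 ennreal_mult del: emeasure_completion)
    also have "\<dots> \<le> (\<integral>\<^sup>+y. ennreal (cmod (h (G y))) \<partial>lebesgue_on P)"
      by (rule submean_value[OF P(1,2) hGh P(3)])
    also have "\<dots> \<le> ennreal (M\<^sup>2) * (\<integral>\<^sup>+w. ennreal (cmod (h w)) \<partial>lebesgue_on Q)"
    proof (rule nn_integral_substitution_le[OF Pm Qm, where G=F and J=J])
      have "h \<in> borel_measurable (lebesgue_on Q)"
        using continuous_on_subset[OF holomorphic_fun_on_imp_continuous_on[OF h] Q\<Omega>] Qm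
        by (intro continuous_imp_measurable_on_sets_lebesgue) auto
      then show "(\<lambda>w. ennreal (cmod (h w))) \<in> borel_measurable (lebesgue_on Q)" by measurable
      show "det (J w) \<noteq> 0" "cmod (det (J w)) \<le> M" if "w \<in> Q" for w
        using that Q\<Omega> jac(2) jnz by (auto simp: detJ)
    qed (use P(3) FG FQ Q\<Omega> GF in \<open>auto simp: Q_def intro!: has_derivative_at_withinI[OF dF]\<close>)
    finally show ?thesis .
  qed
  have \<kappa>: "\<kappa> > 0" unfolding \<kappa>_def by (rule bergman_diag_pos[OF op bdd z])
  have H: "H > 0" using C \<kappa> by (simp add: H_def)
  have M: "M > 0" using jac[OF z] M' by linarith
  have kA: "k \<in> bergman_space \<Omega>" unfolding k_def by (rule bergman_kernel_props(1)[OF op z])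
  have kL: "k \<in> L2_on ?L" by (rule bergman_space_L2[OF op kA])
  have km: "k \<in> borel_measurable ?L" using kL by (simp add: L2_on_def)
  have kz: "cmod (k z) = \<kappa>"
    using \<kappa> by (simp add: k_def bergman_kernel_diag(1)[OF op z] \<kappa>_def)
  have diagQ: "bergman_diag \<Omega> w \<le> C * \<kappa>" if "w \<in> Q" for w
    using C(2) that Q\<Omega> FQ by (auto simp: \<kappa>_def)
  have kH: "cmod (k w) \<le> H" if "w \<in> Q" for w
  proof -
    have w: "w \<in> \<Omega>" using that Q\<Omega> by auto
    have "(cmod (k w))\<^sup>2 \<le> \<kappa> * bergman_diag \<Omega> w"
      using bergman_kernel_le[OF op z w] by (simp add: k_def \<kappa>_def)
    also have "\<dots> \<le> \<kappa> * (C * \<kappa>)" using diagQ[OF that] \<kappa> by (intro mult_left_mono) auto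
    also have "\<dots> = H\<^sup>2" using C by (simp add: H_def power_mult_distrib power2_eq_square)
    finally show ?thesis by (rule power2_le_imp_le) (use H in simp)
  qed
  have \<mu>Q: "?\<mu> Q > 0"
  proof (rule ccontr)
    assume "\<not> ?thesis"
    then have "?\<mu> Q = 0" using measure_nonneg[of lebesgue Q] by linarith
    then have "emeasure lebesgue Q = 0" using Qm by (simp add: emeasure_eq_measure2 del: emeasure_completion)
    then have "(\<integral>\<^sup>+w. ennreal (cmod (1 :: complex)) \<partial>lebesgue_on Q) = 0"
      using Qm by (simp add: emeasure_restrict_space fmeasurableD del: emeasure_completion)
    with submean[OF holomorphic_fun_on_const[of 1 \<Omega>]] P(4) show False by simp
  qed
  define f where "f = (\<lambda>w. indicator Q w * k w)"
  define \<psi> where "\<psi> = (\<lambda>w. bergman_diag \<Omega> w powr (- \<alpha>))"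
  define u where "u = (\<lambda>w. complex_of_real (\<psi> w) * f w)"
  have fp: "f \<in> Lp_fun p \<Omega>" and fn: "Lp_norm p \<Omega> f \<le> H * ?\<mu> Q powr (1 / p)"
    unfolding f_def using H p
    by (auto intro!: Lp_fun_indicator[OF Qm Q\<Omega> \<Omega>l km _ kH] Lp_norm_indicator[OF Qm Q\<Omega> \<Omega>l km _ kH])
  have dpos: "bergman_diag \<Omega> w > 0" if "w \<in> \<Omega>" for w by (rule bergman_diag_pos[OF op bdd that])
  have "continuous_on \<Omega> \<psi>"
    unfolding \<psi>_def using dpos by (intro continuous_on_powr cont continuous_on_const) (auto simp: less_imp_neq[symmetric])
  then have \<psi>m: "\<psi> \<in> borel_measurable ?L"
    using \<Omega>l by (rule continuous_imp_measurable_on_sets_lebesgue)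
  have \<psi>0: "\<psi> w \<ge> 0" for w by (simp add: \<psi>_def)
  \<comment> \<open>Boundedness of the symbol puts \<open>u\<close> into L^2, where integration
    against the Bergman kernel is the orthogonal projection. It comes from the lower bound for the
    diagonal and \<open>\<alpha> \<ge> 0\<close>.\<close>
  have \<psi>le: "\<psi> w \<le> ?\<mu> \<Omega> powr \<alpha>" if "w \<in> \<Omega>" for w
  proof -
    have "1 \<le> ?\<mu> \<Omega> * bergman_diag \<Omega> w" by (rule bergman_diag_lower[OF op bdd that])
    then have "1 \<le> (?\<mu> \<Omega> * bergman_diag \<Omega> w) powr \<alpha>" using \<alpha> by (intro ge_one_powr_ge_zero)
    also have "\<dots> = ?\<mu> \<Omega> powr \<alpha> * bergman_diag \<Omega> w powr \<alpha>"
      by (rule powr_mult)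
    finally show ?thesis using dpos[OF that] by (simp add: \<psi>_def powr_minus field_simps)
  qed
  have um: "u \<in> borel_measurable ?L"
    using \<psi>m km Qon unfolding u_def f_def by measurable
  have uL: "u \<in> L2_on ?L"
  proof -
    have "integrable ?L (\<lambda>w. (cmod (u w))\<^sup>2)"
    proof (rule Bochner_Integration.integrable_bound)
      show "integrable ?L (\<lambda>w. (?\<mu> \<Omega> powr \<alpha>)\<^sup>2 * (cmod (k w))\<^sup>2)"
        using kL by (auto simp: L2_on_def)
      show "AE w in ?L. norm ((cmod (u w))\<^sup>2) \<le> norm ((?\<mu> \<Omega> powr \<alpha>)\<^sup>2 * (cmod (k w))\<^sup>2)"
      proof (rule AE_I2)
        fix w assume "w \<in> space ?L"
        then have w: "w \<in> \<Omega>" by simp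
        have "cmod (u w) \<le> ?\<mu> \<Omega> powr \<alpha> * cmod (k w)"
          using \<psi>le[OF w] \<psi>0[of w] by (auto simp: u_def f_def norm_mult indicator_def intro!: mult_right_mono)
        then have "(cmod (u w))\<^sup>2 \<le> (?\<mu> \<Omega> powr \<alpha> * cmod (k w))\<^sup>2" by (intro power_mono) auto
        then show "norm ((cmod (u w))\<^sup>2) \<le> norm ((?\<mu> \<Omega> powr \<alpha>)\<^sup>2 * (cmod (k w))\<^sup>2)"
          by (simp add: power_mult_distrib)
      qed
    qed (use um in measurable)
    with um show ?thesis by (simp add: L2_on_def)
  qed
  have Tf: "T f y = (\<integral>w. bergman_kernel \<Omega> y w * u w \<partial>?L)" for y
    by (simp add: T_def toeplitz_op_def u_def \<psi>_def mult.assoc)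
  obtain g where g: "g \<in> bergman_space \<Omega>" "\<And>y. y \<in> \<Omega> \<Longrightarrow> T f y = g y"
    using bergman_projection[OF op uL] unfolding Tf by blast
  define N where "N = A * (H * ?\<mu> Q powr (1 / p))"
  have N: "N > 0" using A H \<mu>Q by (simp add: N_def)
  have TN: "Lp_norm q \<Omega> (T f) \<le> N"
    unfolding N_def using T(2)[OF fp] fn A by (meson mult_left_mono less_imp_le order_trans)
  have "ennreal (?\<mu> P * cmod (g z)) \<le> ennreal (M\<^sup>2) * (\<integral>\<^sup>+w. ennreal (cmod (g w)) \<partial>lebesgue_on Q)"
    by (rule submean[OF bergman_space_holomorphic[OF g(1)]])
  also have "(\<integral>\<^sup>+w. ennreal (cmod (g w)) \<partial>lebesgue_on Q) = (\<integral>\<^sup>+w. ennreal (cmod (T f w)) \<partial>lebesgue_on Q)"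
    using Q\<Omega> g(2) by (intro nn_integral_cong) auto
  also have "\<dots> \<le> ennreal (2 * N * ?\<mu> Q powr (1 - 1/q))"
    by (rule nn_integral_le_Lp_norm[OF Qm Q\<Omega> \<mu>Q \<Omega>l T(1)[OF fp] TN N]) (use q in simp)
  finally have "ennreal (?\<mu> P * cmod (g z)) \<le> ennreal (M\<^sup>2 * (2 * N * ?\<mu> Q powr (1 - 1/q)))"
    using N by (simp add: mult_left_mono ennreal_mult)
  then have upper: "?\<mu> P * cmod (g z) \<le> M\<^sup>2 * (2 * N * ?\<mu> Q powr (1 - 1/q))"
    using N by (subst (asm) ennreal_le_iff) auto
  \<comment> \<open>The kernel times its conjugate makes \<open>T f z\<close> an integral of a
    nonnegative function. On \<open>Q\<close> the symbol is at least
    \<open>(C * \<kappa>) powr (- \<alpha>)\<close>, and \<open>submean\<close> for the square of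
    \<open>k\<close> bounds the remaining integral from below.\<close>
  have lower: "(C * \<kappa>) powr (- \<alpha>) * (?\<mu> P * \<kappa>\<^sup>2) \<le> M\<^sup>2 * cmod (g z)"
  proof -
    let ?v = "\<lambda>w. \<psi> w * (indicator Q w * (cmod (k w))\<^sup>2)"
    have Kk: "?K w * k w = of_real ((cmod (k w))\<^sup>2)" for w
      unfolding k_def complex_norm_square by (simp add: mult.commute)
    have "T f z = (\<integral>w. complex_of_real (?v w) \<partial>?L)"
      unfolding Tf
    proof (intro Bochner_Integration.integral_cong refl)
      fix w
      have "?K w * u w = of_real (\<psi> w) * indicator Q w * (?K w * k w)"
        by (simp add: u_def f_def mult_ac)
      then show "?K w * u w = complex_of_real (?v w)"
        unfolding Kk by (simp add: indicator_def)
    qed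
    then have gz: "g z = of_real (\<integral>w. ?v w \<partial>?L)" using g(2)[OF z] by (simp only: integral_complex_of_real)
    have ki: "integrable ?L (\<lambda>w. (cmod (k w))\<^sup>2)" using kL by (simp add: L2_on_def)
    have Qk: "integrable ?L (\<lambda>w. indicator Q w * (cmod (k w))\<^sup>2)"
      using integrable_real_mult_indicator[OF Qon ki] by (simp add: mult.commute)
    have vi: "integrable ?L ?v"
    proof (rule Bochner_Integration.integrable_bound)
      show "integrable ?L (\<lambda>w. ?\<mu> \<Omega> powr \<alpha> * (indicator Q w * (cmod (k w))\<^sup>2))"
        using Qk by (rule integrable_mult_right)
      show "?v \<in> borel_measurable ?L" using \<psi>m km Qon by measurable
      show "AE w in ?L. norm (?v w) \<le> norm (?\<mu> \<Omega> powr \<alpha> * (indicator Q w * (cmod (k w))\<^sup>2))"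
        using \<psi>le \<psi>0 by (intro AE_I2) (auto simp: abs_mult intro!: mult_right_mono)
    qed
    have "(C * \<kappa>) powr (- \<alpha>) * (\<integral>w. indicator Q w * (cmod (k w))\<^sup>2 \<partial>?L)
        = (\<integral>w. (C * \<kappa>) powr (- \<alpha>) * (indicator Q w * (cmod (k w))\<^sup>2) \<partial>?L)"
      by simp
    also have "\<dots> \<le> (\<integral>w. ?v w \<partial>?L)"
    proof (rule integral_mono[OF integrable_mult_right[OF Qk] vi])
      fix w assume "w \<in> space ?L"
      then have w: "w \<in> \<Omega>" by simp
      show "(C * \<kappa>) powr (- \<alpha>) * (indicator Q w * (cmod (k w))\<^sup>2) \<le> ?v w"
      proof (cases "w \<in> Q")
        case True
        have "(C * \<kappa>) powr (- \<alpha>) \<le> \<psi> w"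
          unfolding \<psi>_def using diagQ[OF True] dpos[OF w] \<alpha> by (intro powr_mono2') auto
        then show ?thesis by (intro mult_right_mono) auto
      qed simp
    qed
    also have "\<dots> \<le> cmod (g z)" unfolding gz norm_of_real by simp
    finally have 1: "(C * \<kappa>) powr (- \<alpha>) * (\<integral>w. indicator Q w * (cmod (k w))\<^sup>2 \<partial>?L) \<le> cmod (g z)" .
    have "ennreal (?\<mu> P * \<kappa>\<^sup>2) = ennreal (?\<mu> P * cmod (k z * k z))"
      by (simp add: norm_mult kz power2_eq_square)
    also have "\<dots> \<le> ennreal (M\<^sup>2) * (\<integral>\<^sup>+w. ennreal (cmod (k w * k w)) \<partial>lebesgue_on Q)"
      by (intro submean holomorphic_fun_on_mult bergman_space_holomorphic kA)
    also have "(\<integral>\<^sup>+w. ennreal (cmod (k w * k w)) \<partial>lebesgue_on Q)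
        = (\<integral>\<^sup>+w. ennreal (indicator Q w * (cmod (k w))\<^sup>2) \<partial>?L)"
      unfolding nn_integral_lebesgue_on[OF fmeasurableD[OF Qm]] nn_integral_lebesgue_on[OF \<Omega>l]
      using Q\<Omega> by (intro nn_integral_cong) (auto simp: indicator_def norm_mult power2_eq_square)
    also have "\<dots> = ennreal (\<integral>w. indicator Q w * (cmod (k w))\<^sup>2 \<partial>?L)"
      using Qk by (intro nn_integral_eq_integral) auto
    finally have "ennreal (?\<mu> P * \<kappa>\<^sup>2) \<le> ennreal (M\<^sup>2 * (\<integral>w. indicator Q w * (cmod (k w))\<^sup>2 \<partial>?L))"
      by (simp add: ennreal_mult)
    then have 2: "?\<mu> P * \<kappa>\<^sup>2 \<le> M\<^sup>2 * (\<integral>w. indicator Q w * (cmod (k w))\<^sup>2 \<partial>?L)"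
      by (subst (asm) ennreal_le_iff) auto
    have "(C * \<kappa>) powr (- \<alpha>) * (?\<mu> P * \<kappa>\<^sup>2)
        \<le> (C * \<kappa>) powr (- \<alpha>) * (M\<^sup>2 * (\<integral>w. indicator Q w * (cmod (k w))\<^sup>2 \<partial>?L))"
      using 2 by (rule mult_left_mono) simp
    also have "\<dots> = M\<^sup>2 * ((C * \<kappa>) powr (- \<alpha>) * (\<integral>w. indicator Q w * (cmod (k w))\<^sup>2 \<partial>?L))" by simp
    also have "\<dots> \<le> M\<^sup>2 * cmod (g z)" using 1 by (rule mult_left_mono) simp
    finally show ?thesis .
  qed
  \<comment> \<open>The factor \<open>M ^ 4\<close> collects two uses of \<open>submean\<close>; the
    exponent \<open>1 + 1/p - 1/q\<close> adds \<open>1/p\<close> from the norm of \<open>f\<close>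
    to \<open>1 - 1/q\<close> from Hoelder's inequality.\<close>
  have "?\<mu> P * ((C * \<kappa>) powr (- \<alpha>) * (?\<mu> P * \<kappa>\<^sup>2)) \<le> ?\<mu> P * (M\<^sup>2 * cmod (g z))"
    using lower by (rule mult_left_mono) simp
  also have "\<dots> = M\<^sup>2 * (?\<mu> P * cmod (g z))" by simp
  also have "\<dots> \<le> M\<^sup>2 * (M\<^sup>2 * (2 * N * ?\<mu> Q powr (1 - 1/q)))"
    using upper by (rule mult_left_mono) simp
  also have "\<dots> = 2 * M ^ 4 * A * H * (?\<mu> Q powr (1 / p) * ?\<mu> Q powr (1 - 1/q))"
    by (simp add: N_def power4_eq_xxxx power2_eq_square mult_ac)
  also have "?\<mu> Q powr (1 / p) * ?\<mu> Q powr (1 - 1/q) = ?\<mu> Q powr (1 + 1/p - 1/q)"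
    by (simp add: powr_add[symmetric] algebra_simps)
  also have "2 * M ^ 4 * A * H * \<dots> \<le> 2 * M ^ 4 * A * H * (?\<mu> P / M'\<^sup>2) powr (1 + 1/p - 1/q)"
  proof (intro mult_left_mono powr_mono2)
    have "1 / q < 1" "1 / p > 0" using p q by auto
    then show "0 \<le> 1 + 1/p - 1/q" by linarith
    show "?\<mu> Q \<le> ?\<mu> P / M'\<^sup>2" using Qle by (simp add: power_divide)
  qed (use A H in auto)
  finally show ?thesis
    by (simp add: H_def \<kappa>_def power2_eq_square mult_ac)
qed

text \<open>Two instances of \<open>bergman_diag_pullback\<close>: along \<open>F\<close> the
  Jacobian of the inverse enters, bounded by \<open>1 / M'\<close>, and along the inverse that of
  \<open>F\<close>, bounded by \<open>M\<close>.\<close>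

lemma bergman_diag_biholomorphic:
  fixes S :: "(complex ^ 'n) set"
  assumes F: "biholomorphic_on F S" and S: "open S" "bounded S" "bounded (F ` S)" and M': "M' > 0"
    and jac: "\<And>w. w \<in> S \<Longrightarrow> M' \<le> cmod (holo_jacobian F w)" "\<And>w. w \<in> S \<Longrightarrow> cmod (holo_jacobian F w) \<le> M"
    and x: "x \<in> S"
  shows "bergman_diag (F ` S) (F x) \<le> bergman_diag S x / M'\<^sup>2"
    and "bergman_diag S x \<le> M\<^sup>2 * bergman_diag (F ` S) (F x)"
proof -
  let ?G = "inv_into S F"
  have o: "open (F ` S)" and h: "holomorphic_map_on F S" "holomorphic_map_on ?G (F ` S)" and inj: "inj_on F S"
    using F by (auto simp: biholomorphic_on_def)
  have maps: "\<And>w. w \<in> S \<Longrightarrow> F w \<in> F ` S" "\<And>y. y \<in> F ` S \<Longrightarrow> ?G y \<in> S"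
    "\<And>w. w \<in> S \<Longrightarrow> ?G (F w) = w" "\<And>y. y \<in> F ` S \<Longrightarrow> F (?G y) = y"
    using inj by (auto simp: inv_into_into f_inv_into_f)
  note i = biholomorphic_inverse_derivative[OF F S(1) M' jac(1)]
  have "bergman_diag (F ` S) (F x) \<le> (1 / M')\<^sup>2 * bergman_diag S x"
    by (rule bergman_diag_pullback[OF S(1,2) o S(3) h(1) maps i x])
  then show "bergman_diag (F ` S) (F x) \<le> bergman_diag S x / M'\<^sup>2" by (simp add: power_divide)
  have d: "det (matrix (frechet_derivative F (at w))) \<noteq> 0"
    "cmod (det (matrix (frechet_derivative F (at w)))) \<le> M" if "w \<in> S" for w
    using jac[OF that] M' by (auto simp: holo_jacobian_def)
  have "bergman_diag S (?G (F x)) \<le> M\<^sup>2 * bergman_diag (F ` S) (F x)"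
    by (rule bergman_diag_pullback[OF o S(3) S(1,2) h(2) maps(2,1,4,3)
          biholomorphic_on_jacobian(1)[OF F S(1)] d maps(1)[OF x]])
  then show "bergman_diag S x \<le> M\<^sup>2 * bergman_diag (F ` S) (F x)" by (simp add: maps(3)[OF x])
qed

text \<open>Here \<open>V\<close> is the volume of the polydisc and \<open>\<beta>\<close> stands
  for \<open>1/p - 1/q\<close>. The hypothesis \<open>est\<close> bounds
  \<open>V powr (1 - \<beta>) * \<kappa> powr (1 - \<alpha>)\<close>; since
  \<open>1 - \<beta>\<close> is nonnegative, \<open>V\<close> may be replaced by its lower bound
  \<open>a / \<kappa>\<close>, which leaves a power of \<open>\<kappa>\<close> alone.\<close>

lemma exponent_estimate:
  fixes V \<kappa> a c m E \<alpha> \<beta> :: real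
  assumes pos: "V > 0" "\<kappa> > 0" "a > 0" "c > 0" "m > 0" and a: "a \<le> \<kappa> * V" and \<beta>: "\<beta> \<le> 1"
    and est: "V\<^sup>2 * (c * \<kappa>) powr (- \<alpha>) * \<kappa>\<^sup>2 \<le> E * \<kappa> * (V / m) powr (1 + \<beta>)"
  shows "a powr (1 - \<beta>) * \<kappa> powr (\<beta> - \<alpha>) \<le> E * (1 / m) powr (1 + \<beta>) * c powr \<alpha>"
proof -
  \<comment> \<open>Multiplication by \<open>?X\<close> removes \<open>\<kappa>\<close> and
    \<open>V\<close> from the right-hand side of \<open>est\<close> and \<open>c\<close> from its
    left-hand side.\<close>
  let ?X = "c powr \<alpha> * \<kappa> powr (- 1) * V powr (- (1 + \<beta>))"
  have "a powr (1 - \<beta>) * \<kappa> powr (\<beta> - \<alpha>) \<le> (\<kappa> * V) powr (1 - \<beta>) * \<kappa> powr (\<beta> - \<alpha>)"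
    using a pos \<beta> by (intro mult_right_mono powr_mono2) auto
  also have "\<dots> = V powr (1 - \<beta>) * (\<kappa> powr (1 - \<beta>) * \<kappa> powr (\<beta> - \<alpha>))"
    by (simp add: powr_mult mult_ac)
  also have "\<dots> = V powr (1 - \<beta>) * \<kappa> powr (1 - \<alpha>)"
    by (simp add: powr_add[symmetric])
  also have "\<dots> = V powr (2 + - (1 + \<beta>)) * \<kappa> powr (- \<alpha> + 2 + - 1) * c powr (- \<alpha> + \<alpha>)"
    using pos by simp
  also have "\<dots> = (V powr 2 * (c powr (- \<alpha>) * \<kappa> powr (- \<alpha>)) * \<kappa> powr 2) * ?X"
    unfolding powr_add by (simp only: mult_ac)
  also have "\<dots> = (V\<^sup>2 * (c * \<kappa>) powr (- \<alpha>) * \<kappa>\<^sup>2) * ?X"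
    using pos by (simp add: powr_mult)
  also have "\<dots> \<le> (E * \<kappa> * (V / m) powr (1 + \<beta>)) * ?X"
    using est by (rule mult_right_mono) simp
  also have "\<dots> = (E * \<kappa> powr 1 * (V powr (1 + \<beta>) * (1 / m) powr (1 + \<beta>))) * ?X"
    using pos powr_mult[of V "1 / m" "1 + \<beta>"] by simp
  also have "\<dots> = E * (1 / m) powr (1 + \<beta>) * c powr \<alpha> * (\<kappa> powr (1 + - 1)) * (V powr ((1 + \<beta>) + - (1 + \<beta>)))"
    unfolding powr_add by (simp only: mult_ac)
  also have "\<dots> = E * (1 / m) powr (1 + \<beta>) * c powr \<alpha>"
    using pos by simp
  finally show ?thesis .
qed

text \<open>The diagonal over \<open>\<Omega>\<close> does not meet the removed boundary diagonal.
  The continuity provides the measurability of the symbol.\<close>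

lemma continuous_on_bergman_diag:
  assumes "open \<Omega>" "bergman_kernel_cont_ext \<Omega>"
  shows "continuous_on \<Omega> (bergman_diag \<Omega>)"
proof -
  obtain K where K: "continuous_on (closure \<Omega> \<times> closure \<Omega> - {(z, z) |z. z \<in> frontier \<Omega>}) K"
      "\<And>z w. z \<in> \<Omega> \<Longrightarrow> w \<in> \<Omega> \<Longrightarrow> K (z, w) = bergman_kernel \<Omega> z w"
    using assms(2) by (auto simp: bergman_kernel_cont_ext_def)
  have "continuous_on \<Omega> (\<lambda>w. K (w, w))"
  proof (rule continuous_on_compose2[OF K(1)])
    show "(\<lambda>w. (w, w)) ` \<Omega> \<subseteq> closure \<Omega> \<times> closure \<Omega> - {(z, z) |z. z \<in> frontier \<Omega>}"
      using closure_subset[of \<Omega>] assms(1) by (auto simp: frontier_def interior_open)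
  qed (intro continuous_intros)
  then have "continuous_on \<Omega> (\<lambda>w. Re (K (w, w)))" by (rule continuous_on_Re)
  then show ?thesis by (rule continuous_on_eq) (simp add: K(2) bergman_diag_def)
qed

section \<open>The necessary condition\<close>

theorem theorem3p1:
  fixes \<Omega> :: "(complex ^ 'n) set"
    and o1 :: 'n
    and \<Phi> :: "complex ^ 'n \<Rightarrow> complex ^ 'n \<Rightarrow> complex ^ 'n"
    and b :: "complex ^ 'n \<Rightarrow> 'n \<Rightarrow> complex ^ 'n \<Rightarrow> real"
    and \<alpha> p q :: real
  assumes "bounded_domain \<Omega>" and "smooth_pseudoconvex \<Omega>"
    and "sharp_B_type_via o1 \<Omega> \<Phi> b"
    and "B_polydisc_property \<Omega> \<Phi> b"
    and "\<alpha> \<ge> 0" and "1 < p" and "p \<le> q"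
    and "Lp_Lq_bounded p q \<Omega>
           (toeplitz_op \<Omega> (\<lambda>z. complex_of_real (bergman_diag \<Omega> z powr (- \<alpha>))))"
  shows "\<alpha> \<ge> 1 / p - 1 / q"
proof -
  let ?T = "toeplitz_op \<Omega> (\<lambda>z. complex_of_real (bergman_diag \<Omega> z powr (- \<alpha>)))"
  let ?\<mu> = "measure lebesgue :: (complex ^ 'n) set \<Rightarrow> real"
  define \<beta> where "\<beta> = 1 / p - 1 / q"
  have op: "open \<Omega>" and bdd: "bounded \<Omega>"
    using assms(1) by (auto simp: bounded_domain_def)
  have q: "1 < q" using assms by linarith
  have cont: "continuous_on \<Omega> (bergman_diag \<Omega>)"
    using assms(3) by (intro continuous_on_bergman_diag op) (simp add: sharp_B_type_via_def)
  obtain \<epsilon>1 C1 C' M M' where \<epsilon>1: "\<epsilon>1 > 0" and C': "C' > 0" and M: "M > 0" and M': "M' > 0"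
    and sharp: "\<And>z. z \<in> closure \<Omega> \<Longrightarrow> infdist z (frontier \<Omega>) < \<epsilon>1 \<Longrightarrow>
          biholomorphic_on (\<Phi> z) \<Omega> \<and>
          (\<forall>w\<in>\<Omega>. M' \<le> cmod (holo_jacobian (\<Phi> z) w) \<and> cmod (holo_jacobian (\<Phi> z) w) \<le> M) \<and>
          B_system o1 (\<Phi> z ` \<Omega>) (\<Phi> z z) (b z) \<and>
          sharp_B_type_at C1 C' (\<Phi> z ` \<Omega>) (\<Phi> z z) (b z)"
    using assms(3) unfolding sharp_B_type_via_def by blast
  obtain r C2 \<epsilon>2 where r: "r > 0" and C2: "C2 > 0" and \<epsilon>2: "\<epsilon>2 > 0"
    and poly: "\<And>z. z \<in> \<Omega> \<Longrightarrow> infdist z (frontier \<Omega>) < \<epsilon>2 \<Longrightarrow>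
        B_polydisc r (\<Phi> z z) (b z) \<subseteq> \<Phi> z ` \<Omega> \<and>
        (\<forall>w\<in>B_polydisc r (\<Phi> z z) (b z).
           bergman_diag (\<Phi> z ` \<Omega>) w \<le> C2 * bergman_diag (\<Phi> z ` \<Omega>) (\<Phi> z z))"
    using assms(4) unfolding B_polydisc_property_def by blast
  obtain A0 where A0: "\<And>f. f \<in> Lp_fun p \<Omega> \<Longrightarrow> ?T f \<in> Lp_fun q \<Omega> \<and> Lp_norm q \<Omega> (?T f) \<le> A0 * Lp_norm p \<Omega> f"
    using assms(8) unfolding Lp_Lq_bounded_def by blast
  \<comment> \<open>\<open>A0\<close> may be zero or negative, whereas the local estimate asks for a
    positive bound.\<close>
  define A where "A = max A0 1"
  have A: "A > 0" by (simp add: A_def)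
  have TA: "Lp_norm q \<Omega> (?T f) \<le> A * Lp_norm p \<Omega> f" if "f \<in> Lp_fun p \<Omega>" for f
  proof -
    have "A0 * Lp_norm p \<Omega> f \<le> A * Lp_norm p \<Omega> f"
      by (intro mult_right_mono) (auto simp: A_def Lp_norm_def)
    then show ?thesis using A0[OF that] by linarith
  qed
  \<comment> \<open>The polydisc hypothesis concerns the image domain; passing to the diagonal of
    \<open>\<Omega>\<close> costs \<open>M\<^sup>2\<close> on one side and
    \<open>1 / M'\<^sup>2\<close> on the other.\<close>
  define C3 where "C3 = M\<^sup>2 * C2 / M'\<^sup>2"
  \<comment> \<open>A lower bound for the diagonal at \<open>z\<close> times the volume of the
    polydisc. The volume estimate contributes the last factor, sharpness contributes
    \<open>C'\<close>, and the return to \<open>\<Omega>\<close> contributes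
    \<open>M'\<^sup>2\<close>.\<close>
  define a where "a = M'\<^sup>2 * C' * (?\<mu> (cball 0 1) * r ^ (2 * CARD('n)))"
  define E where "E = 2 * M ^ 4 * A * sqrt C3"
  define X where "X = E * (1 / M'\<^sup>2) powr (1 + \<beta>) * C3 powr \<alpha>"
  have C3: "C3 > 0" using M C2 M' by (simp add: C3_def)
  have ball: "?\<mu> (cball 0 1) > 0" by (simp add: content_cball_pos)
  have a: "a > 0" unfolding a_def by (intro mult_pos_pos zero_less_power M' C' r ball)
  have \<beta>1: "\<beta> \<le> 1"
  proof -
    have "1 / p \<le> 1" "1 / q > 0" using assms(6) q by auto
    then show ?thesis unfolding \<beta>_def by linarith
  qed
  \<comment> \<open>All constants in \<open>X\<close> and \<open>a\<close> are uniform in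
    \<open>z\<close>, so the bound persists along every approach to the boundary.\<close>
  have local: "a powr (1 - \<beta>) * bergman_diag \<Omega> z powr (\<beta> - \<alpha>) \<le> X"
    if z: "z \<in> \<Omega>" and near: "infdist z (frontier \<Omega>) < min \<epsilon>1 \<epsilon>2" for z
  proof -
    let ?P = "B_polydisc r (\<Phi> z z) (b z)" and ?D = "\<Phi> z ` \<Omega>"
    have "z \<in> closure \<Omega>" using z closure_subset by blast
    with sharp[of z] near have F: "biholomorphic_on (\<Phi> z) \<Omega>"
      and jac: "\<And>w. w \<in> \<Omega> \<Longrightarrow> M' \<le> cmod (holo_jacobian (\<Phi> z) w)"
        "\<And>w. w \<in> \<Omega> \<Longrightarrow> cmod (holo_jacobian (\<Phi> z) w) \<le> M"
      and sys: "B_system o1 ?D (\<Phi> z z) (b z)" and shp: "sharp_B_type_at C1 C' ?D (\<Phi> z z) (b z)"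
      by auto
    have PD: "?P \<subseteq> ?D" and Pk: "\<And>y. y \<in> ?P \<Longrightarrow> bergman_diag ?D y \<le> C2 * bergman_diag ?D (\<Phi> z z)"
      using poly[OF z] near by auto
    have Db: "bounded ?D" using sys by (simp add: B_system_def bounded_domain_def)
    have bpos: "b z j (\<Phi> z z) > 0" for j by (rule B_polydisc_bounded_imp_pos[OF PD Db r])
    have zD: "\<Phi> z z \<in> ?D" using z by auto
    let ?B = "\<Prod>j\<in>UNIV. (b z j (\<Phi> z z))\<^sup>2"
    have B: "?B > 0" using bpos by (intro prod_pos) (simp add: less_imp_neq[symmetric])
    have PB: "?\<mu> (cball 0 1) * r ^ (2 * CARD('n)) \<le> ?\<mu> ?P * ?B"
      by (intro measure_B_polydisc_ge bpos r)
    have "0 < ?\<mu> (cball 0 1) * r ^ (2 * CARD('n))" using ball r by simp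
    then have "0 < ?\<mu> ?P * ?B" using PB by linarith
    then have P0: "?\<mu> ?P > 0" using B by (simp add: zero_less_mult_iff)
    have diag: "bergman_diag ?D (\<Phi> z w) \<le> bergman_diag \<Omega> w / M'\<^sup>2"
      "bergman_diag \<Omega> w \<le> M\<^sup>2 * bergman_diag ?D (\<Phi> z w)" if "w \<in> \<Omega>" for w
      by (rule bergman_diag_biholomorphic[OF F op bdd Db M']; use jac that in blast)+
    have CB: "C' * ?B \<le> bergman_diag ?D (\<Phi> z z)"
      using shp zD by (simp add: sharp_B_type_at_def)
    have "a \<le> M'\<^sup>2 * C' * (?\<mu> ?P * ?B)"
      unfolding a_def using PB M' C' by (intro mult_left_mono) auto
    also have "\<dots> = M'\<^sup>2 * (C' * ?B) * ?\<mu> ?P" by simp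
    also have "\<dots> \<le> M'\<^sup>2 * (bergman_diag \<Omega> z / M'\<^sup>2) * ?\<mu> ?P"
      using CB diag(1)[OF z] by (intro mult_right_mono mult_left_mono) auto
    also have "\<dots> = bergman_diag \<Omega> z * ?\<mu> ?P" using M' by simp
    finally have aV: "a \<le> bergman_diag \<Omega> z * ?\<mu> ?P" .
    have Ck: "bergman_diag \<Omega> w \<le> C3 * bergman_diag \<Omega> z" if w: "w \<in> \<Omega>" "\<Phi> z w \<in> ?P" for w
    proof -
      have "bergman_diag \<Omega> w \<le> M\<^sup>2 * bergman_diag ?D (\<Phi> z w)" by (rule diag(2)[OF w(1)])
      also have "\<dots> \<le> M\<^sup>2 * (C2 * bergman_diag ?D (\<Phi> z z))"
        using Pk[OF w(2)] by (intro mult_left_mono) auto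
      also have "\<dots> \<le> M\<^sup>2 * (C2 * (bergman_diag \<Omega> z / M'\<^sup>2))"
        using diag(1)[OF z] C2 by (intro mult_left_mono) auto
      finally show ?thesis by (simp add: C3_def)
    qed
    have "(?\<mu> ?P)\<^sup>2 * (C3 * bergman_diag \<Omega> z) powr (- \<alpha>) * (bergman_diag \<Omega> z)\<^sup>2
        \<le> 2 * M ^ 4 * A * sqrt C3 * bergman_diag \<Omega> z * (?\<mu> ?P / M'\<^sup>2) powr (1 + 1/p - 1/q)"
    proof (rule toeplitz_local_estimate[where F = "\<Phi> z", OF op bdd cont assms(6) q assms(5)])
      show "compact ?P" by (intro compact_B_polydisc bpos)
      show "complex_balanced (\<Phi> z z) ?P" by (intro complex_balanced_B_polydisc bpos)
    qed (use A0 TA A z PD P0 F M' jac C3 Ck in auto)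
    then show ?thesis
      unfolding X_def E_def
      by (intro exponent_estimate[where V = "?\<mu> ?P"] P0 a C3 aV \<beta>1 bergman_diag_pos[OF op bdd z])
        (use M' in \<open>auto simp: \<beta>_def add_diff_eq\<close>)
  qed
  show ?thesis
  proof (rule ccontr)
    assume "\<not> ?thesis"
    then have \<beta>\<alpha>: "\<beta> - \<alpha> > 0" by (simp add: \<beta>_def)
    \<comment> \<open>The absolute value and the summand 1 make \<open>?Y\<close> positive and
      strictly larger than the bound it is compared with.\<close>
    let ?Y = "\<bar>X / a powr (1 - \<beta>)\<bar> + 1"
    obtain z where z: "z \<in> \<Omega>" "infdist z (frontier \<Omega>) < min \<epsilon>1 \<epsilon>2"
      "?Y powr (1 / (\<beta> - \<alpha>)) \<le> bergman_diag \<Omega> z"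
      using bergman_diag_unbounded[OF assms(1), of "min \<epsilon>1 \<epsilon>2"] \<epsilon>1 \<epsilon>2 by auto
    have "?Y = (?Y powr (1 / (\<beta> - \<alpha>))) powr (\<beta> - \<alpha>)"
      using \<beta>\<alpha> by (simp add: powr_powr)
    also have "\<dots> \<le> bergman_diag \<Omega> z powr (\<beta> - \<alpha>)"
      using z(3) \<beta>\<alpha> by (intro powr_mono2) auto
    also have "\<dots> \<le> X / a powr (1 - \<beta>)"
      using local[OF z(1,2)] a by (simp add: pos_le_divide_eq mult.commute)
    finally show False by linarith
  qed
qed

end
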